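(* Suppose that $A$ and $B$ are compact, Ahlfors-David regular, Borel subsets of $\mathbb{R}^d$, $d\ge 2$, of Hausdorff dimension $s_A$ and $s_B$ respectively, which satisfy $s_A+s_B\ge d$. Let $\mu$ be a compactly supported probability measure on $\mathbb{R}^d$ with $I^\alpha(\mu)<\infty$. Furthermore, suppose that $B$ satisfies the hyperplane size condition of order $h<s_B$ and $$\frac{\alpha+s_A}{2}>d-(s_B-h).$$ Let $\lambda_t(x)$ denote the lower Minkowski dimension of $A\cap(x-tB)$, and let $N(x,t,\epsilon)$ be the minimum number of open $\epsilon$-balls needed to cover $A\cap(x-tB)$. Then, with a constant $C$ independent of $\epsilon>0$, $$\int\int_1^2N(x,t,\epsilon)\,dt\,d\mu(x)\le C\,(\epsilon^{-1})^{s_A+s_B-d}.$$ It follows that $$\lambda_t(x)\le s_A+s_B-d$$ almost everywhere with respect to the probability measure $dt\,d\mu(x)$, $t\in[1,2]$. Finally, for almost every $t\in[1,2]$, $$\dim_{\mathcal H}\left(\left\{x:\int_1^2\lambda_t(x)\,dt>s_A+s_B-d\right\}\right)\le 2(d-(s_B-h))-s_A.$$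
   Context: A Borel set $E\subset\mathbb{R}^d$ of Hausdorff dimension $s_E$ is Ahlfors-David regular if there is $C>0$ such that $C^{-1}\delta^{s_E}\le\mu(B(x,\delta))\le C\delta^{s_E}$ for all $x\in E$ and all $0<\delta<\mathrm{diam}(E)$, where $\mu$ is the ($s_E$-dimensional) Hausdorff measure restricted to $E$ and $B(x,\delta)$ is the ball of radius $\delta$ centered at $x$. A Borel and compact set $B\subset\mathbb{R}^d$ of Hausdorff dimension $s_B$ satisfies the hyperplane size condition of order $h$, for some $s_B>h>0$, if there exists a Borel measure $\mu_B$ supported in $B$ such that $\mu_B(H_\omega^\delta)\le C\delta^{s_B-h}$ (with a constant $C$ uniform over unit vectors $\omega$ and $\delta>0$), where $H_\omega=\{x\in\mathbb{R}^d:x\cdot\omega=0\}$ and $H_\omega^\delta$ is its open $\delta$-neighborhood. $x-tB=\{x-tb:b\in B\}$. For a compactly supported measure $\nu$ on $\mathbb{R}^d$, $I^s(\nu)=\iint|x-y|^{-s}\,d\nu(x)\,d\nu(y)$. $\dim_{\mathcal H}$ is Hausdorff dimension. The lower Minkowski dimension of a nonempty bounded set $E$ is $\liminf_{\epsilon\downarrow 0}\frac{\log N_E(\epsilon)}{\log(1/\epsilon)}$, where $N_E(\epsilon)$ is the minimum number of open $\epsilon$-balls needed to cover $E$; the empty set needs $0$ balls and is assigned dimension $0$.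
   Formalization: The measure μ_B in the hyperplane size condition is required to be Ahlfors-David regular on B with exponent s_B (the zero measure, or one missing a flat piece of B, would make the claim false), and the integral bound is stated for 0 < ε ≤ 1, since for large ε it fails. *)

theory Defs
  imports "HOL-Probability.Probability"
begin

(* Hausdorff measure without normalising constant.  The cases s = 0 and U = {} are separated
   because 0 powr 0 = 0 in Isabelle, whereas H^0 has to be the counting measure.  Covering sets
   are required to be bounded because diameter is only meaningful for bounded sets. *)

definition diam_power :: "real \<Rightarrow> 'a::metric_space set \<Rightarrow> ennreal" where
  "diam_power s U =
     (if U = {} then 0 else if s = 0 then 1 else ennreal (diameter U powr s))"

definition hausdorff_pre :: "real \<Rightarrow> real \<Rightarrow> 'a::metric_space set \<Rightarrow> ennreal" where
  "hausdorff_pre s \<delta> E =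
     Inf {(\<Sum>n. diam_power s (U n)) | U :: nat \<Rightarrow> 'a set.
            E \<subseteq> (\<Union>n. U n) \<and> (\<forall>n. bounded (U n) \<and> diameter (U n) \<le> \<delta>)}"

definition hausdorff_measure :: "real \<Rightarrow> 'a::metric_space set \<Rightarrow> ennreal" where
  "hausdorff_measure s E = (SUP \<delta>\<in>{0<..}. hausdorff_pre s \<delta> E)"

definition hausdorff_dim :: "'a::metric_space set \<Rightarrow> ereal" where
  "hausdorff_dim E = Inf (ereal ` {s. 0 \<le> s \<and> hausdorff_measure s E = 0})"

definition ahlfors_david_bounds ::
  "real \<Rightarrow> 'a::metric_space set \<Rightarrow> ('a set \<Rightarrow> ennreal) \<Rightarrow> bool" where
  "ahlfors_david_bounds s E m \<longleftrightarrow>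
     (\<exists>C>0. \<forall>x\<in>E. \<forall>\<delta>. 0 < \<delta> \<and> \<delta> < diameter E \<longrightarrow>
        ennreal (inverse C * \<delta> powr s) \<le> m (ball x \<delta>) \<and>
        m (ball x \<delta>) \<le> ennreal (C * \<delta> powr s))"

definition ahlfors_david_regular :: "real \<Rightarrow> 'a::metric_space set \<Rightarrow> bool" where
  "ahlfors_david_regular s E \<longleftrightarrow>
     E \<in> sets borel \<and> hausdorff_dim E = ereal s \<and>
     ahlfors_david_bounds s E (\<lambda>S. hausdorff_measure s (E \<inter> S))"

definition hyperplane :: "'a::euclidean_space \<Rightarrow> 'a set" where
  "hyperplane \<omega> = {x. x \<bullet> \<omega> = 0}"

definition open_nbhd :: "real \<Rightarrow> 'a::metric_space set \<Rightarrow> 'a set" where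
  "open_nbhd \<delta> S = (\<Union>x\<in>S. ball x \<delta>)"

definition borel_measure_supported_in ::
  "'a::topological_space measure \<Rightarrow> 'a set \<Rightarrow> bool" where
  "borel_measure_supported_in M S \<longleftrightarrow> sets M = sets borel \<and> emeasure M (- S) = 0"

definition hyperplane_size_bound ::
  "real \<Rightarrow> 'a::euclidean_space measure \<Rightarrow> bool" where
  "hyperplane_size_bound p M \<longleftrightarrow>
     (\<exists>C::real. \<forall>\<omega> \<delta>. norm \<omega> = 1 \<and> 0 < \<delta> \<longrightarrow>
        emeasure M (open_nbhd \<delta> (hyperplane \<omega>)) \<le> ennreal (C * \<delta> powr p))"

(* The measure witnessing the hyperplane size condition is taken to be an Ahlfors-David regular
   measure of exponent s on B (for instance, Hausdorff measure restricted to B).  With an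
   arbitrary Borel measure supported in B the condition would be void, being satisfied by the
   zero measure; and a nonzero measure may still miss a piece of B lying in a hyperplane. *)

definition hyperplane_size_condition ::
  "real \<Rightarrow> real \<Rightarrow> 'a::euclidean_space set \<Rightarrow> bool" where
  "hyperplane_size_condition s h B \<longleftrightarrow>
     B \<in> sets borel \<and> compact B \<and> hausdorff_dim B = ereal s \<and> 0 < h \<and> h < s \<and>
     (\<exists>M. borel_measure_supported_in M B \<and> ahlfors_david_bounds s B (emeasure M) \<and>
          hyperplane_size_bound (s - h) M)"

(* The inverse is taken in ennreal so that, for s > 0, the kernel is infinite on the diagonal
   (0 powr (- s) would be 0). *)

definition riesz_energy :: "real \<Rightarrow> 'a::metric_space measure \<Rightarrow> ennreal" where
  "riesz_energy s M = (\<integral>\<^sup>+x. (\<integral>\<^sup>+y. inverse (ennreal (dist x y powr s)) \<partial>M) \<partial>M)"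

(* Only meaningful for totally bounded E. *)

definition covering_number :: "'a::metric_space set \<Rightarrow> real \<Rightarrow> nat" where
  "covering_number E \<epsilon> =
     (LEAST n. \<exists>F. finite F \<and> card F = n \<and> E \<subseteq> (\<Union>x\<in>F. ball x \<epsilon>))"

definition lower_minkowski_dim :: "'a::metric_space set \<Rightarrow> ereal" where
  "lower_minkowski_dim E =
     (if E = {} then 0
      else Liminf (at_right 0) (\<lambda>\<epsilon>. ereal (ln (real (covering_number E \<epsilon>)) / ln (1 / \<epsilon>))))"

definition slice :: "'a::real_vector set \<Rightarrow> 'a set \<Rightarrow> 'a \<Rightarrow> real \<Rightarrow> 'a set" where
  "slice A B x t = A \<inter> (\<lambda>b. x - t *\<^sub>R b) ` B"

end

(* The inner t-average is bounded, up to constants, by eps^(-s_A-s_B) times the mass of the triples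
   (t,a,b) with |x - a - tb| of order eps. Replace the cutoffs by Gaussians, also in t.
   In frequency space the average over t and b is then multiplication by
   m(xi) = int exp(-(b.xi)^2/2) dM(b) >= 0, and the hyperplane size condition makes
   m(xi) decay like |xi|^(-p), p = s_B - h. Writing this decay as an integral of Gaussians
   exp(-r^2 |xi|^2/2) against r^(p-1) dr, Cauchy-Schwarz for each r reduces everything to the Gaussian
   energies at scale r of mu and of A, which are controlled by I^alpha(mu) and by regularity. The
   resulting integral in r converges exactly when (alpha + s_A)/2 > d - p.
   The Hausdorff measure on A enters only through counts of eps-separated subsets, for which its
   superadditivity on separated pieces suffices.
   The almost everywhere bound follows by Fatou along eps = 2^(-k). A point x of the exceptional set has,
   for all large k, a t-average exceeding the bound by a factor 2^(k eta). For each such k a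
   discrete Frostman measure on a 2^(-k)-net of these points has the energy needed for the same estimate, which
   bounds its mass, hence the Hausdorff content of the set, by a power of 2^(-k). *)

theory Submission
  imports Defs
begin

section \<open>Fourier transform of Gaussians\<close>

text \<open>One inequality has to serve two kinds of measures: the given \<mu>, and nonzero measures
  on finite nets, whose Riesz energy of positive order is infinite. This is why energies are
  measured with Gaussian kernels at scales between \<epsilon> and 2 only, and why the estimate is
  uniform over all measures, with the energy constant L entering as \<open>sqrt L\<close>. For a net
  measure of mass W the constant L is of order W, so the inequality compares W with
  \<open>sqrt W\<close> and can be solved for W. No measurability is established for covering
  numbers or for the exceptional set: a jointly measurable majorant \<open>D\<close> replaces the
  former, and contents of finite covers replace a Frostman measure on the latter. The normal law in
  t has a positive characteristic function, so the multiplier does not oscillate, and Gaussians with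
  parameters r and \<epsilon> multiply to one with parameter
  \<open>sqrt (r^2 + \<epsilon>^2)\<close>. A dimension is never negative, so the last bound also
  requires 2(d - p) >= s_A. This comes from s_A <= d and from p <= 1, which the hyperplane bound
  forces on a nonzero measure of bounded support in dimension at least two.\<close>

lemma gaussian_fourier_real:
  fixes \<rho> z :: real
  assumes "\<rho> > 0"
  shows "has_bochner_integral lborel
           (\<lambda>s. complex_of_real (exp (- (\<rho> * s)\<^sup>2 / 2)) * iexp (z * s))
           (complex_of_real (sqrt (2 * pi) / \<rho> * exp (- (z / \<rho>)\<^sup>2 / 2)))"
proof -
  have int: "integrable std_normal_distribution (\<lambda>s. iexp (z / \<rho> * s))"
    by (intro finite_measure.integrable_const_bound[where B = 1] prob_space.finite_measure prob_space_normal_density) auto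
  have char: "(CLINT s|std_normal_distribution. iexp (z / \<rho> * s)) = complex_of_real (exp (- (z / \<rho>)\<^sup>2 / 2))"
    using fun_cong[OF char_std_normal_distribution, of "z / \<rho>"] by (simp add: char_def)
  have 1: "has_bochner_integral lborel (\<lambda>s. std_normal_density s *\<^sub>R iexp (z / \<rho> * s))
          (complex_of_real (exp (- (z / \<rho>)\<^sup>2 / 2)))"
    unfolding has_bochner_integral_iff
  proof
    show "integrable lborel (\<lambda>s. std_normal_density s *\<^sub>R iexp (z / \<rho> * s))"
      using int by (subst (asm) integrable_density) auto
    show "(\<integral>s. std_normal_density s *\<^sub>R iexp (z / \<rho> * s) \<partial>lborel) = complex_of_real (exp (- (z / \<rho>)\<^sup>2 / 2))"
      using char by (subst (asm) integral_density) auto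
  qed
  have "has_bochner_integral lborel (\<lambda>s. sqrt (2 * pi) *\<^sub>R (std_normal_density s *\<^sub>R iexp (z / \<rho> * s)))
          (sqrt (2 * pi) *\<^sub>R complex_of_real (exp (- (z / \<rho>)\<^sup>2 / 2)))"
    by (intro has_bochner_integral_scaleR_right 1)
  then have "has_bochner_integral lborel (\<lambda>s. complex_of_real (exp (- s\<^sup>2 / 2)) * iexp (z / \<rho> * s))
          (sqrt (2 * pi) *\<^sub>R complex_of_real (exp (- (z / \<rho>)\<^sup>2 / 2)))"
    by (simp add: std_normal_density_def scaleR_conv_of_real)
  \<comment> \<open>Substitution by \<open>\<rho> * s\<close>; the summand 0 is the shift of the
    affine change of variables.\<close>
  then have "has_bochner_integral lborel (\<lambda>s. complex_of_real (exp (- (0 + \<rho> * s)\<^sup>2 / 2)) * iexp (z / \<rho> * (0 + \<rho> * s)))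
          ((sqrt (2 * pi) *\<^sub>R complex_of_real (exp (- (z / \<rho>)\<^sup>2 / 2))) /\<^sub>R \<bar>\<rho>\<bar>)"
    using assms by (subst (asm) lborel_has_bochner_integral_real_affine_iff[where c = \<rho> and t = 0]) auto
  then show ?thesis
    using assms by (simp add: scaleR_conv_of_real field_simps)
qed

text \<open>On a Euclidean space \<open>lborel\<close> is the image of a product of one-dimensional
  Lebesgue measures under the coordinate map, so integrals of product functions factor.\<close>

lemma integral_lborel_prod:
  fixes f :: "'a::euclidean_space \<Rightarrow> real \<Rightarrow> 'b::{real_normed_field, banach, second_countable_topology}"
  assumes "\<And>b. b \<in> Basis \<Longrightarrow> integrable lborel (f b)"
  shows "(\<integral>x. (\<Prod>b\<in>Basis. f b (x \<bullet> b)) \<partial>lborel) = (\<Prod>b\<in>Basis. integral\<^sup>L lborel (f b))"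
    and "integrable lborel (\<lambda>x::'a. \<Prod>b\<in>Basis. f b (x \<bullet> b))"
proof -
  interpret product_sigma_finite "\<lambda>b::'a. lborel :: real measure" ..
  have [measurable]: "f b \<in> borel_measurable borel" if "b \<in> Basis" for b
    using borel_measurable_integrable[OF assms[OF that]] by simp
  have meas: "(\<lambda>x::'a. \<Prod>b\<in>Basis. f b (x \<bullet> b)) \<in> borel_measurable borel"
    by measurable
  have eq: "(lborel :: 'a measure) = distr (Pi\<^sub>M Basis (\<lambda>b. lborel)) borel (\<lambda>f. \<Sum>b\<in>Basis. f b *\<^sub>R b)"
    by (subst lborel_def) (simp add: lborel_eq_real)
  have coord: "(\<Sum>b\<in>Basis. g b *\<^sub>R b) \<bullet> c = g c" if "c \<in> Basis" for g :: "'a \<Rightarrow> real" and c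
    using that by simp
  have map: "(\<lambda>f. \<Sum>b\<in>Basis. f b *\<^sub>R b) \<in> measurable (Pi\<^sub>M Basis (\<lambda>b::'a. lborel :: real measure)) borel"
    by measurable
  show "(\<integral>x. (\<Prod>b\<in>Basis. f b (x \<bullet> b)) \<partial>lborel) = (\<Prod>b\<in>Basis. integral\<^sup>L lborel (f b))"
    by (subst eq, subst integral_distr[OF map meas])
       (simp add: coord product_integral_prod[OF finite_Basis assms])
  show "integrable lborel (\<lambda>x::'a. \<Prod>b\<in>Basis. f b (x \<bullet> b))"
    by (subst eq, subst integrable_distr_eq[OF map meas])
       (simp add: coord product_integrable_prod[OF finite_Basis assms])
qed

text \<open>Both the Gaussian and the character split over the coordinates, which reduces the
  complex integral to dimension one. Its value is real, so passing to real parts keeps the value and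
  leaves a cosine.\<close>

lemma gaussian_fourier:
  fixes z :: "'a::euclidean_space"
  assumes "\<rho> > 0"
  shows "has_bochner_integral lborel (\<lambda>\<xi>. exp (- (\<rho> * norm \<xi>)\<^sup>2 / 2) * cos (z \<bullet> \<xi>))
           ((sqrt (2 * pi) / \<rho>) ^ DIM('a) * exp (- (norm z / \<rho>)\<^sup>2 / 2))"
proof -
  define f where "f = (\<lambda>(b::'a) s. complex_of_real (exp (- (\<rho> * s)\<^sup>2 / 2)) * iexp ((z \<bullet> b) * s))"
  have hb: "has_bochner_integral lborel (f b)
      (complex_of_real (sqrt (2 * pi) / \<rho> * exp (- ((z \<bullet> b) / \<rho>)\<^sup>2 / 2)))" for b
    unfolding f_def by (rule gaussian_fourier_real[OF assms])
  have norm2: "(\<Sum>b\<in>Basis. (x \<bullet> b)\<^sup>2) = (norm x)\<^sup>2" for x :: 'a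
    by (simp add: power2_norm_eq_inner euclidean_inner[of x x] power2_eq_square[of "x \<bullet> _"])
  have prod_f: "(\<Prod>b\<in>Basis. f b (\<xi> \<bullet> b)) = complex_of_real (exp (- (\<rho> * norm \<xi>)\<^sup>2 / 2)) * iexp (z \<bullet> \<xi>)" for \<xi>
  proof -
    have "(\<Prod>b\<in>Basis. f b (\<xi> \<bullet> b)) = (\<Prod>b\<in>Basis. exp (complex_of_real (- (\<rho> * (\<xi> \<bullet> b))\<^sup>2 / 2) + \<i> * complex_of_real ((z \<bullet> b) * (\<xi> \<bullet> b))))"
      by (simp only: f_def exp_add exp_of_real)
    also have "\<dots> = exp (\<Sum>b\<in>Basis. (complex_of_real (- (\<rho> * (\<xi> \<bullet> b))\<^sup>2 / 2) + \<i> * complex_of_real ((z \<bullet> b) * (\<xi> \<bullet> b))))"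
      by (simp add: exp_sum)
    also have "(\<Sum>b\<in>Basis. (complex_of_real (- (\<rho> * (\<xi> \<bullet> b))\<^sup>2 / 2) + \<i> * complex_of_real ((z \<bullet> b) * (\<xi> \<bullet> b))))
       = complex_of_real (\<Sum>b\<in>Basis. - (\<rho> * (\<xi> \<bullet> b))\<^sup>2 / 2) + \<i> * complex_of_real (\<Sum>b\<in>Basis. (z \<bullet> b) * (\<xi> \<bullet> b))"
      by (simp only: sum.distrib of_real_sum sum_distrib_left)
    also have "(\<Sum>b\<in>Basis. - (\<rho> * (\<xi> \<bullet> b))\<^sup>2 / 2) = - (\<rho> * norm \<xi>)\<^sup>2 / 2"
      by (simp add: norm2[symmetric] power_mult_distrib sum_distrib_left sum_negf sum_divide_distrib)
    also have "(\<Sum>b\<in>Basis. (z \<bullet> b) * (\<xi> \<bullet> b)) = z \<bullet> \<xi>"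
      by (simp add: euclidean_inner[of z \<xi>])
    finally show ?thesis by (simp only: exp_add exp_of_real)
  qed
  have "(\<Prod>b\<in>Basis. integral\<^sup>L lborel (f b)) =
      (\<Prod>b\<in>(Basis::'a set). complex_of_real (sqrt (2 * pi) / \<rho> * exp (- ((z \<bullet> b) / \<rho>)\<^sup>2 / 2)))"
    by (intro prod.cong refl has_bochner_integral_integral_eq[OF hb])
  also have "\<dots> = complex_of_real ((sqrt (2 * pi) / \<rho>) ^ DIM('a) * exp (\<Sum>b\<in>Basis. - ((z \<bullet> b) / \<rho>)\<^sup>2 / 2))"
    unfolding of_real_prod[symmetric] prod.distrib by (simp add: exp_sum)
  also have "(\<Sum>b\<in>Basis. - ((z \<bullet> b) / \<rho>)\<^sup>2 / 2) = - (norm z / \<rho>)\<^sup>2 / 2"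
    by (simp add: norm2[symmetric] power_divide sum_negf sum_divide_distrib)
  finally have val: "(\<Prod>b\<in>Basis. integral\<^sup>L lborel (f b)) =
     complex_of_real ((sqrt (2 * pi) / \<rho>) ^ DIM('a) * exp (- (norm z / \<rho>)\<^sup>2 / 2))" .
  have fi: "integrable lborel (f b)" for b
    using hb by (rule integrable.intros)
  note pr = integral_lborel_prod[of f, OF fi]
  have "has_bochner_integral lborel (\<lambda>\<xi>::'a. complex_of_real (exp (- (\<rho> * norm \<xi>)\<^sup>2 / 2)) * iexp (z \<bullet> \<xi>))
     (complex_of_real ((sqrt (2 * pi) / \<rho>) ^ DIM('a) * exp (- (norm z / \<rho>)\<^sup>2 / 2)))"
    using has_bochner_integral_integrable[OF pr(2)] trans[OF pr(1) val] unfolding prod_f by simp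
  from has_bochner_integral_bounded_linear[OF bounded_linear_Re this]
  show ?thesis by (simp add: Re_exp exp_of_real[symmetric] del: of_real_exp)
qed

section \<open>Gaussian energies\<close>

text \<open>Together with \<open>sin_transform\<close> the real and imaginary parts of the Fourier
  transform of \<mu>, with the sign convention exp(i x.\<xi>). Keeping them apart makes all later
  integrands real.\<close>

definition cos_transform :: "'a::euclidean_space measure \<Rightarrow> 'a \<Rightarrow> real" where
  "cos_transform \<mu> \<xi> = (\<integral>x. cos (x \<bullet> \<xi>) \<partial>\<mu>)"

definition sin_transform :: "'a::euclidean_space measure \<Rightarrow> 'a \<Rightarrow> real" where
  "sin_transform \<mu> \<xi> = (\<integral>x. sin (x \<bullet> \<xi>) \<partial>\<mu>)"

text \<open>Real part of the Fourier transform of \<mu> times the conjugate of that of \<nu>; for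
  \<mu> = \<nu> it is the squared modulus \<open>spectrum\<close>.\<close>

definition cross_spectrum :: "'a::euclidean_space measure \<Rightarrow> 'a measure \<Rightarrow> 'a \<Rightarrow> real" where
  "cross_spectrum \<mu> \<nu> \<xi> =
     cos_transform \<mu> \<xi> * cos_transform \<nu> \<xi> + sin_transform \<mu> \<xi> * sin_transform \<nu> \<xi>"

definition spectrum :: "'a::euclidean_space measure \<Rightarrow> 'a \<Rightarrow> real" where
  "spectrum \<mu> \<xi> = (cos_transform \<mu> \<xi>)\<^sup>2 + (sin_transform \<mu> \<xi>)\<^sup>2"

text \<open>A smooth count of the pairs at distance of order at most \<rho>, chosen so that its
  Fourier side is again a Gaussian.\<close>

definition gauss_energy :: "'a::euclidean_space measure \<Rightarrow> 'a measure \<Rightarrow> real \<Rightarrow> ennreal" where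
  "gauss_energy \<mu> \<nu> \<rho> = (\<integral>\<^sup>+x. (\<integral>\<^sup>+y. ennreal (exp (- (norm (x - y) / \<rho>)\<^sup>2 / 2)) \<partial>\<nu>) \<partial>\<mu>)"

lemma transform_integrable:
  fixes \<mu> :: "'a::euclidean_space measure"
  assumes "finite_measure \<mu>" "sets \<mu> = sets borel"
  shows "integrable \<mu> (\<lambda>x. cos (x \<bullet> \<xi>))" "integrable \<mu> (\<lambda>x. sin (x \<bullet> \<xi>))"
proof -
  note [measurable_cong] = assms(2)
  have [measurable]: "(\<lambda>x::'a. cos (x \<bullet> \<xi>)) \<in> borel_measurable borel"
      "(\<lambda>x::'a. sin (x \<bullet> \<xi>)) \<in> borel_measurable borel"
    by (intro borel_measurable_continuous_onI continuous_intros)+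
  show "integrable \<mu> (\<lambda>x. cos (x \<bullet> \<xi>))"
    by (rule finite_measure.integrable_const_bound[OF assms(1), where B = 1]) auto
  show "integrable \<mu> (\<lambda>x. sin (x \<bullet> \<xi>))"
    by (rule finite_measure.integrable_const_bound[OF assms(1), where B = 1]) auto
qed

lemma transform_measurable [measurable]:
  assumes "finite_measure \<mu>" "sets \<mu> = sets borel"
  shows "cos_transform \<mu> \<in> borel_measurable borel" "sin_transform \<mu> \<in> borel_measurable borel"
    "spectrum \<mu> \<in> borel_measurable borel"
proof -
  interpret finite_measure \<mu> by fact
  note [measurable_cong] = assms(2)
  show 1: "cos_transform \<mu> \<in> borel_measurable borel" and 2: "sin_transform \<mu> \<in> borel_measurable borel"
    unfolding cos_transform_def[abs_def] sin_transform_def[abs_def] by measurable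
  show "spectrum \<mu> \<in> borel_measurable borel"
    unfolding spectrum_def[abs_def] using 1 2 by measurable
qed

lemma cos_transform_difference:
  assumes \<mu>: "finite_measure \<mu>" "sets \<mu> = sets borel"
    and \<nu>: "finite_measure \<nu>" "sets \<nu> = sets borel"
  shows "(\<integral>x. (\<integral>y. cos ((x - y) \<bullet> \<xi>) \<partial>\<nu>) \<partial>\<mu>)
       = cross_spectrum \<mu> \<nu> \<xi>"
proof -
  note i = transform_integrable[OF \<mu>] transform_integrable[OF \<nu>]
  have "(\<integral>y. cos ((x - y) \<bullet> \<xi>) \<partial>\<nu>) = cos (x \<bullet> \<xi>) * cos_transform \<nu> \<xi> + sin (x \<bullet> \<xi>) * sin_transform \<nu> \<xi>" for x
    using i by (simp add: inner_diff_left cos_diff cos_transform_def sin_transform_def)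
  then show ?thesis
    using i by (simp add: cross_spectrum_def cos_transform_def[of \<mu>] sin_transform_def[of \<mu>])
qed

text \<open>Write the Gaussian kernel as a Fourier integral and exchange the integrals; the Gaussian
  in \<xi> dominates, since the cosines are bounded and both measures are finite. For \<mu> \<noteq>
  \<nu> the integrand may change sign, hence the Bochner integral.\<close>

lemma gauss_energy_fourier:
  fixes \<mu> \<nu> :: "'a::euclidean_space measure"
  assumes \<mu>: "finite_measure \<mu>" "sets \<mu> = sets borel"
    and \<nu>: "finite_measure \<nu>" "sets \<nu> = sets borel" and "\<rho> > 0"
  shows "integrable lborel (\<lambda>\<xi>. exp (- (\<rho> * norm \<xi>)\<^sup>2 / 2) *
           cross_spectrum \<mu> \<nu> \<xi>)"
    and "gauss_energy \<mu> \<nu> \<rho> = ennreal ((\<rho> / sqrt (2 * pi)) ^ DIM('a) *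
           (\<integral>\<xi>. exp (- (\<rho> * norm \<xi>)\<^sup>2 / 2) *
             cross_spectrum \<mu> \<nu> \<xi> \<partial>lborel))"
proof -
  interpret m: finite_measure \<mu> by fact
  interpret n: finite_measure \<nu> by fact
  note [measurable_cong] = \<mu>(2) \<nu>(2)
  interpret mn: pair_sigma_finite \<mu> \<nu> ..
  interpret P: finite_measure "\<mu> \<Otimes>\<^sub>M \<nu>"
    by (rule finite_measure_pair_measure) fact+
  interpret PL: pair_sigma_finite "\<mu> \<Otimes>\<^sub>M \<nu>" "lborel :: 'a measure" ..
  define g where "g = (\<lambda>\<xi>::'a. exp (- (\<rho> * norm \<xi>)\<^sup>2 / 2))"
  define c where "c = (sqrt (2 * pi) / \<rho>) ^ DIM('a)"
  have c: "c > 0" using \<open>\<rho> > 0\<close> by (simp add: c_def)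
  have [measurable]: "g \<in> borel_measurable borel" unfolding g_def by measurable
  have g: "integrable lborel g"
    using gaussian_fourier[OF \<open>\<rho> > 0\<close>, of 0] by (auto simp: g_def has_bochner_integral_iff)
  let ?f = "\<lambda>p \<xi>. g \<xi> * cos ((fst p - snd p) \<bullet> \<xi>)"
  have "integrable ((\<mu> \<Otimes>\<^sub>M \<nu>) \<Otimes>\<^sub>M lborel) (\<lambda>(p, \<xi>). g \<xi>)"
    using g by (intro PL.Fubini_integrable) auto
  have f: "integrable ((\<mu> \<Otimes>\<^sub>M \<nu>) \<Otimes>\<^sub>M lborel) (\<lambda>(p, \<xi>). ?f p \<xi>)"
    by (rule Bochner_Integration.integrable_bound[OF \<open>integrable _ (\<lambda>(p, \<xi>). g \<xi>)\<close>])
       (auto simp: abs_mult g_def)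
  have P_cos: "integrable (\<mu> \<Otimes>\<^sub>M \<nu>) (\<lambda>p. cos ((fst p - snd p) \<bullet> \<xi>))" for \<xi>
    by (rule P.integrable_const_bound[where B = 1]) auto
  have "(\<integral>p. cos ((fst p - snd p) \<bullet> \<xi>) \<partial>(\<mu> \<Otimes>\<^sub>M \<nu>))
      = cross_spectrum \<mu> \<nu> \<xi>" for \<xi>
    using mn.integral_fst'[OF P_cos, of \<xi>] cos_transform_difference[OF \<mu> \<nu>, of \<xi>] by simp
  then have inner: "(\<integral>p. ?f p \<xi> \<partial>(\<mu> \<Otimes>\<^sub>M \<nu>))
      = g \<xi> * cross_spectrum \<mu> \<nu> \<xi>" for \<xi>
    by simp
  have "integrable lborel (\<lambda>\<xi>. \<integral>p. ?f p \<xi> \<partial>(\<mu> \<Otimes>\<^sub>M \<nu>))"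
    using PL.integrable_snd[OF f] by simp
  then show "integrable lborel (\<lambda>\<xi>. exp (- (\<rho> * norm \<xi>)\<^sup>2 / 2) *
           cross_spectrum \<mu> \<nu> \<xi>)"
    unfolding inner by (simp add: g_def)
  have gi: "(\<integral>\<xi>. ?f p \<xi> \<partial>lborel) = c * exp (- (norm (fst p - snd p) / \<rho>)\<^sup>2 / 2)" for p
    using has_bochner_integral_integral_eq[OF gaussian_fourier[OF \<open>\<rho> > 0\<close>, of "fst p - snd p"]]
    by (simp add: g_def c_def)
  have Pexp: "integrable (\<mu> \<Otimes>\<^sub>M \<nu>) (\<lambda>p. exp (- (norm (fst p - snd p) / \<rho>)\<^sup>2 / 2))"
    by (rule P.integrable_const_bound[where B = 1]) auto
  have "(\<integral>\<xi>. (\<integral>p. ?f p \<xi> \<partial>(\<mu> \<Otimes>\<^sub>M \<nu>)) \<partial>lborel) = (\<integral>p. (\<integral>\<xi>. ?f p \<xi> \<partial>lborel) \<partial>(\<mu> \<Otimes>\<^sub>M \<nu>))"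
    by (rule PL.Fubini_integral[OF f])
  also have "\<dots> = c * (\<integral>p. exp (- (norm (fst p - snd p) / \<rho>)\<^sup>2 / 2) \<partial>(\<mu> \<Otimes>\<^sub>M \<nu>))"
    unfolding gi by simp
  finally have *: "(\<integral>p. exp (- (norm (fst p - snd p) / \<rho>)\<^sup>2 / 2) \<partial>(\<mu> \<Otimes>\<^sub>M \<nu>)) =
     (\<integral>\<xi>. g \<xi> * cross_spectrum \<mu> \<nu> \<xi> \<partial>lborel) / c"
    unfolding inner using c by (simp add: field_simps)
  have "gauss_energy \<mu> \<nu> \<rho> = (\<integral>\<^sup>+p. ennreal (exp (- (norm (fst p - snd p) / \<rho>)\<^sup>2 / 2)) \<partial>(\<mu> \<Otimes>\<^sub>M \<nu>))"
    unfolding gauss_energy_def by (subst n.nn_integral_fst[symmetric]) auto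
  also have "\<dots> = ennreal (\<integral>p. exp (- (norm (fst p - snd p) / \<rho>)\<^sup>2 / 2) \<partial>(\<mu> \<Otimes>\<^sub>M \<nu>))"
    using Pexp by (intro nn_integral_eq_integral) auto
  also have "\<dots> = ennreal ((\<rho> / sqrt (2 * pi)) ^ DIM('a) *
           (\<integral>\<xi>. g \<xi> * cross_spectrum \<mu> \<nu> \<xi> \<partial>lborel))"
    unfolding * c_def using \<open>\<rho> > 0\<close> by (simp add: field_simps)
  finally show "gauss_energy \<mu> \<nu> \<rho> = ennreal ((\<rho> / sqrt (2 * pi)) ^ DIM('a) *
           (\<integral>\<xi>. exp (- (\<rho> * norm \<xi>)\<^sup>2 / 2) *
             cross_spectrum \<mu> \<nu> \<xi> \<partial>lborel))"
    by (simp add: g_def)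
qed

lemma spectrum_eq: "spectrum \<mu> \<xi> = cross_spectrum \<mu> \<mu> \<xi>"
  by (simp add: spectrum_def cross_spectrum_def power2_eq_square)

lemma spectrum_nonneg [simp]: "0 \<le> spectrum \<mu> \<xi>"
  by (simp add: spectrum_def)

text \<open>The diagonal case has a nonnegative integrand; this is the form in which Cauchy-Schwarz
  consumes energies.\<close>

lemma gauss_energy_spectrum:
  fixes \<mu> :: "'a::euclidean_space measure"
  assumes \<mu>: "finite_measure \<mu>" "sets \<mu> = sets borel" and "\<rho> > 0"
  shows "(\<integral>\<^sup>+\<xi>. ennreal (exp (- (\<rho> * norm \<xi>)\<^sup>2 / 2) * spectrum \<mu> \<xi>) \<partial>lborel)
       = ennreal ((sqrt (2 * pi) / \<rho>) ^ DIM('a)) * gauss_energy \<mu> \<mu> \<rho>"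
proof -
  note F = gauss_energy_fourier[OF \<mu> \<mu> \<open>\<rho> > 0\<close>, folded spectrum_eq]
  have "(\<integral>\<^sup>+\<xi>. ennreal (exp (- (\<rho> * norm \<xi>)\<^sup>2 / 2) * spectrum \<mu> \<xi>) \<partial>lborel)
     = ennreal (\<integral>\<xi>. exp (- (\<rho> * norm \<xi>)\<^sup>2 / 2) * spectrum \<mu> \<xi> \<partial>lborel)"
    using F(1) by (intro nn_integral_eq_integral) auto
  also have "\<dots> = ennreal ((sqrt (2 * pi) / \<rho>) ^ DIM('a)) * gauss_energy \<mu> \<mu> \<rho>"
    unfolding F(2) using \<open>\<rho> > 0\<close>
    by (subst ennreal_mult''[symmetric]) (auto simp: field_simps intro!: integral_nonneg_AE)
  finally show ?thesis .
qed

section \<open>Decay under the hyperplane size condition\<close>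

text \<open>Cost of summing a power bound of order s over unit layers against the Gaussian; see
  \<open>nn_integral_gaussian_layer\<close>.\<close>

definition layer_const :: "real \<Rightarrow> real" where
  "layer_const s = (\<Sum>k::nat. exp (- (real k)\<^sup>2 / 2) * (real k + 1) powr s)"

lemma powr_le_exp_half:
  fixes s x :: real
  assumes "0 < s" "0 \<le> x"
  shows "x powr s \<le> (2 * s) powr s * exp (x / 2)"
proof -
  have "x / (2 * s) \<le> exp (x / (2 * s))" using exp_ge_add_one_self[of "x / (2 * s)"] by linarith
  then have "(x / (2 * s)) powr s \<le> exp (x / (2 * s)) powr s"
    using assms by (intro powr_mono2) auto
  also have "\<dots> = exp (x / 2)" using assms by (simp add: powr_def)
  finally show ?thesis using assms by (simp add: powr_divide divide_le_eq mult.commute)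
qed

lemma summable_layer:
  assumes "0 \<le> s"
  shows "summable (\<lambda>k::nat. exp (- (real k)\<^sup>2 / 2) * (real k + 1) powr s)"
proof -
  \<comment> \<open>The elementary bound on powers needs a positive exponent, while s = 0 is allowed
    here.\<close>
  define s' where "s' = s + 1"
  have s': "s' > 0" using assms by (simp add: s'_def)
  have "norm (exp (- (real k)\<^sup>2 / 2) * (real k + 1) powr s) \<le> ((2 * s') powr s' * exp 1) * exp (-1/2) ^ k" for k
  proof -
    have "- (real k)\<^sup>2 / 2 \<le> 1 / 2 - real k"
      using zero_le_power2[of "real k - 1"] by (simp add: power2_eq_square algebra_simps)
    then have "exp (- (real k)\<^sup>2 / 2) \<le> exp (1 / 2 - real k)" by simp
    moreover have "(real k + 1) powr s \<le> (real k + 1) powr s'"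
      by (rule powr_mono) (auto simp: s'_def)
    then have "(real k + 1) powr s \<le> (2 * s') powr s' * exp ((real k + 1) / 2)"
      using powr_le_exp_half[OF s', of "real k + 1"] by simp
    ultimately have "exp (- (real k)\<^sup>2 / 2) * (real k + 1) powr s
        \<le> exp (1 / 2 - real k) * ((2 * s') powr s' * exp ((real k + 1) / 2))"
      by (intro mult_mono) auto
    also have "\<dots> = (2 * s') powr s' * exp ((1 / 2 - real k) + (real k + 1) / 2)"
      by (simp add: exp_add[symmetric] mult.left_commute)
    also have "(1 / 2 - real k) + (real k + 1) / 2 = 1 + real k * (- 1 / 2)" by (simp add: field_simps)
    also have "exp (1 + real k * (- 1 / 2)) = exp 1 * exp (-1/2 :: real) ^ k"
      by (simp only: exp_add exp_of_nat_mult)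
    finally show ?thesis by (simp add: mult.assoc)
  qed
  moreover have "summable (\<lambda>k::nat. ((2 * s') powr s' * exp 1) * exp (-1/2 :: real) ^ k)"
    by (intro summable_mult summable_geometric) simp
  ultimately show ?thesis by (rule summable_comparison_test'[rotated])
qed

lemma layer_const_pos: "0 \<le> s \<Longrightarrow> 0 < layer_const s"
  unfolding layer_const_def by (rule suminf_pos[OF summable_layer]) (auto intro!: mult_pos_pos)

text \<open>Cut the space into layers where \<open>f x / \<rho>\<close> lies in [k, k + 1). The mass
  bound is used only at the radii \<open>(real k + 1) * \<rho>\<close>, all at least \<rho>, so the
  lemma also serves measures that are regular only above some scale.\<close>

lemma nn_integral_gaussian_layer:
  assumes [measurable]: "f \<in> borel_measurable N" and f: "\<And>x. x \<in> space N \<Longrightarrow> 0 \<le> f x"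
    and s: "0 \<le> s" and C: "0 \<le> C" and \<rho>: "0 < \<rho>"
    and le: "\<And>r. \<rho> \<le> r \<Longrightarrow> emeasure N {x \<in> space N. f x < r} \<le> ennreal (C * r powr s)"
  shows "(\<integral>\<^sup>+x. ennreal (exp (- (f x / \<rho>)\<^sup>2 / 2)) \<partial>N) \<le> ennreal (C * layer_const s * \<rho> powr s)"
proof -
  let ?S = "\<lambda>k::nat. {x \<in> space N. f x < (real k + 1) * \<rho>}"
  let ?e = "\<lambda>k::nat. exp (- (real k)\<^sup>2 / 2)"
  have [measurable]: "?S k \<in> sets N" for k by measurable
  have pt: "ennreal (exp (- (f x / \<rho>)\<^sup>2 / 2)) \<le> (\<Sum>k. ennreal (?e k) * indicator (?S k) x)" if x: "x \<in> space N" for x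
  proof -
    define k where "k = nat \<lfloor>f x / \<rho>\<rfloor>"
    have q: "0 \<le> f x / \<rho>" using f[OF x] \<rho> by simp
    have k: "real k \<le> f x / \<rho>" "f x / \<rho> < real k + 1"
      using q by (auto simp: k_def)
    have "x \<in> ?S k" using k(2) \<rho> x by (simp add: divide_less_eq)
    moreover have "exp (- (f x / \<rho>)\<^sup>2 / 2) \<le> ?e k"
      using power_mono[OF k(1), of 2] by simp
    ultimately have "ennreal (exp (- (f x / \<rho>)\<^sup>2 / 2)) \<le> ennreal (?e k) * indicator (?S k) x"
      by (simp add: ennreal_leI)
    also have "\<dots> = (\<Sum>j\<in>{k}. ennreal (?e j) * indicator (?S j) x)"
      by (subst sum.insert) simp_all
    also have "\<dots> \<le> (\<Sum>k. ennreal (?e k) * indicator (?S k) x)"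
      by (rule sum_le_suminf) auto
    finally show ?thesis .
  qed
  have "(\<integral>\<^sup>+x. ennreal (exp (- (f x / \<rho>)\<^sup>2 / 2)) \<partial>N) \<le> (\<integral>\<^sup>+x. (\<Sum>k. ennreal (?e k) * indicator (?S k) x) \<partial>N)"
    by (rule nn_integral_mono) (rule pt)
  also have "\<dots> = (\<Sum>k. \<integral>\<^sup>+x. ennreal (?e k) * indicator (?S k) x \<partial>N)"
    by (rule nn_integral_suminf) measurable
  also have "\<dots> = (\<Sum>k. ennreal (?e k) * emeasure N (?S k))"
    by (subst nn_integral_cmult_indicator) auto
  also have "\<dots> \<le> (\<Sum>k. ennreal (C * \<rho> powr s * (?e k * (real k + 1) powr s)))"
  proof (intro suminf_le)
    fix k :: nat
    have "\<rho> \<le> (real k + 1) * \<rho>" using \<rho> by simp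
    then have "ennreal (?e k) * emeasure N (?S k) \<le> ennreal (?e k) * ennreal (C * ((real k + 1) * \<rho>) powr s)"
      by (intro mult_left_mono le) auto
    also have "((real k + 1) * \<rho>) powr s = (real k + 1) powr s * \<rho> powr s"
      using \<rho> by (simp add: powr_mult)
    also have "ennreal (?e k) * ennreal (C * ((real k + 1) powr s * \<rho> powr s))
        = ennreal (C * \<rho> powr s * (?e k * (real k + 1) powr s))"
      using C by (subst ennreal_mult''[symmetric]) (auto simp: mult_ac)
    finally show "ennreal (?e k) * emeasure N (?S k) \<le> ennreal (C * \<rho> powr s * (?e k * (real k + 1) powr s))" .
  qed auto
  also have "\<dots> = ennreal (\<Sum>k. C * \<rho> powr s * (?e k * (real k + 1) powr s))"
    using C by (intro suminf_ennreal2 summable_mult summable_layer s) auto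
  also have "(\<Sum>k. C * \<rho> powr s * (?e k * (real k + 1) powr s)) = C * layer_const s * \<rho> powr s"
    by (subst suminf_mult[OF summable_layer[OF s]]) (simp add: layer_const_def)
  finally show ?thesis .
qed

lemma nn_integral_powr_01:
  assumes "a > -1" "0 \<le> c"
  shows "(\<integral>\<^sup>+r\<in>{0..c}. ennreal (r powr a) \<partial>lborel) = ennreal (c powr (a + 1) / (a + 1))"
proof -
  have "(\<integral>\<^sup>+r. ennreal (r powr a * indicator {0..c} r) \<partial>lborel) = ennreal (c powr (a + 1) / (a + 1))"
  proof (rule nn_integral_has_integral_lborel)
    show "((\<lambda>r. r powr a * indicator {0..c} r) has_integral c powr (a + 1) / (a + 1)) UNIV"
      using has_integral_powr_from_0[OF assms]
      by (subst (asm) has_integral_restrict_UNIV[symmetric])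
         (simp add: indicator_def if_distrib of_bool_def cong: if_cong)
  qed auto
  then show ?thesis by (simp add: ennreal_mult'' ennreal_indicator)
qed

text \<open>The multiplier m(\<xi>) of the overview: averaging the character at
  \<open>t *\<^sub>R b\<close> over a standard normal t gives the integrand.\<close>

definition gauss_transform :: "'a::euclidean_space measure \<Rightarrow> 'a \<Rightarrow> real" where
  "gauss_transform M \<xi> = (\<integral>b. exp (- (b \<bullet> \<xi>)\<^sup>2 / 2) \<partial>M)"

lemma gauss_transform_integrable:
  fixes M :: "'a::euclidean_space measure"
  assumes "finite_measure M" "sets M = sets borel"
  shows "integrable M (\<lambda>b. exp (- (b \<bullet> \<xi>)\<^sup>2 / 2))"
proof -
  note [measurable_cong] = assms(2)
  have [measurable]: "(\<lambda>b::'a. exp (- (b \<bullet> \<xi>)\<^sup>2 / 2)) \<in> borel_measurable borel"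
    by (intro borel_measurable_continuous_onI continuous_intros) auto
  show ?thesis
    by (rule finite_measure.integrable_const_bound[OF assms(1), where B = 1]) auto
qed

lemma gauss_transform_nonneg [simp]: "0 \<le> gauss_transform M \<xi>"
  by (simp add: gauss_transform_def)

lemma ennreal_gauss_transform:
  fixes M :: "'a::euclidean_space measure"
  assumes "finite_measure M" "sets M = sets borel"
  shows "ennreal (gauss_transform M \<xi>) = (\<integral>\<^sup>+b. ennreal (exp (- (b \<bullet> \<xi>)\<^sup>2 / 2)) \<partial>M)"
  unfolding gauss_transform_def
  by (subst nn_integral_eq_integral[OF gauss_transform_integrable[OF assms]]) auto

section \<open>Slabs and the decay of the multiplier\<close>

lemma open_nbhd_hyperplane:
  fixes \<omega> :: "'a::euclidean_space"
  assumes "norm \<omega> = 1"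
  shows "open_nbhd \<delta> (hyperplane \<omega>) = {b. \<bar>b \<bullet> \<omega>\<bar> < \<delta>}"
proof (intro equalityI subsetI)
  fix b assume "b \<in> open_nbhd \<delta> (hyperplane \<omega>)"
  then obtain x where x: "x \<bullet> \<omega> = 0" "norm (x - b) < \<delta>"
    by (auto simp: open_nbhd_def hyperplane_def dist_norm)
  have "\<bar>b \<bullet> \<omega>\<bar> = \<bar>(x - b) \<bullet> \<omega>\<bar>" using x(1) by (simp add: inner_diff_left)
  also have "\<dots> \<le> norm (x - b)" using Cauchy_Schwarz_ineq2[of "x - b" \<omega>] assms by simp
  finally show "b \<in> {b. \<bar>b \<bullet> \<omega>\<bar> < \<delta>}" using x(2) by simp
next
  fix b assume b: "b \<in> {b. \<bar>b \<bullet> \<omega>\<bar> < \<delta>}"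
  have "\<omega> \<bullet> \<omega> = 1" using assms by (simp add: norm_eq_1)
  then have "b - (b \<bullet> \<omega>) *\<^sub>R \<omega> \<in> hyperplane \<omega>" by (simp add: hyperplane_def inner_diff_left)
  moreover have "b \<in> ball (b - (b \<bullet> \<omega>) *\<^sub>R \<omega>) \<delta>" using b assms by (simp add: dist_norm)
  ultimately show "b \<in> open_nbhd \<delta> (hyperplane \<omega>)" unfolding open_nbhd_def by (rule UN_I)
qed

lemma hyperplane_size_boundE:
  fixes M :: "'a::euclidean_space measure"
  assumes "hyperplane_size_bound p M"
  obtains C where "C > 0"
    "\<And>\<xi> r. \<xi> \<noteq> 0 \<Longrightarrow> 0 < r \<Longrightarrow> emeasure M {b. \<bar>b \<bullet> \<xi>\<bar> < r} \<le> ennreal (C * (r / norm \<xi>) powr p)"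
proof -
  obtain C where C: "\<And>\<omega> \<delta>. norm \<omega> = 1 \<Longrightarrow> 0 < \<delta> \<Longrightarrow> emeasure M (open_nbhd \<delta> (hyperplane \<omega>)) \<le> ennreal (C * \<delta> powr p)"
    using assms unfolding hyperplane_size_bound_def by blast
  show ?thesis
  proof
    show "max C 1 > 0" by simp
    fix \<xi> :: 'a and r :: real assume *: "\<xi> \<noteq> 0" "0 < r"
    let ?\<omega> = "\<xi> /\<^sub>R norm \<xi>"
    have w: "norm ?\<omega> = 1" using * by simp
    have "{b. \<bar>b \<bullet> \<xi>\<bar> < r} = open_nbhd (r / norm \<xi>) (hyperplane ?\<omega>)"
      unfolding open_nbhd_hyperplane[OF w] using *
      by (auto simp: abs_mult field_simps)
    then have "emeasure M {b. \<bar>b \<bullet> \<xi>\<bar> < r} \<le> ennreal (C * (r / norm \<xi>) powr p)"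
      using C[OF w, of "r / norm \<xi>"] * by simp
    also have "\<dots> \<le> ennreal (max C 1 * (r / norm \<xi>) powr p)"
      by (intro ennreal_leI mult_right_mono) auto
    finally show "emeasure M {b. \<bar>b \<bullet> \<xi>\<bar> < r} \<le> ennreal (max C 1 * (r / norm \<xi>) powr p)" .
  qed
qed

text \<open>The slab |b.\<xi>| < r is a neighbourhood of a hyperplane of width r / |\<xi>|, so the
  layer bound at scale 1 yields |\<xi>|^(-p). For |\<xi>| <= 1 the total mass of M takes over;
  \<open>K\<close> adds both constants.\<close>

lemma gauss_transform_decay:
  fixes M :: "'a::euclidean_space measure"
  assumes M: "finite_measure M" "sets M = sets borel" and hyp: "hyperplane_size_bound p M" and p: "0 < p"
  obtains C where "C > 0" "\<And>\<xi>. gauss_transform M \<xi> \<le> C * (max 1 (norm \<xi>)) powr (- p)"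
proof -
  interpret finite_measure M by fact
  note [measurable_cong] = M(2)
  have sp: "space M = UNIV" using sets_eq_imp_space_eq[OF M(2)] by simp
  obtain C where C: "C > 0" "\<And>\<xi> r. \<xi> \<noteq> 0 \<Longrightarrow> 0 < r \<Longrightarrow> emeasure M {b. \<bar>b \<bullet> \<xi>\<bar> < r} \<le> ennreal (C * (r / norm \<xi>) powr p)"
    using hyperplane_size_boundE[OF hyp] by metis
  define K where "K = C * layer_const p + measure M UNIV"
  have lc: "layer_const p > 0" using layer_const_pos[of p] p by simp
  have "gauss_transform M \<xi> \<le> K * (max 1 (norm \<xi>)) powr (- p)" for \<xi>
  proof (cases "norm \<xi> \<le> 1")
    case True
    have "gauss_transform M \<xi> \<le> (\<integral>b. 1 \<partial>M)"
      unfolding gauss_transform_def by (intro integral_mono gauss_transform_integrable M) auto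
    also have "\<dots> \<le> K" using C lc by (simp add: K_def sp)
    finally show ?thesis using True by simp
  next
    case False
    then have "\<xi> \<noteq> 0" by auto
    have "ennreal (gauss_transform M \<xi>) = (\<integral>\<^sup>+b. ennreal (exp (- (\<bar>b \<bullet> \<xi>\<bar> / 1)\<^sup>2 / 2)) \<partial>M)"
      using ennreal_gauss_transform[OF M] by simp
    also have "\<dots> \<le> ennreal ((C * norm \<xi> powr (- p)) * layer_const p * 1 powr p)"
    proof (rule nn_integral_gaussian_layer)
      show "(\<lambda>b. \<bar>b \<bullet> \<xi>\<bar>) \<in> borel_measurable M" by measurable
      fix r :: real assume "1 \<le> r"
      then show "emeasure M {x \<in> space M. \<bar>x \<bullet> \<xi>\<bar> < r} \<le> ennreal ((C * norm \<xi> powr (- p)) * r powr p)"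
        using C(2)[of \<xi> r] \<open>\<xi> \<noteq> 0\<close> by (simp add: sp powr_divide powr_minus field_simps)
    qed (use p C in auto)
    finally have "gauss_transform M \<xi> \<le> C * norm \<xi> powr (- p) * layer_const p"
      using C lc by (simp add: ennreal_le_iff)
    also have "\<dots> \<le> K * norm \<xi> powr (- p)" by (simp add: K_def algebra_simps)
    finally show ?thesis using False by (simp add: max_def)
  qed
  moreover have "K > 0" using C lc by (simp add: K_def add_pos_nonneg)
  ultimately show ?thesis using that by blast
qed

text \<open>The decay of the multiplier is spread over Gaussians of all widths \<open>r \<le> 1\<close>.\<close>

lemma max_powr_le_gaussians:
  assumes p: "0 < p" and "0 \<le> u"
  shows "ennreal ((max 1 u) powr (- p)) \<le>
    ennreal (p * exp (1/2)) * (\<integral>\<^sup>+r\<in>{0..1}. ennreal (r powr (p - 1) * exp (- (r * u)\<^sup>2 / 2)) \<partial>lborel)"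
proof -
  define R where "R = max 1 u"
  have R: "R \<ge> 1" "u \<le> R" by (auto simp: R_def)
  \<comment> \<open>For r <= 1/R the Gaussian is at least exp(-1/2), and the integral of r^(p-1) up
    to 1/R equals R^(-p)/p; this fixes the constant p exp(1/2).\<close>
  have "ennreal (R powr (- p) / p * exp (-1/2)) = ennreal (exp (-1/2)) * ennreal ((1 / R) powr (p - 1 + 1) / (p - 1 + 1))"
    using R p by (subst ennreal_mult''[symmetric]) (auto simp: powr_minus powr_divide field_simps)
  also have "\<dots> = ennreal (exp (-1/2)) * (\<integral>\<^sup>+r\<in>{0..1/R}. ennreal (r powr (p - 1)) \<partial>lborel)"
    using R p by (subst nn_integral_powr_01) auto
  also have "\<dots> = (\<integral>\<^sup>+r. ennreal (exp (-1/2)) * (ennreal (r powr (p - 1)) * indicator {0..1/R} r) \<partial>lborel)"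
    by (subst nn_integral_cmult) auto
  also have "\<dots> \<le> (\<integral>\<^sup>+r\<in>{0..1}. ennreal (r powr (p - 1) * exp (- (r * u)\<^sup>2 / 2)) \<partial>lborel)"
  proof (rule nn_integral_mono)
    fix r :: real
    show "ennreal (exp (-1/2)) * (ennreal (r powr (p - 1)) * indicator {0..1/R} r)
        \<le> ennreal (r powr (p - 1) * exp (- (r * u)\<^sup>2 / 2)) * indicator {0..1} r"
    proof (cases "r \<in> {0..1/R}")
      case True
      then have r: "0 \<le> r" "r * R \<le> 1" using R by (auto simp: field_simps)
      then have "r * u \<le> 1" using R mult_left_mono[OF R(2) r(1)] by linarith
      then have "(r * u)\<^sup>2 \<le> 1" using r assms by (simp add: power_le_one)
      then have "exp (- 1 / 2) \<le> exp (- (r * u)\<^sup>2 / 2)" by simp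
      moreover have "r \<le> 1" using r R mult_left_mono[OF R(1) r(1)] by linarith
      ultimately show ?thesis using True r
        by (simp add: ennreal_mult''[symmetric] mult.commute[of "exp _"] ennreal_leI mult_left_mono)
    qed simp
  qed
  finally have "ennreal (p * exp (1/2)) * ennreal (R powr (- p) / p * exp (-1/2)) \<le>
     ennreal (p * exp (1/2)) * (\<integral>\<^sup>+r\<in>{0..1}. ennreal (r powr (p - 1) * exp (- (r * u)\<^sup>2 / 2)) \<partial>lborel)"
    by (rule mult_left_mono) simp
  moreover have "ennreal (p * exp (1/2)) * ennreal (R powr (- p) / p * exp (-1/2)) = ennreal (R powr (- p))"
    using p by (subst ennreal_mult''[symmetric]) (auto simp: exp_minus field_simps)
  ultimately show ?thesis by (simp add: R_def)
qed

section \<open>Averages over dilates\<close>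

text \<open>Image of \<nu> x M x N(0,1) under (a, b, t) -> a + t b. The standard normal law stands
  in for the uniform law on [1,2] because its characteristic function is a positive
  Gaussian.\<close>

definition dilation_law :: "'a::euclidean_space measure \<Rightarrow> 'a measure \<Rightarrow> 'a measure" where
  "dilation_law \<nu> M = distr ((\<nu> \<Otimes>\<^sub>M M) \<Otimes>\<^sub>M std_normal_distribution) borel (\<lambda>w. fst (fst w) + snd w *\<^sub>R snd (fst w))"

lemma std_normal_cos_sin:
  "(\<integral>t. cos (y * t) \<partial>std_normal_distribution) = exp (- y\<^sup>2 / 2)"
  "(\<integral>t. sin (y * t) \<partial>std_normal_distribution) = 0"
  "integrable std_normal_distribution (\<lambda>t. cos (y * t))"
  "integrable std_normal_distribution (\<lambda>t. sin (y * t))"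
proof -
  have int: "integrable std_normal_distribution (\<lambda>t. iexp (y * t))"
    by (intro finite_measure.integrable_const_bound[where B = 1] prob_space.finite_measure prob_space_normal_density) auto
  have char: "(CLINT t|std_normal_distribution. iexp (y * t)) = complex_of_real (exp (- y\<^sup>2 / 2))"
    using fun_cong[OF char_std_normal_distribution, of y] by (simp add: char_def)
  have re: "Re (iexp (y * t)) = cos (y * t)" "Im (iexp (y * t)) = sin (y * t)" for t
    by (simp_all add: Re_exp Im_exp)
  show "integrable std_normal_distribution (\<lambda>t. cos (y * t))" "integrable std_normal_distribution (\<lambda>t. sin (y * t))"
    using integrable_Re[OF int] integrable_Im[OF int] unfolding re by simp_all
  show "(\<integral>t. cos (y * t) \<partial>std_normal_distribution) = exp (- y\<^sup>2 / 2)" "(\<integral>t. sin (y * t) \<partial>std_normal_distribution) = 0"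
    using integral_Re[OF int] integral_Im[OF int] unfolding re char by simp_all
qed

context
  fixes \<nu> M :: "'a::euclidean_space measure"
  assumes \<nu>: "finite_measure \<nu>" "sets \<nu> = sets borel"
    and M: "finite_measure M" "sets M = sets borel"
begin

lemma dilation_map_measurable:
  "(\<lambda>w. fst (fst w) + snd w *\<^sub>R snd (fst w)) \<in> borel_measurable ((\<nu> \<Otimes>\<^sub>M M) \<Otimes>\<^sub>M std_normal_distribution)"
proof -
  note [measurable_cong] = \<nu>(2) M(2)
  show ?thesis by measurable
qed

lemma dilation_law_finite: "finite_measure (dilation_law \<nu> M)" "sets (dilation_law \<nu> M) = sets borel"
proof -
  have "finite_measure ((\<nu> \<Otimes>\<^sub>M M) \<Otimes>\<^sub>M std_normal_distribution)"
    by (intro finite_measure_pair_measure \<nu> M prob_space.finite_measure prob_space_normal_density) simp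
  then show "finite_measure (dilation_law \<nu> M)"
    unfolding dilation_law_def by (rule finite_measure.finite_measure_distr) (rule dilation_map_measurable)
qed (simp add: dilation_law_def)

lemma nn_integral_dilation_law:
  assumes [measurable]: "f \<in> borel_measurable borel"
  shows "(\<integral>\<^sup>+y. f y \<partial>dilation_law \<nu> M) = (\<integral>\<^sup>+a. (\<integral>\<^sup>+b. (\<integral>\<^sup>+t. f (a + t *\<^sub>R b) \<partial>std_normal_distribution) \<partial>M) \<partial>\<nu>)"
proof -
  interpret m: finite_measure M by (rule M)
  interpret N: prob_space std_normal_distribution by (rule prob_space_normal_density) simp
  note [measurable_cong] = \<nu>(2) M(2)
  have "(\<integral>\<^sup>+y. f y \<partial>dilation_law \<nu> M) = (\<integral>\<^sup>+w. f (fst (fst w) + snd w *\<^sub>R snd (fst w)) \<partial>((\<nu> \<Otimes>\<^sub>M M) \<Otimes>\<^sub>M std_normal_distribution))"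
    unfolding dilation_law_def using dilation_map_measurable
    by (subst nn_integral_distr) (auto simp: split_beta)
  also have "\<dots> = (\<integral>\<^sup>+w. (\<integral>\<^sup>+t. f (fst w + t *\<^sub>R snd w) \<partial>std_normal_distribution) \<partial>(\<nu> \<Otimes>\<^sub>M M))"
    by (subst N.nn_integral_fst[symmetric]) (auto simp: split_beta)
  also have "\<dots> = (\<integral>\<^sup>+a. (\<integral>\<^sup>+b. (\<integral>\<^sup>+t. f (a + t *\<^sub>R b) \<partial>std_normal_distribution) \<partial>M) \<partial>\<nu>)"
    by (subst m.nn_integral_fst[symmetric]) (auto simp: split_beta)
  finally show ?thesis .
qed

lemma integral_dilation_law:
  fixes f :: "'a \<Rightarrow> real"
  assumes [measurable]: "f \<in> borel_measurable borel" and bound: "\<And>y. \<bar>f y\<bar> \<le> 1"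
  shows "(\<integral>y. f y \<partial>dilation_law \<nu> M) = (\<integral>a. (\<integral>b. (\<integral>t. f (a + t *\<^sub>R b) \<partial>std_normal_distribution) \<partial>M) \<partial>\<nu>)"
proof -
  interpret n: finite_measure \<nu> by (rule \<nu>)
  interpret m: finite_measure M by (rule M)
  interpret N: prob_space std_normal_distribution by (rule prob_space_normal_density) simp
  note [measurable_cong] = \<nu>(2) M(2)
  interpret nm: pair_sigma_finite \<nu> M ..
  interpret P: finite_measure "\<nu> \<Otimes>\<^sub>M M"
    by (intro finite_measure_pair_measure n.finite_measure_axioms m.finite_measure_axioms)
  interpret PN: pair_sigma_finite "\<nu> \<Otimes>\<^sub>M M" std_normal_distribution ..
  interpret Q: finite_measure "(\<nu> \<Otimes>\<^sub>M M) \<Otimes>\<^sub>M std_normal_distribution"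
    by (intro finite_measure_pair_measure P.finite_measure_axioms N.finite_measure_axioms)
  have 1: "integrable ((\<nu> \<Otimes>\<^sub>M M) \<Otimes>\<^sub>M std_normal_distribution) (\<lambda>w. f (fst (fst w) + snd w *\<^sub>R snd (fst w)))"
    by (rule Q.integrable_const_bound[where B = 1]) (auto simp: bound)
  have 2: "integrable (\<nu> \<Otimes>\<^sub>M M) (\<lambda>w. (\<integral>t. f (fst w + t *\<^sub>R snd w) \<partial>std_normal_distribution))"
    using PN.integrable_fst'[OF 1] by simp
  have "(\<integral>y. f y \<partial>dilation_law \<nu> M) = (\<integral>w. f (fst (fst w) + snd w *\<^sub>R snd (fst w)) \<partial>((\<nu> \<Otimes>\<^sub>M M) \<Otimes>\<^sub>M std_normal_distribution))"
    unfolding dilation_law_def using dilation_map_measurable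
    by (subst integral_distr) (auto simp: split_beta)
  also have "\<dots> = (\<integral>w. (\<integral>t. f (fst w + t *\<^sub>R snd w) \<partial>std_normal_distribution) \<partial>(\<nu> \<Otimes>\<^sub>M M))"
    using PN.integral_fst'[OF 1] by simp
  also have "\<dots> = (\<integral>a. (\<integral>b. (\<integral>t. f (a + t *\<^sub>R b) \<partial>std_normal_distribution) \<partial>M) \<partial>\<nu>)"
    using nm.integral_fst'[OF 2] by simp
  finally show ?thesis .
qed

text \<open>Expand the angle sum: the odd part \<open>sin (t * (b \<bullet> \<xi>))\<close> averages
  to zero over the symmetric law of t, and the even part gives the integrand of
  \<open>gauss_transform\<close>. Averaging over dilates thus acts in frequency space as
  multiplication by a nonnegative function.\<close>

lemma dilation_law_transforms:
  "cos_transform (dilation_law \<nu> M) \<xi> = cos_transform \<nu> \<xi> * gauss_transform M \<xi>"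
  "sin_transform (dilation_law \<nu> M) \<xi> = sin_transform \<nu> \<xi> * gauss_transform M \<xi>"
proof -
  note i = std_normal_cos_sin
  have [measurable]: "(\<lambda>x::'a. cos (x \<bullet> \<xi>)) \<in> borel_measurable borel"
      "(\<lambda>x::'a. sin (x \<bullet> \<xi>)) \<in> borel_measurable borel"
    by (intro borel_measurable_continuous_onI continuous_intros)+
  have "(\<integral>t. cos ((a + t *\<^sub>R b) \<bullet> \<xi>) \<partial>std_normal_distribution) = cos (a \<bullet> \<xi>) * exp (- (b \<bullet> \<xi>)\<^sup>2 / 2)"
       "(\<integral>t. sin ((a + t *\<^sub>R b) \<bullet> \<xi>) \<partial>std_normal_distribution) = sin (a \<bullet> \<xi>) * exp (- (b \<bullet> \<xi>)\<^sup>2 / 2)" for a b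
    using i[of "b \<bullet> \<xi>"] by (simp_all add: inner_add_left cos_add sin_add mult.commute[of _ "b \<bullet> \<xi>"])
  then show "cos_transform (dilation_law \<nu> M) \<xi> = cos_transform \<nu> \<xi> * gauss_transform M \<xi>"
    "sin_transform (dilation_law \<nu> M) \<xi> = sin_transform \<nu> \<xi> * gauss_transform M \<xi>"
    unfolding cos_transform_def sin_transform_def
    by (simp_all add: integral_dilation_law gauss_transform_def)
qed

end

section \<open>Cauchy-Schwarz in frequency space\<close>

lemma spectral_Cauchy_Schwarz:
  "\<bar>cross_spectrum \<mu> \<nu> \<xi>\<bar>
     \<le> sqrt (spectrum \<mu> \<xi>) * sqrt (spectrum \<nu> \<xi>)"
proof -
  let ?z = "Complex (cos_transform \<mu> \<xi>) (sin_transform \<mu> \<xi>)" and ?w = "Complex (cos_transform \<nu> \<xi>) (sin_transform \<nu> \<xi>)"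
  have "\<bar>?z \<bullet> ?w\<bar> \<le> norm ?z * norm ?w" by (rule Cauchy_Schwarz_ineq2)
  then show ?thesis by (simp add: inner_complex_def cmod_def spectrum_def cross_spectrum_def)
qed

lemma spectral_product_bound:
  fixes \<mu> \<nu> :: "'a::euclidean_space measure"
  assumes \<mu>: "finite_measure \<mu>" "sets \<mu> = sets borel"
    and \<nu>: "finite_measure \<nu>" "sets \<nu> = sets borel" and \<rho>: "\<rho> > 0"
    and L: "0 \<le> L" "gauss_energy \<mu> \<mu> \<rho> \<le> ennreal L" and L': "0 \<le> L'" "gauss_energy \<nu> \<nu> \<rho> \<le> ennreal L'"
  shows "(\<integral>\<^sup>+\<xi>. ennreal (exp (- (\<rho> * norm \<xi>)\<^sup>2 / 2) * (sqrt (spectrum \<mu> \<xi>) * sqrt (spectrum \<nu> \<xi>))) \<partial>lborel)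
     \<le> ennreal ((sqrt (2 * pi) / \<rho>) ^ DIM('a) * sqrt (L * L'))"
proof -
  note [measurable] = transform_measurable[OF \<mu>] transform_measurable[OF \<nu>]
  \<comment> \<open>Each factor receives half of the Gaussian weight, so that products and squares
    carry the full weight exp(-(\<rho>|\<xi>|)^2/2).\<close>
  define u where "u = (\<lambda>\<mu> (\<xi>::'a). ennreal (exp (- (\<rho> * norm \<xi>)\<^sup>2 / 4) * sqrt (spectrum \<mu> \<xi>)))"
  define c where "c = (sqrt (2 * pi) / \<rho>) ^ DIM('a)"
  have c: "c > 0" using \<rho> by (simp add: c_def)
  have e2: "exp (- (\<rho> * norm \<xi>)\<^sup>2 / 4) * exp (- (\<rho> * norm \<xi>)\<^sup>2 / 4) = exp (- (\<rho> * norm \<xi>)\<^sup>2 / 2)" for \<xi> :: 'a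
    by (simp add: exp_add[symmetric])
  have uu: "u \<mu> \<xi> * u \<nu> \<xi> = ennreal (exp (- (\<rho> * norm \<xi>)\<^sup>2 / 2) * (sqrt (spectrum \<mu> \<xi>) * sqrt (spectrum \<nu> \<xi>)))" for \<mu> \<nu> \<xi>
    unfolding u_def e2[symmetric] by (subst ennreal_mult''[symmetric]) (simp_all add: mult_ac)
  have sq: "(u \<mu> \<xi>)\<^sup>2 = ennreal (exp (- (\<rho> * norm \<xi>)\<^sup>2 / 2) * spectrum \<mu> \<xi>)" for \<mu> \<xi>
    unfolding power2_eq_square uu by simp
  let ?I = "\<integral>\<^sup>+\<xi>. u \<mu> \<xi> * u \<nu> \<xi> \<partial>lborel"
  have [measurable]: "u \<mu> \<in> borel_measurable lborel" "u \<nu> \<in> borel_measurable lborel"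
    unfolding u_def by measurable
  have "?I\<^sup>2 \<le> (\<integral>\<^sup>+\<xi>. (u \<mu> \<xi>)\<^sup>2 \<partial>lborel) * (\<integral>\<^sup>+\<xi>. (u \<nu> \<xi>)\<^sup>2 \<partial>lborel)"
    by (rule Cauchy_Schwarz_nn_integral) measurable
  also have "\<dots> \<le> (ennreal c * ennreal L) * (ennreal c * ennreal L')"
    unfolding sq gauss_energy_spectrum[OF \<mu> \<rho>] gauss_energy_spectrum[OF \<nu> \<rho>] c_def
    by (intro mult_mono mult_left_mono L L') auto
  also have "\<dots> = (ennreal (c * sqrt (L * L')))\<^sup>2"
  proof -
    have "(c * L) * (c * L') = (c * sqrt (L * L'))\<^sup>2"
      using L(1) L'(1) by (simp add: power_mult_distrib power2_eq_square[of c])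
    then show ?thesis
      using c L(1) L'(1) by (simp only: ennreal_mult[symmetric] ennreal_power mult_nonneg_nonneg real_sqrt_ge_zero less_imp_le)
  qed
  finally have "?I\<^sup>2 \<le> (ennreal (c * sqrt (L * L')))\<^sup>2" .
  then have "?I \<le> ennreal (c * sqrt (L * L'))"
    using c L(1) L'(1)
    by (cases ?I) (auto simp: ennreal_power ennreal_le_iff top_unique intro: power2_le_imp_le)
  then show ?thesis unfolding uu c_def .
qed

text \<open>Spreading the multiplier over Gaussians turns the integral at parameter \<epsilon> into
  integrals at \<open>sqrt (r^2 + \<epsilon>^2)\<close> with r in (0,1], which lies between
  \<epsilon> and 2; Cauchy-Schwarz bounds each by its parameter to the power \<kappa> - d. Against
  r^(p-1) this is integrable at 0 because p + \<kappa> > d. The constant is chosen before \<mu>,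
  \<nu>, \<epsilon> and the energy constants, which admits discrete measures that depend on
  \<epsilon>.\<close>

lemma gauss_energy_dilation_bound:
  fixes M :: "'a::euclidean_space measure"
  assumes M: "finite_measure M" "sets M = sets borel"
    and hyp: "hyperplane_size_bound p M" and p: "0 < p" and \<kappa>: "real DIM('a) < p + \<kappa>"
  obtains C where "C > 0"
    "\<And>\<mu> \<nu> \<epsilon> L L' \<alpha> s. finite_measure \<mu> \<Longrightarrow> sets \<mu> = sets borel \<Longrightarrow> finite_measure \<nu> \<Longrightarrow> sets \<nu> = sets borel \<Longrightarrow>
       0 < \<epsilon> \<Longrightarrow> \<epsilon> \<le> 1 \<Longrightarrow> 0 \<le> L \<Longrightarrow> 0 \<le> L' \<Longrightarrow> (\<alpha> + s) / 2 = \<kappa> \<Longrightarrow>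
       (\<And>\<rho>. \<epsilon> \<le> \<rho> \<Longrightarrow> \<rho> \<le> 2 \<Longrightarrow> gauss_energy \<mu> \<mu> \<rho> \<le> ennreal (L * \<rho> powr \<alpha>)) \<Longrightarrow>
       (\<And>\<rho>. \<epsilon> \<le> \<rho> \<Longrightarrow> \<rho> \<le> 2 \<Longrightarrow> gauss_energy \<nu> \<nu> \<rho> \<le> ennreal (L' * \<rho> powr s)) \<Longrightarrow>
       gauss_energy \<mu> (dilation_law \<nu> M) \<epsilon> \<le> ennreal (C * \<epsilon> ^ DIM('a) * sqrt (L * L'))"
proof -
  obtain C1 where C1: "C1 > 0" "\<And>\<xi>. gauss_transform M \<xi> \<le> C1 * (max 1 (norm \<xi>)) powr (- p)"
    using gauss_transform_decay[OF M hyp p] by blast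
  define C2 where "C2 = C1 * (p * exp (1/2))"
  define d where "d = DIM('a)"
  \<comment> \<open>The square root of the two energies contributes the power \<kappa> of the
    parameter, the Fourier normalisation the power -d.\<close>
  define \<tau> where "\<tau> = \<kappa> - real d"
  define J where "J = 1 / (p + \<tau>) + 2 powr \<tau> / p"
  have \<tau>: "p + \<tau> > 0" using \<kappa> by (simp add: \<tau>_def d_def)
  have C2: "C2 > 0" using C1 p by (simp add: C2_def)
  have J: "J > 0" using \<tau> p by (simp add: J_def add_pos_pos)
  have JI: "(\<integral>\<^sup>+r\<in>{0..1}. ennreal (r powr (p - 1) * (r powr \<tau> + 2 powr \<tau>)) \<partial>lborel) = ennreal J"
  proof -
    have "(\<integral>\<^sup>+r\<in>{0..1}. ennreal (r powr (p - 1) * (r powr \<tau> + 2 powr \<tau>)) \<partial>lborel)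
      = (\<integral>\<^sup>+r. ennreal (r powr (p - 1 + \<tau>)) * indicator {0..1} r + ennreal (2 powr \<tau>) * (ennreal (r powr (p - 1)) * indicator {0..1} r) \<partial>lborel)"
      by (intro nn_integral_cong)
        (auto simp: indicator_def powr_add distrib_left ennreal_plus ennreal_mult''[symmetric] mult.commute)
    also have "\<dots> = (\<integral>\<^sup>+r\<in>{0..1}. ennreal (r powr (p - 1 + \<tau>)) \<partial>lborel)
         + ennreal (2 powr \<tau>) * (\<integral>\<^sup>+r\<in>{0..1}. ennreal (r powr (p - 1)) \<partial>lborel)"
      by (subst nn_integral_add) (auto simp: nn_integral_cmult)
    also have "\<dots> = ennreal (1 / (p + \<tau>)) + ennreal (2 powr \<tau>) * ennreal (1 / p)"
      using p \<tau> by (simp add: nn_integral_powr_01)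
    also have "\<dots> = ennreal J"
      using p \<tau> by (simp add: J_def ennreal_mult''[symmetric] ennreal_plus[symmetric] del: ennreal_plus)
    finally show ?thesis .
  qed
  have "gauss_energy \<mu> (dilation_law \<nu> M) \<epsilon> \<le> ennreal (C2 * J * \<epsilon> ^ DIM('a) * sqrt (L * L'))"
    if \<mu>: "finite_measure \<mu>" "sets \<mu> = sets borel" and \<nu>: "finite_measure \<nu>" "sets \<nu> = sets borel"
      and \<epsilon>: "0 < \<epsilon>" "\<epsilon> \<le> 1" and L: "0 \<le> L" "0 \<le> L'" and \<kappa>': "(\<alpha> + s) / 2 = \<kappa>"
      and G: "\<And>\<rho>. \<epsilon> \<le> \<rho> \<Longrightarrow> \<rho> \<le> 2 \<Longrightarrow> gauss_energy \<mu> \<mu> \<rho> \<le> ennreal (L * \<rho> powr \<alpha>)"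
      and G': "\<And>\<rho>. \<epsilon> \<le> \<rho> \<Longrightarrow> \<rho> \<le> 2 \<Longrightarrow> gauss_energy \<nu> \<nu> \<rho> \<le> ennreal (L' * \<rho> powr s)"
    for \<mu> \<nu> :: "'a measure" and \<epsilon> L L' \<alpha> s
  proof -
    note [measurable] = transform_measurable[OF \<mu>] transform_measurable[OF \<nu>]
    let ?R = "dilation_law \<nu> M"
    note R = dilation_law_finite[OF \<nu> M]
    define W where "W = (\<lambda>\<xi>. sqrt (spectrum \<mu> \<xi>) * sqrt (spectrum \<nu> \<xi>))"
    have [measurable]: "W \<in> borel_measurable borel" unfolding W_def by measurable
    have W0: "0 \<le> W \<xi>" for \<xi> by (simp add: W_def)
    let ?g = "\<lambda>\<rho> \<xi>::'a. exp (- (\<rho> * norm \<xi>)\<^sup>2 / 2)"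
    let ?H = "\<lambda>\<xi> r. ennreal C2 * (ennreal (r powr (p - 1)) * ennreal (?g (sqrt (r\<^sup>2 + \<epsilon>\<^sup>2)) \<xi> * W \<xi>))"
    define F where "F = (\<lambda>\<xi>. ?g \<epsilon> \<xi> * cross_spectrum \<mu> ?R \<xi>)"
    note FF = gauss_energy_fourier[OF \<mu> R \<epsilon>(1), folded F_def]
    have Fb: "\<bar>F \<xi>\<bar> \<le> ?g \<epsilon> \<xi> * W \<xi> * gauss_transform M \<xi>" for \<xi>
    proof -
      have "F \<xi> = ?g \<epsilon> \<xi> * gauss_transform M \<xi> * cross_spectrum \<mu> \<nu> \<xi>"
        unfolding F_def cross_spectrum_def dilation_law_transforms[OF \<nu> M] by (simp add: algebra_simps)
      also have "\<bar>\<dots>\<bar> \<le> ?g \<epsilon> \<xi> * gauss_transform M \<xi> * W \<xi>"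
        unfolding abs_mult W_def by (intro mult_mono spectral_Cauchy_Schwarz) auto
      finally show ?thesis by (simp add: mult_ac)
    qed
    have Fpt: "ennreal (norm (F \<xi>)) \<le> (\<integral>\<^sup>+r\<in>{0..1}. ?H \<xi> r \<partial>lborel)" for \<xi>
    proof -
      have "norm (F \<xi>) \<le> ?g \<epsilon> \<xi> * W \<xi> * (C1 * (max 1 (norm \<xi>)) powr (- p))"
        unfolding real_norm_def by (rule order_trans[OF Fb mult_left_mono[OF C1(2)]]) (simp add: W0)
      then have "ennreal (norm (F \<xi>)) \<le> ennreal (?g \<epsilon> \<xi> * W \<xi> * C1) * ennreal ((max 1 (norm \<xi>)) powr (- p))"
        using W0[of \<xi>] C1 by (subst ennreal_mult''[symmetric]) (auto simp: mult.assoc intro!: ennreal_leI)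
      also have "\<dots> \<le> ennreal (?g \<epsilon> \<xi> * W \<xi> * C1) * (ennreal (p * exp (1/2)) *
          (\<integral>\<^sup>+r\<in>{0..1}. ennreal (r powr (p - 1) * ?g r \<xi>) \<partial>lborel))"
        by (intro mult_left_mono max_powr_le_gaussians p) auto
      also have "\<dots> = (ennreal (?g \<epsilon> \<xi> * W \<xi> * C1) * ennreal (p * exp (1/2))) *
          (\<integral>\<^sup>+r\<in>{0..1}. ennreal (r powr (p - 1) * ?g r \<xi>) \<partial>lborel)"
        by (simp only: mult.assoc)
      also have "ennreal (?g \<epsilon> \<xi> * W \<xi> * C1) * ennreal (p * exp (1/2)) = ennreal (?g \<epsilon> \<xi> * W \<xi> * C2)"
        using p by (subst ennreal_mult''[symmetric]) (auto simp: C2_def mult_ac)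
      also have "ennreal (?g \<epsilon> \<xi> * W \<xi> * C2) * (\<integral>\<^sup>+r\<in>{0..1}. ennreal (r powr (p - 1) * ?g r \<xi>) \<partial>lborel)
         = (\<integral>\<^sup>+r. ennreal (?g \<epsilon> \<xi> * W \<xi> * C2) * (ennreal (r powr (p - 1) * ?g r \<xi>) * indicator {0..1} r) \<partial>lborel)"
        by (subst nn_integral_cmult) auto
      also have "\<dots> = (\<integral>\<^sup>+r\<in>{0..1}. ?H \<xi> r \<partial>lborel)"
      proof (intro nn_integral_cong)
        fix r :: real
        have "(sqrt (r\<^sup>2 + \<epsilon>\<^sup>2) * norm \<xi>)\<^sup>2 = (\<epsilon> * norm \<xi>)\<^sup>2 + (r * norm \<xi>)\<^sup>2"
          by (simp add: power_mult_distrib distrib_right)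
        then have "- (sqrt (r\<^sup>2 + \<epsilon>\<^sup>2) * norm \<xi>)\<^sup>2 / 2 = - (\<epsilon> * norm \<xi>)\<^sup>2 / 2 + - (r * norm \<xi>)\<^sup>2 / 2"
          by linarith
        then have "?g (sqrt (r\<^sup>2 + \<epsilon>\<^sup>2)) \<xi> = ?g \<epsilon> \<xi> * ?g r \<xi>"
          by (simp only: exp_add)
        then have "ennreal (?g \<epsilon> \<xi> * W \<xi> * C2) * ennreal (r powr (p - 1) * ?g r \<xi>)
           = ?H \<xi> r"
          using C2 W0[of \<xi>] by (simp add: ennreal_mult[symmetric] mult_ac)
        then show "ennreal (?g \<epsilon> \<xi> * W \<xi> * C2) * (ennreal (r powr (p - 1) * ?g r \<xi>) * indicator {0..1} r)
           = ?H \<xi> r * indicator {0..1} r"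
          by (simp add: mult.assoc[symmetric])
      qed
      finally show ?thesis .
    qed
    have slice: "ennreal (r powr (p - 1)) * (\<integral>\<^sup>+\<xi>. ennreal (?g (sqrt (r\<^sup>2 + \<epsilon>\<^sup>2)) \<xi> * W \<xi>) \<partial>lborel)
        \<le> ennreal (sqrt (2 * pi) ^ d * sqrt (L * L')) * ennreal (r powr (p - 1) * (r powr \<tau> + 2 powr \<tau>))"
      if r: "r \<in> {0..1}" for r
    \<comment> \<open>At r = 0 the weight \<open>r powr (p - 1)\<close> is 0 by convention, also
      when p < 1.\<close>
    proof (cases "r = 0")
      case False
      then have r0: "r > 0" "r \<le> 1" using r by auto
      define \<rho> where "\<rho> = sqrt (r\<^sup>2 + \<epsilon>\<^sup>2)"
      have \<rho>: "\<epsilon> \<le> \<rho>" "r \<le> \<rho>" unfolding \<rho>_def by (auto intro!: real_le_rsqrt)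
      have \<rho>2: "\<rho> \<le> 2" unfolding \<rho>_def using r0 \<epsilon> power_le_one[of r 2] power_le_one[of \<epsilon> 2] by (intro real_le_lsqrt) auto
      have \<rho>0: "\<rho> > 0" using \<rho> \<epsilon> by linarith
      have "(\<integral>\<^sup>+\<xi>. ennreal (?g \<rho> \<xi> * W \<xi>) \<partial>lborel)
          \<le> ennreal ((sqrt (2 * pi) / \<rho>) ^ DIM('a) * sqrt ((L * \<rho> powr \<alpha>) * (L' * \<rho> powr s)))"
        unfolding W_def by (intro spectral_product_bound \<mu> \<nu> \<rho>0 G G' \<rho> \<rho>2) (use L in auto)
      also have "sqrt ((L * \<rho> powr \<alpha>) * (L' * \<rho> powr s)) = sqrt (L * L') * \<rho> powr \<kappa>"
      proof -
        have *: "(L * \<rho> powr \<alpha>) * (L' * \<rho> powr s) = (L * L') * (\<rho> powr \<kappa>)\<^sup>2"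
          using \<rho>0 \<kappa>' by (simp add: powr_power[symmetric] power2_eq_square powr_add[symmetric] mult_ac)
        show ?thesis unfolding * real_sqrt_mult[of "L * L'"] by simp
      qed
      also have "(sqrt (2 * pi) / \<rho>) ^ DIM('a) * (sqrt (L * L') * \<rho> powr \<kappa>) = sqrt (2 * pi) ^ d * sqrt (L * L') * \<rho> powr \<tau>"
        using \<rho>0 by (simp add: d_def \<tau>_def powr_diff power_divide powr_realpow)
      finally have "(\<integral>\<^sup>+\<xi>. ennreal (?g \<rho> \<xi> * W \<xi>) \<partial>lborel) \<le> ennreal (sqrt (2 * pi) ^ d * sqrt (L * L') * \<rho> powr \<tau>)" .
      also have "\<dots> \<le> ennreal (sqrt (2 * pi) ^ d * sqrt (L * L') * (r powr \<tau> + 2 powr \<tau>))"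
      proof (intro ennreal_leI mult_left_mono)
        show "\<rho> powr \<tau> \<le> r powr \<tau> + 2 powr \<tau>"
        \<comment> \<open>The parameter lies between r and 2, and the sign of \<tau> decides which
          end dominates; the sum of both powers covers either case.\<close>
        proof (cases "\<tau> \<ge> 0")
          case True
          then have "\<rho> powr \<tau> \<le> 2 powr \<tau>" using \<rho>0 \<rho>2 by (intro powr_mono2) auto
          then show ?thesis using powr_ge_zero[of r \<tau>] by linarith
        next
          case False
          then have "\<rho> powr \<tau> \<le> r powr \<tau>" using r0 \<rho> by (intro powr_mono2') auto
          then show ?thesis using powr_ge_zero[of 2 \<tau>] by linarith
        qed
      qed (use L in auto)
      finally have "ennreal (r powr (p - 1)) * (\<integral>\<^sup>+\<xi>. ennreal (?g \<rho> \<xi> * W \<xi>) \<partial>lborel)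
        \<le> ennreal (r powr (p - 1)) * ennreal (sqrt (2 * pi) ^ d * sqrt (L * L') * (r powr \<tau> + 2 powr \<tau>))"
        by (rule mult_left_mono) simp
      also have "\<dots> = ennreal (sqrt (2 * pi) ^ d * sqrt (L * L')) * ennreal (r powr (p - 1) * (r powr \<tau> + 2 powr \<tau>))"
        using L by (simp add: ennreal_mult[symmetric] mult_ac del: ennreal_plus)
      finally show ?thesis by (simp add: \<rho>_def)
    qed simp
    have [measurable]: "F \<in> borel_measurable borel"
      using borel_measurable_integrable[OF FF(1)] by simp
    \<comment> \<open>The cross spectrum has no definite sign, so absolute values go inside before
      the decay of the multiplier is used.\<close>
    have "ennreal (\<integral>\<xi>. F \<xi> \<partial>lborel) \<le> ennreal (norm (\<integral>\<xi>. F \<xi> \<partial>lborel))" by (intro ennreal_leI) simp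
    also have "\<dots> \<le> (\<integral>\<^sup>+\<xi>. ennreal (norm (F \<xi>)) \<partial>lborel)"
      by (rule integral_norm_bound_ennreal) (rule FF(1))
    also have "\<dots> \<le> (\<integral>\<^sup>+\<xi>. (\<integral>\<^sup>+r\<in>{0..1}. ?H \<xi> r \<partial>lborel) \<partial>lborel)"
      by (rule nn_integral_mono) (rule Fpt)
    also have "\<dots> = (\<integral>\<^sup>+r. (\<integral>\<^sup>+\<xi>. ?H \<xi> r * indicator {0..1} r \<partial>lborel) \<partial>lborel)"
      by (rule lborel_pair.Fubini') measurable
    also have "\<dots> = (\<integral>\<^sup>+r\<in>{0..1}. ennreal C2 * (ennreal (r powr (p - 1)) * (\<integral>\<^sup>+\<xi>. ennreal (?g (sqrt (r\<^sup>2 + \<epsilon>\<^sup>2)) \<xi> * W \<xi>) \<partial>lborel)) \<partial>lborel)"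
      by (intro nn_integral_cong) (simp add: nn_integral_cmult nn_integral_multc)
    also have "\<dots> \<le> (\<integral>\<^sup>+r\<in>{0..1}. ennreal C2 * (ennreal (sqrt (2 * pi) ^ d * sqrt (L * L')) * ennreal (r powr (p - 1) * (r powr \<tau> + 2 powr \<tau>))) \<partial>lborel)"
    proof (rule nn_integral_mono)
      fix r :: real
      show "ennreal C2 * (ennreal (r powr (p - 1)) * (\<integral>\<^sup>+\<xi>. ennreal (?g (sqrt (r\<^sup>2 + \<epsilon>\<^sup>2)) \<xi> * W \<xi>) \<partial>lborel)) * indicator {0..1} r
         \<le> ennreal C2 * (ennreal (sqrt (2 * pi) ^ d * sqrt (L * L')) * ennreal (r powr (p - 1) * (r powr \<tau> + 2 powr \<tau>))) * indicator {0..1} r"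
        using slice[of r] by (auto simp: indicator_def intro!: mult_left_mono)
    qed
    also have "\<dots> = (\<integral>\<^sup>+r. (ennreal C2 * ennreal (sqrt (2 * pi) ^ d * sqrt (L * L'))) * (ennreal (r powr (p - 1) * (r powr \<tau> + 2 powr \<tau>)) * indicator {0..1} r) \<partial>lborel)"
      by (simp only: mult.assoc)
    also have "\<dots> = (ennreal C2 * ennreal (sqrt (2 * pi) ^ d * sqrt (L * L'))) * ennreal J"
      by (subst nn_integral_cmult) (simp_all add: JI)
    also have "\<dots> = ennreal (C2 * J * sqrt (2 * pi) ^ d * sqrt (L * L'))"
      using C2 J L by (simp add: ennreal_mult[symmetric] mult_ac)
    finally have I: "ennreal (\<integral>\<xi>. F \<xi> \<partial>lborel) \<le> ennreal (C2 * J * sqrt (2 * pi) ^ d * sqrt (L * L'))" .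
    have "gauss_energy \<mu> ?R \<epsilon> = ennreal ((\<epsilon> / sqrt (2 * pi)) ^ d) * ennreal (\<integral>\<xi>. F \<xi> \<partial>lborel)"
      unfolding FF(2) d_def using \<epsilon> by (subst ennreal_mult') auto
    also have "\<dots> \<le> ennreal ((\<epsilon> / sqrt (2 * pi)) ^ d) * ennreal (C2 * J * sqrt (2 * pi) ^ d * sqrt (L * L'))"
      by (intro mult_left_mono I) simp
    also have "\<dots> = ennreal (C2 * J * \<epsilon> ^ DIM('a) * sqrt (L * L'))"
      using C2 J L \<epsilon> by (subst ennreal_mult[symmetric]) (auto simp: power_divide d_def)
    finally show ?thesis .
  qed
  then show ?thesis using that[of "C2 * J"] C2 J by (auto simp: mult_pos_pos)
qed

text \<open>On [1,2] the standard normal density is at least exp(-2)/sqrt(2 pi), so passing from the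
  uniform to the normal average over t costs the factor
  \<open>sqrt (2 * pi) * exp 2\<close>.\<close>

lemma average_dilations_le_gauss_energy:
  fixes \<mu> \<nu> M :: "'a::euclidean_space measure"
  assumes \<mu>: "sets \<mu> = sets borel" and \<nu>: "finite_measure \<nu>" "sets \<nu> = sets borel"
    and M: "finite_measure M" "sets M = sets borel"
  shows "(\<integral>\<^sup>+x. (\<integral>\<^sup>+t\<in>{1..2}. (\<integral>\<^sup>+a. (\<integral>\<^sup>+b. ennreal (exp (- (norm (x - (a + t *\<^sub>R b)) / \<epsilon>)\<^sup>2 / 2)) \<partial>M) \<partial>\<nu>) \<partial>lborel) \<partial>\<mu>)
    \<le> ennreal (sqrt (2 * pi) * exp 2) * gauss_energy \<mu> (dilation_law \<nu> M) \<epsilon>"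
proof -
  interpret n: finite_measure \<nu> by (rule \<nu>)
  interpret m: finite_measure M by (rule M)
  note [measurable_cong] = \<nu>(2) M(2)
  interpret R: finite_measure "dilation_law \<nu> M" by (rule dilation_law_finite[OF \<nu> M])
  note [measurable_cong] = \<mu> dilation_law_finite(2)[OF \<nu> M]
  interpret Ln: pair_sigma_finite "lborel :: real measure" \<nu> ..
  interpret Lm: pair_sigma_finite "lborel :: real measure" M ..
  let ?K = "\<lambda>x a b (t::real). ennreal (exp (- (norm (x - (a + t *\<^sub>R b)) / \<epsilon>)\<^sup>2 / 2))"
  let ?c = "sqrt (2 * pi) * exp 2"
  have "(\<integral>\<^sup>+t\<in>{1..2}. (\<integral>\<^sup>+a. (\<integral>\<^sup>+b. ?K x a b t \<partial>M) \<partial>\<nu>) \<partial>lborel)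
     \<le> ennreal ?c * (\<integral>\<^sup>+y. ennreal (exp (- (norm (x - y) / \<epsilon>)\<^sup>2 / 2)) \<partial>dilation_law \<nu> M)" for x
  proof -
    have "(\<integral>\<^sup>+t\<in>{1..2}. (\<integral>\<^sup>+a. (\<integral>\<^sup>+b. ?K x a b t \<partial>M) \<partial>\<nu>) \<partial>lborel)
       \<le> (\<integral>\<^sup>+t. ennreal ?c * ennreal (std_normal_density t) * (\<integral>\<^sup>+a. (\<integral>\<^sup>+b. ?K x a b t \<partial>M) \<partial>\<nu>) \<partial>lborel)"
    proof (intro nn_integral_mono)
      fix t :: real
      show "(\<integral>\<^sup>+a. (\<integral>\<^sup>+b. ?K x a b t \<partial>M) \<partial>\<nu>) * indicator {1..2} t
         \<le> ennreal ?c * ennreal (std_normal_density t) * (\<integral>\<^sup>+a. (\<integral>\<^sup>+b. ?K x a b t \<partial>M) \<partial>\<nu>)"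
      proof (cases "t \<in> {1..2}")
        case True
        then have "t\<^sup>2 \<le> 2\<^sup>2" by (intro power_mono) auto
        then have "exp (- 2) \<le> exp (- t\<^sup>2 / 2)" by simp
        then have "1 \<le> exp 2 * exp (- t\<^sup>2 / 2)" by (simp add: exp_minus field_simps)
        also have "\<dots> = ?c * std_normal_density t" by (simp add: std_normal_density_def)
        finally have "1 \<le> ennreal ?c * ennreal (std_normal_density t)"
          by (subst ennreal_mult[symmetric]) auto
        from mult_right_mono[OF this] show ?thesis using True by simp
      qed simp
    qed
    also have "\<dots> = (\<integral>\<^sup>+t. (\<integral>\<^sup>+a. (\<integral>\<^sup>+b. ennreal ?c * (ennreal (std_normal_density t) * ?K x a b t) \<partial>M) \<partial>\<nu>) \<partial>lborel)"
      by (simp add: nn_integral_cmult mult.assoc)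
    also have "\<dots> = (\<integral>\<^sup>+a. (\<integral>\<^sup>+t. (\<integral>\<^sup>+b. ennreal ?c * (ennreal (std_normal_density t) * ?K x a b t) \<partial>M) \<partial>lborel) \<partial>\<nu>)"
      by (rule Ln.Fubini'[symmetric]) measurable
    also have "\<dots> = (\<integral>\<^sup>+a. (\<integral>\<^sup>+b. (\<integral>\<^sup>+t. ennreal ?c * (ennreal (std_normal_density t) * ?K x a b t) \<partial>lborel) \<partial>M) \<partial>\<nu>)"
      by (intro nn_integral_cong Lm.Fubini'[symmetric]) measurable
    also have "\<dots> = ennreal ?c * (\<integral>\<^sup>+a. (\<integral>\<^sup>+b. (\<integral>\<^sup>+t. ?K x a b t \<partial>std_normal_distribution) \<partial>M) \<partial>\<nu>)"
      by (simp add: nn_integral_cmult nn_integral_density)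
    also have "\<dots> = ennreal ?c * (\<integral>\<^sup>+y. ennreal (exp (- (norm (x - y) / \<epsilon>)\<^sup>2 / 2)) \<partial>dilation_law \<nu> M)"
      by (subst nn_integral_dilation_law[OF \<nu> M]) auto
    finally show ?thesis .
  qed
  then have "(\<integral>\<^sup>+x. (\<integral>\<^sup>+t\<in>{1..2}. (\<integral>\<^sup>+a. (\<integral>\<^sup>+b. ?K x a b t \<partial>M) \<partial>\<nu>) \<partial>lborel) \<partial>\<mu>)
     \<le> (\<integral>\<^sup>+x. ennreal ?c * (\<integral>\<^sup>+y. ennreal (exp (- (norm (x - y) / \<epsilon>)\<^sup>2 / 2)) \<partial>dilation_law \<nu> M) \<partial>\<mu>)"
    by (intro nn_integral_mono)
  also have "\<dots> \<le> ennreal ?c * gauss_energy \<mu> (dilation_law \<nu> M) \<epsilon>"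
    unfolding gauss_energy_def by (subst nn_integral_cmult) auto
  finally show ?thesis .
qed

section \<open>Upper bounds for Gaussian energies\<close>

lemma gauss_energy_le_riesz_energy:
  fixes \<mu> :: "'a::euclidean_space measure"
  assumes fin: "finite_measure \<mu>" and \<mu>: "sets \<mu> = sets borel" and \<alpha>: "0 < \<alpha>" and \<rho>: "0 < \<rho>"
  shows "gauss_energy \<mu> \<mu> \<rho> \<le> ennreal (\<alpha> powr (\<alpha> / 2) * \<rho> powr \<alpha>) * riesz_energy \<alpha> \<mu>"
proof -
  interpret finite_measure \<mu> by (rule fin)
  note [measurable_cong] = \<mu>
  let ?c = "\<alpha> powr (\<alpha> / 2) * \<rho> powr \<alpha>"
  have c: "?c > 0" using \<alpha> \<rho> by simp
  have pt: "ennreal (exp (- (norm (x - y) / \<rho>)\<^sup>2 / 2)) \<le> ennreal ?c * inverse (ennreal (dist x y powr \<alpha>))" for x y :: 'a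
  proof (cases "x = y")
    case True
    \<comment> \<open>On the diagonal the Riesz kernel is infinite, so positivity of the constant is
      enough.\<close>
    then show ?thesis using c \<alpha> by (simp add: ennreal_mult_top less_imp_neq[OF \<rho>, symmetric])
  next
    case False
    define u where "u = norm (x - y) / \<rho>"
    have u: "u > 0" using False \<rho> by (simp add: u_def)
    \<comment> \<open>The inequality x^s <= (2s)^s exp(x/2) with x = u^2 and s = \<alpha>/2 compares
      the two kernels and produces the constant \<alpha>^(\<alpha>/2).\<close>
    have "(u\<^sup>2) powr (\<alpha> / 2) \<le> (2 * (\<alpha> / 2)) powr (\<alpha> / 2) * exp (u\<^sup>2 / 2)"
      using \<alpha> by (intro powr_le_exp_half) auto
    moreover have "(u\<^sup>2) powr (\<alpha> / 2) = u powr \<alpha>"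
    proof -
      have "u\<^sup>2 = u powr 2" using u by simp
      then show ?thesis by (simp only: powr_powr) simp
    qed
    ultimately have "u powr \<alpha> * exp (- u\<^sup>2 / 2) \<le> \<alpha> powr (\<alpha> / 2)"
      by (simp add: exp_minus field_simps)
    moreover have "u powr \<alpha> = dist x y powr \<alpha> / \<rho> powr \<alpha>"
      using \<rho> by (simp add: u_def powr_divide dist_norm)
    ultimately have "exp (- u\<^sup>2 / 2) \<le> ?c * inverse (dist x y powr \<alpha>)"
      using \<rho> False by (simp add: field_simps)
    then have "ennreal (exp (- u\<^sup>2 / 2)) \<le> ennreal (?c * inverse (dist x y powr \<alpha>))" by (rule ennreal_leI)
    also have "\<dots> = ennreal ?c * inverse (ennreal (dist x y powr \<alpha>))"
      using False by (subst ennreal_mult) (auto simp: inverse_ennreal)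
    finally show ?thesis by (simp add: u_def)
  qed
  have "gauss_energy \<mu> \<mu> \<rho> \<le> (\<integral>\<^sup>+x. (\<integral>\<^sup>+y. ennreal ?c * inverse (ennreal (dist x y powr \<alpha>)) \<partial>\<mu>) \<partial>\<mu>)"
    unfolding gauss_energy_def by (intro nn_integral_mono pt)
  also have "\<dots> = (\<integral>\<^sup>+x. ennreal ?c * (\<integral>\<^sup>+y. inverse (ennreal (dist x y powr \<alpha>)) \<partial>\<mu>) \<partial>\<mu>)"
    by (intro nn_integral_cong nn_integral_cmult) measurable
  also have "\<dots> \<le> ennreal ?c * (\<integral>\<^sup>+x. (\<integral>\<^sup>+y. inverse (ennreal (dist x y powr \<alpha>)) \<partial>\<mu>) \<partial>\<mu>)"
    by (subst nn_integral_cmult) auto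
  finally show ?thesis by (simp add: riesz_energy_def)
qed

text \<open>The layer bound controls the inner integral, with the distance to x as layer function;
  the outer integral contributes the total mass. Linearity in the mass is what the treatment of
  exceptional sets relies on.\<close>

lemma gauss_energy_le_growth:
  fixes \<nu> :: "'a::euclidean_space measure"
  assumes \<nu>: "sets \<nu> = sets borel"
    and s: "0 \<le> s" and C: "0 \<le> C" and \<rho>: "0 < \<rho>"
    and growth: "\<And>x r. \<rho> \<le> r \<Longrightarrow> emeasure \<nu> (ball x r) \<le> ennreal (C * r powr s)"
  shows "gauss_energy \<nu> \<nu> \<rho> \<le> ennreal (C * layer_const s * \<rho> powr s) * emeasure \<nu> UNIV"
proof -
  note [measurable_cong] = \<nu>
  have sp: "space \<nu> = UNIV" using sets_eq_imp_space_eq[OF \<nu>] by simp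
  have "(\<integral>\<^sup>+y. ennreal (exp (- (norm (x - y) / \<rho>)\<^sup>2 / 2)) \<partial>\<nu>) \<le> ennreal (C * layer_const s * \<rho> powr s)" for x
  proof (rule nn_integral_gaussian_layer[OF _ _ s C \<rho>])
    fix r assume "\<rho> \<le> r"
    have "{y \<in> space \<nu>. norm (x - y) < r} = ball x r" by (auto simp: sp dist_norm)
    then show "emeasure \<nu> {y \<in> space \<nu>. norm (x - y) < r} \<le> ennreal (C * r powr s)"
      using growth[OF \<open>\<rho> \<le> r\<close>] by simp
  qed auto
  then have "gauss_energy \<nu> \<nu> \<rho> \<le> (\<integral>\<^sup>+x. ennreal (C * layer_const s * \<rho> powr s) \<partial>\<nu>)"
    unfolding gauss_energy_def by (intro nn_integral_mono)
  then show ?thesis by (simp add: sp)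
qed

text \<open>\<open>point_measure\<close> lives on the subsets of S; the image under the identity
  moves it to the Borel sets, as the Fourier lemmas require.\<close>

definition point_masses :: "'a::euclidean_space set \<Rightarrow> ('a \<Rightarrow> real) \<Rightarrow> 'a measure" where
  "point_masses S w = distr (point_measure S (\<lambda>x. ennreal (w x))) borel (\<lambda>x. x)"

lemma sets_point_masses: "sets (point_masses S w) = sets borel"
  by (simp add: point_masses_def)

lemma nn_integral_point_masses:
  assumes "finite S" and "f \<in> borel_measurable borel"
  shows "(\<integral>\<^sup>+x. f x \<partial>point_masses S w) = (\<Sum>x\<in>S. ennreal (w x) * f x)"
  unfolding point_masses_def using assms
  by (subst nn_integral_distr) (auto simp: nn_integral_point_measure_finite measurable_def space_point_measure sets_point_measure)

lemma emeasure_point_masses: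
  assumes "finite S" and "B \<in> sets borel" and "\<And>x. x \<in> S \<Longrightarrow> 0 \<le> w x"
  shows "emeasure (point_masses S w) B = ennreal (\<Sum>x\<in>S \<inter> B. w x)"
proof -
  have "emeasure (point_masses S w) B = (\<integral>\<^sup>+x. indicator B x \<partial>point_masses S w)"
    using assms by (simp add: sets_point_masses)
  also have "\<dots> = (\<Sum>x\<in>S. ennreal (w x) * indicator B x)"
    using assms by (intro nn_integral_point_masses) auto
  also have "\<dots> = (\<Sum>x\<in>S \<inter> B. ennreal (w x))"
    using assms(1) by (auto simp: indicator_def sum.inter_restrict if_distrib cong: if_cong intro!: sum.cong)
  also have "\<dots> = ennreal (\<Sum>x\<in>S \<inter> B. w x)"
    using assms by (intro sum_ennreal) auto
  finally show ?thesis .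
qed

lemma finite_point_masses:
  assumes "finite S" and "\<And>x. x \<in> S \<Longrightarrow> 0 \<le> w x"
  shows "finite_measure (point_masses S w)"
proof
  have "space (point_masses S w) = UNIV" using sets_eq_imp_space_eq[OF sets_point_masses] by simp
  then show "emeasure (point_masses S w) (space (point_masses S w)) \<noteq> \<infinity>"
    using emeasure_point_masses[of S UNIV w] assms by simp
qed

section \<open>Separated sets and Hausdorff measure\<close>

definition separated_by :: "real \<Rightarrow> 'a::metric_space set \<Rightarrow> bool" where
  "separated_by \<epsilon> S \<longleftrightarrow> (\<forall>a\<in>S. \<forall>b\<in>S. a \<noteq> b \<longrightarrow> \<epsilon> \<le> dist a b)"

lemma separated_by_subset: "separated_by \<epsilon> S \<Longrightarrow> T \<subseteq> S \<Longrightarrow> \<delta> \<le> \<epsilon> \<Longrightarrow> separated_by \<delta> T"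
  unfolding separated_by_def by (meson order_trans subsetD)

text \<open>Compare volumes: the balls of radius \<epsilon>/2 about the points are disjoint and lie
  in the ball of radius R + \<epsilon>/2.\<close>

lemma card_separated_le:
  fixes S :: "'a::euclidean_space set"
  assumes S: "finite S" "S \<subseteq> cball 0 R" "separated_by \<epsilon> S" and \<epsilon>: "0 < \<epsilon>" and R: "0 \<le> R"
  shows "real (card S) \<le> ((2 * R + \<epsilon>) / \<epsilon>) ^ DIM('a)"
proof -
  let ?V = "unit_ball_vol (real DIM('a))"
  have V: "?V > 0" by simp
  have dis: "disjoint_family_on (\<lambda>s. ball s (\<epsilon> / 2)) S"
    unfolding disjoint_family_on_def
  proof (intro ballI impI)
    fix a b assume "a \<in> S" "b \<in> S" "a \<noteq> b"
    then have "\<epsilon> / 2 + \<epsilon> / 2 \<le> dist a b" using S(3) by (auto simp: separated_by_def)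
    then show "ball a (\<epsilon> / 2) \<inter> ball b (\<epsilon> / 2) = {}" by (rule disjoint_ballI)
  qed
  have "ennreal (real (card S) * (?V * (\<epsilon> / 2) ^ DIM('a))) = (\<Sum>s\<in>S. emeasure lborel (ball s (\<epsilon> / 2)))"
    using \<epsilon> by (simp add: emeasure_ball ennreal_mult' ennreal_of_nat_eq_real_of_nat)
  also have "\<dots> = emeasure lborel (\<Union>s\<in>S. ball s (\<epsilon> / 2))"
    by (rule sum_emeasure) (use dis S(1) in auto)
  also have "\<dots> \<le> emeasure lborel (ball (0::'a) (R + \<epsilon> / 2))"
  proof (rule emeasure_mono)
    show "(\<Union>s\<in>S. ball s (\<epsilon> / 2)) \<subseteq> ball 0 (R + \<epsilon> / 2)"
    proof
      fix y assume "y \<in> (\<Union>s\<in>S. ball s (\<epsilon> / 2))"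
      then obtain s where s: "s \<in> S" "dist s y < \<epsilon> / 2" by auto
      have "dist 0 y \<le> dist 0 s + dist s y" by (rule dist_triangle)
      with s S(2) show "y \<in> ball 0 (R + \<epsilon> / 2)" by force
    qed
  qed simp
  also have "\<dots> = ennreal (?V * (R + \<epsilon> / 2) ^ DIM('a))"
    using \<epsilon> R by (simp add: emeasure_ball)
  finally have "real (card S) * (?V * (\<epsilon> / 2) ^ DIM('a)) \<le> ?V * (R + \<epsilon> / 2) ^ DIM('a)"
    using \<epsilon> R by (subst (asm) ennreal_le_iff) auto
  then have "?V * (real (card S) * (\<epsilon> / 2) ^ DIM('a)) \<le> ?V * (R + \<epsilon> / 2) ^ DIM('a)"
    by (simp only: mult.left_commute)
  then have "real (card S) * (\<epsilon> / 2) ^ DIM('a) \<le> (R + \<epsilon> / 2) ^ DIM('a)"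
    by (rule mult_left_le_imp_le) (rule V)
  then have "real (card S) \<le> ((R + \<epsilon> / 2) / (\<epsilon> / 2)) ^ DIM('a)"
    using \<epsilon> unfolding power_divide[of "R + \<epsilon> / 2" "\<epsilon> / 2"] by (subst pos_le_divide_eq) auto
  also have "(R + \<epsilon> / 2) / (\<epsilon> / 2) = (2 * R + \<epsilon>) / \<epsilon>" using \<epsilon> by (simp add: field_simps)
  finally show ?thesis .
qed

text \<open>Volume bounds the cardinality of separated subsets, so one of greatest cardinality
  exists; an uncovered point could be added to it.\<close>

lemma maximal_separated:
  fixes E :: "'a::euclidean_space set"
  assumes "bounded E" and \<epsilon>: "0 < \<epsilon>"
  obtains S where "finite S" "S \<subseteq> E" "separated_by \<epsilon> S" "E \<subseteq> (\<Union>s\<in>S. ball s \<epsilon>)"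
proof -
  obtain R where R: "R \<ge> 0" "E \<subseteq> cball 0 R"
    using bounded_subset_ballD[OF assms(1), of 0] by (meson ball_subset_cball less_imp_le order_trans)
  define P where "P = (\<lambda>S. finite S \<and> S \<subseteq> E \<and> separated_by \<epsilon> S)"
  have bound: "\<forall>S. P S \<longrightarrow> card S < Suc (nat \<lceil>((2 * R + \<epsilon>) / \<epsilon>) ^ DIM('a)\<rceil>)"
  proof (intro allI impI)
    fix S assume "P S"
    then have "real (card S) \<le> ((2 * R + \<epsilon>) / \<epsilon>) ^ DIM('a)"
      using R \<epsilon> unfolding P_def by (intro card_separated_le) auto
    then show "card S < Suc (nat \<lceil>((2 * R + \<epsilon>) / \<epsilon>) ^ DIM('a)\<rceil>)" by linarith
  qed
  have "P {}" by (simp add: P_def separated_by_def)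
  from ex_has_greatest_nat[where f = card, OF this bound]
  obtain S where S: "P S" "\<And>T. P T \<Longrightarrow> card T \<le> card S" by blast
  have "E \<subseteq> (\<Union>s\<in>S. ball s \<epsilon>)"
  proof (rule ccontr)
    assume "\<not> E \<subseteq> (\<Union>s\<in>S. ball s \<epsilon>)"
    then obtain x where x: "x \<in> E" "x \<notin> (\<Union>s\<in>S. ball s \<epsilon>)" by blast
    have x': "\<epsilon> \<le> dist s x" if "s \<in> S" for s using x(2) that by (simp add: not_less)
    then have "x \<notin> S" using \<epsilon> by (metis dist_self linorder_not_le)
    moreover have "P (insert x S)"
      using S(1) x(1) x' by (auto simp: P_def separated_by_def dist_commute)
    ultimately show False using S(2)[of "insert x S"] S(1) by (simp add: P_def)
  qed
  then show ?thesis using that[of S] S(1) by (simp add: P_def)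
qed

section \<open>Hausdorff measure of separated pieces, and vanishing content\<close>

lemma hausdorff_pre_antimono: "\<delta> \<le> \<delta>' \<Longrightarrow> hausdorff_pre s \<delta>' E \<le> hausdorff_pre s \<delta> E"
  unfolding hausdorff_pre_def by (rule Inf_superset_mono) (auto intro: order_trans)

lemma hausdorff_pre_mono: "E \<subseteq> F \<Longrightarrow> hausdorff_pre s \<delta> E \<le> hausdorff_pre s \<delta> F"
  unfolding hausdorff_pre_def by (rule Inf_superset_mono) auto

lemma hausdorff_measure_mono: "E \<subseteq> F \<Longrightarrow> hausdorff_measure s E \<le> hausdorff_measure s F"
  unfolding hausdorff_measure_def by (intro SUP_mono) (auto intro: hausdorff_pre_mono)

lemma diam_power_empty [simp]: "diam_power s {} = 0"
  by (simp add: diam_power_def)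

text \<open>A set of diameter less than the gap meets at most one of the pieces.\<close>

lemma hausdorff_pre_separated:
  fixes E :: "'i \<Rightarrow> 'a::metric_space set"
  assumes I: "finite I" and gap: "\<And>i j x y. i \<in> I \<Longrightarrow> j \<in> I \<Longrightarrow> i \<noteq> j \<Longrightarrow> x \<in> E i \<Longrightarrow> y \<in> E j \<Longrightarrow> c \<le> dist x y"
    and \<delta>: "0 \<le> \<delta>" "\<delta> < c"
  shows "(\<Sum>i\<in>I. hausdorff_pre s \<delta> (E i)) \<le> hausdorff_pre s \<delta> (\<Union>i\<in>I. E i)"
  unfolding hausdorff_pre_def[of s \<delta> "\<Union>i\<in>I. E i"]
proof (rule Inf_greatest, clarify)
  fix U :: "nat \<Rightarrow> 'a set"
  assume U: "(\<Union>i\<in>I. E i) \<subseteq> (\<Union>n. U n)" "\<forall>n. bounded (U n) \<and> diameter (U n) \<le> \<delta>"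
  \<comment> \<open>For each i only the covering sets meeting \<open>E i\<close> are kept; replacing
    the others by {} makes them free even for s = 0.\<close>
  define V where "V = (\<lambda>i n. if U n \<inter> E i = {} then {} else U n)"
  have "(\<Sum>i\<in>I. hausdorff_pre s \<delta> (E i)) \<le> (\<Sum>i\<in>I. \<Sum>n. diam_power s (V i n))"
  proof (intro sum_mono)
    fix i assume i: "i \<in> I"
    have "E i \<subseteq> (\<Union>n. V i n)"
    proof
      fix x assume "x \<in> E i"
      moreover from this obtain n where "x \<in> U n" using U(1) i by blast
      ultimately have "x \<in> V i n" by (auto simp: V_def)
      then show "x \<in> (\<Union>n. V i n)" by blast
    qed
    moreover have "\<forall>n. bounded (V i n) \<and> diameter (V i n) \<le> \<delta>" using U(2) \<delta> by (auto simp: V_def)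
    ultimately show "hausdorff_pre s \<delta> (E i) \<le> (\<Sum>n. diam_power s (V i n))"
      unfolding hausdorff_pre_def by (intro Inf_lower CollectI exI[of _ "V i"]) auto
  qed
  also have "\<dots> = (\<Sum>n. \<Sum>i\<in>I. diam_power s (V i n))" by (rule suminf_sum[symmetric]) auto
  also have "\<dots> \<le> (\<Sum>n. diam_power s (U n))"
  proof (intro suminf_le)
    fix n
    show "(\<Sum>i\<in>I. diam_power s (V i n)) \<le> diam_power s (U n)"
    proof (cases "\<exists>i\<in>I. U n \<inter> E i \<noteq> {}")
      case True
      then obtain i x where i: "i \<in> I" "x \<in> U n" "x \<in> E i" by blast
      have "U n \<inter> E j = {}" if j: "j \<in> I" "j \<noteq> i" for j
      proof (rule ccontr)
        assume "U n \<inter> E j \<noteq> {}"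
        then obtain y where y: "y \<in> U n" "y \<in> E j" by blast
        have "dist x y \<le> diameter (U n)" using U(2) i y by (intro diameter_bounded_bound) auto
        moreover have "c \<le> dist x y" using gap[OF i(1) j(1) _ i(3) y(2)] j by auto
        ultimately show False using U(2) \<delta> by (meson linorder_not_le order_trans)
      qed
      then have "(\<Sum>j\<in>I. diam_power s (V j n)) = (\<Sum>j\<in>I. if j = i then diam_power s (V i n) else 0)"
        by (intro sum.cong) (auto simp: V_def)
      also have "\<dots> = diam_power s (V i n)" using I i by simp
      finally show ?thesis by (auto simp: V_def)
    qed (auto simp: V_def)
  qed auto
  finally show "(\<Sum>i\<in>I. hausdorff_pre s \<delta> (E i)) \<le> (\<Sum>n. diam_power s (U n))" .
qed

text \<open>Below the gap every premeasure is superadditive, and the premeasures increase as the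
  scale shrinks, so the supremum passes through the finite sum. This takes the place of additivity
  on disjoint Borel sets.\<close>

lemma hausdorff_measure_separated:
  fixes E :: "'i \<Rightarrow> 'a::metric_space set"
  assumes I: "finite I" and gap: "\<And>i j x y. i \<in> I \<Longrightarrow> j \<in> I \<Longrightarrow> i \<noteq> j \<Longrightarrow> x \<in> E i \<Longrightarrow> y \<in> E j \<Longrightarrow> c \<le> dist x y"
    and c: "0 < c"
  shows "(\<Sum>i\<in>I. hausdorff_measure s (E i)) \<le> hausdorff_measure s (\<Union>i\<in>I. E i)"
proof -
  \<comment> \<open>The offset 2 keeps every scale strictly below the gap c.\<close>
  define \<delta> where "\<delta> = (\<lambda>n::nat. c / (real n + 2))"
  have \<delta>: "0 < \<delta> n" "\<delta> n < c" for n using c by (auto simp: \<delta>_def divide_less_eq)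
  have le: "hausdorff_measure s F \<le> (SUP n. hausdorff_pre s (\<delta> n) F)" for F :: "'a set"
    unfolding hausdorff_measure_def
  proof (rule SUP_least)
    fix d :: real assume "d \<in> {0<..}"
    then have d: "d > 0" by simp
    obtain n :: nat where "c / d < real n" using reals_Archimedean2 by blast
    then have "c < d * real n" using d by (simp add: divide_less_eq mult.commute)
    then have "c \<le> d * (real n + 2)" using d by (simp add: distrib_left)
    then have "\<delta> n \<le> d" by (simp add: \<delta>_def divide_le_eq)
    then have "hausdorff_pre s d F \<le> hausdorff_pre s (\<delta> n) F" by (rule hausdorff_pre_antimono)
    then show "hausdorff_pre s d F \<le> (SUP n. hausdorff_pre s (\<delta> n) F)" by (rule SUP_upper2[OF UNIV_I])
  qed
  have inc: "incseq (\<lambda>n. hausdorff_pre s (\<delta> n) F)" for F :: "'a set"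
    unfolding incseq_def using c by (auto simp: \<delta>_def intro!: hausdorff_pre_antimono divide_left_mono)
  have "(\<Sum>i\<in>I. hausdorff_measure s (E i)) \<le> (\<Sum>i\<in>I. SUP n. hausdorff_pre s (\<delta> n) (E i))"
    by (intro sum_mono le)
  also have "\<dots> = (SUP n. \<Sum>i\<in>I. hausdorff_pre s (\<delta> n) (E i))"
    by (rule ennreal_SUP_sum[symmetric]) (rule inc)
  also have "\<dots> \<le> hausdorff_measure s (\<Union>i\<in>I. E i)"
  proof (rule SUP_least)
    fix n
    have "(\<Sum>i\<in>I. hausdorff_pre s (\<delta> n) (E i)) \<le> hausdorff_pre s (\<delta> n) (\<Union>i\<in>I. E i)"
      by (rule hausdorff_pre_separated[OF I gap]) (use \<delta>[of n] in auto)
    also have "\<dots> \<le> hausdorff_measure s (\<Union>i\<in>I. E i)"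
      unfolding hausdorff_measure_def by (rule SUP_upper) (use \<delta> in auto)
    finally show "(\<Sum>i\<in>I. hausdorff_pre s (\<delta> n) (E i)) \<le> hausdorff_measure s (\<Union>i\<in>I. E i)" .
  qed
  finally show ?thesis .
qed

text \<open>Vanishing of the Hausdorff content: diameters of the covering sets are unrestricted, so
  for each e a cover at a single scale is enough.\<close>

definition content_null :: "real \<Rightarrow> 'a::metric_space set \<Rightarrow> bool" where
  "content_null s E \<longleftrightarrow> (\<forall>e>0. \<exists>U::nat \<Rightarrow> 'a set. E \<subseteq> (\<Union>n. U n) \<and> (\<forall>n. bounded (U n)) \<and>
     (\<Sum>n. ennreal (diameter (U n) powr s)) \<le> ennreal e)"

text \<open>For s > 0 a small sum forces every single diameter to be small, so covers of small
  content are automatically fine.\<close>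

lemma content_null_hausdorff_measure:
  fixes E :: "'a::metric_space set"
  assumes s: "0 < s" and E: "content_null s E"
  shows "hausdorff_measure s E = 0"
proof -
  have "hausdorff_pre s \<delta> E \<le> ennreal e" if \<delta>: "\<delta> > 0" and e: "e > 0" for \<delta> e
  proof -
    have "min e (\<delta> powr s) > 0" using \<delta> e by simp
    then obtain U :: "nat \<Rightarrow> 'a set" where U: "E \<subseteq> (\<Union>n. U n)" "\<And>n. bounded (U n)"
      "(\<Sum>n. ennreal (diameter (U n) powr s)) \<le> ennreal (min e (\<delta> powr s))"
      using E unfolding content_null_def by blast
    have "diameter (U n) \<le> \<delta>" for n
    proof (rule ccontr)
      assume n: "\<not> diameter (U n) \<le> \<delta>"
      have "ennreal (diameter (U n) powr s) = (\<Sum>n\<in>{n}. ennreal (diameter (U n) powr s))" by simp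
      also have "\<dots> \<le> (\<Sum>n. ennreal (diameter (U n) powr s))" by (rule sum_le_suminf) auto
      also have "\<dots> \<le> ennreal (\<delta> powr s)" using U(3) by (rule order_trans) (auto intro: ennreal_leI)
      finally have "diameter (U n) powr s \<le> \<delta> powr s" by (simp add: ennreal_le_iff)
      moreover have "\<delta> powr s < diameter (U n) powr s" using n \<delta> s by (intro powr_less_mono2) auto
      ultimately show False by simp
    qed
    then have "hausdorff_pre s \<delta> E \<le> (\<Sum>n. diam_power s (U n))"
      unfolding hausdorff_pre_def using U by (intro Inf_lower CollectI exI[of _ U]) auto
    also have "\<dots> \<le> (\<Sum>n. ennreal (diameter (U n) powr s))"
      by (intro suminf_le) (use s in \<open>auto simp: diam_power_def\<close>)
    also have "\<dots> \<le> ennreal e" using U(3) by (rule order_trans) (auto intro: ennreal_leI)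
    finally show ?thesis .
  qed
  then have "hausdorff_pre s \<delta> E \<le> 0 + ennreal e" if "\<delta> > 0" "e > 0" for \<delta> e
    using that by simp
  then have "hausdorff_pre s \<delta> E \<le> 0" if "\<delta> > 0" for \<delta>
    using that by (rule_tac ennreal_le_epsilon) simp
  then show ?thesis unfolding hausdorff_measure_def
    by (intro antisym SUP_least) auto
qed

lemma content_nullI_finite:
  fixes E :: "'a::metric_space set"

  assumes "\<And>e. 0 < e \<Longrightarrow> \<exists>\<G>. finite \<G> \<and> E \<subseteq> \<Union>\<G> \<and> (\<forall>U\<in>\<G>. bounded U) \<and> (\<Sum>U\<in>\<G>. diameter U powr s) \<le> e"
  shows "content_null s E"
  unfolding content_null_def
proof (intro allI impI)
  fix e :: real assume "e > 0"
  then obtain \<G> where \<G>: "finite \<G>" "E \<subseteq> \<Union>\<G>" "\<And>U. U \<in> \<G> \<Longrightarrow> bounded U" "(\<Sum>U\<in>\<G>. diameter U powr s) \<le> e"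
    using assms[OF \<open>e > 0\<close>] by (elim exE conjE) blast
  obtain f where f: "bij_betw f {..<card \<G>} \<G>"
    using ex_bij_betw_nat_finite[OF \<G>(1)] by (auto simp: lessThan_atLeast0)
  define V where "V = (\<lambda>n. if n < card \<G> then f n else {})"
  have "E \<subseteq> (\<Union>n. V n)"
  proof
    fix x assume "x \<in> E"
    then obtain U where "U \<in> \<G>" "x \<in> U" using \<G>(2) by blast
    moreover from this have "U \<in> f ` {..<card \<G>}" using bij_betw_imp_surj_on[OF f] by simp
    then obtain n where "n < card \<G>" "f n = U" by auto
    ultimately have "x \<in> V n" by (simp add: V_def)
    then show "x \<in> (\<Union>n. V n)" by blast
  qed
  moreover have "bounded (V n)" for n
    using \<G>(3) bij_betwE[OF f] by (simp add: V_def)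
  moreover have "(\<Sum>n. ennreal (diameter (V n) powr s)) \<le> ennreal e"
  proof -
    have "(\<Sum>n. ennreal (diameter (V n) powr s)) = (\<Sum>n<card \<G>. ennreal (diameter (V n) powr s))"
      by (rule suminf_finite) (auto simp: V_def)
    also have "\<dots> = ennreal (\<Sum>n<card \<G>. diameter (f n) powr s)"
      by (simp add: V_def)
    also have "(\<Sum>n<card \<G>. diameter (f n) powr s) = (\<Sum>U\<in>\<G>. diameter U powr s)"
      by (rule sum.reindex_bij_betw[OF f])
    finally show ?thesis using \<G>(4) by (simp add: ennreal_leI)
  qed
  ultimately show "\<exists>U::nat \<Rightarrow> 'a set. E \<subseteq> (\<Union>n. U n) \<and> (\<forall>n. bounded (U n)) \<and>
     (\<Sum>n. ennreal (diameter (U n) powr s)) \<le> ennreal e" by blast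
qed

lemma content_null_UN:
  assumes "\<And>i::nat. content_null s (E i)"
  shows "content_null s (\<Union>i. E i)"
  unfolding content_null_def
proof (intro allI impI)
  fix e :: real assume e: "e > 0"
  have "\<exists>U::nat \<Rightarrow> 'a set. E i \<subseteq> (\<Union>n. U n) \<and> (\<forall>n. bounded (U n)) \<and>
     (\<Sum>n. ennreal (diameter (U n) powr s)) \<le> ennreal (e * (1 / 2) ^ Suc i)" for i
  proof -
    have "0 < e * (1 / 2) ^ Suc i" using e by simp
    with assms[of i] show ?thesis unfolding content_null_def by blast
  qed
  then obtain U :: "nat \<Rightarrow> nat \<Rightarrow> 'a set" where U: "\<And>i. E i \<subseteq> (\<Union>n. U i n)" "\<And>i n. bounded (U i n)"
     "\<And>i. (\<Sum>n. ennreal (diameter (U i n) powr s)) \<le> ennreal (e * (1 / 2) ^ Suc i)"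
    by metis
  define V where "V = (\<lambda>k. case prod_decode k of (i, n) \<Rightarrow> U i n)"
  have "(\<Union>i. E i) \<subseteq> (\<Union>k. V k)"
  proof
    fix x assume "x \<in> (\<Union>i. E i)"
    then obtain i n where "x \<in> U i n" using U(1) by blast
    then have "x \<in> V (prod_encode (i, n))" by (simp add: V_def)
    then show "x \<in> (\<Union>k. V k)" by blast
  qed
  moreover have "bounded (V k)" for k using U(2) by (simp add: V_def split: prod.split)
  moreover have "(\<Sum>k. ennreal (diameter (V k) powr s)) \<le> ennreal e"
  proof -
    have "(\<Sum>k. ennreal (diameter (V k) powr s)) = (\<Sum>k. (\<lambda>(i, n). ennreal (diameter (U i n) powr s)) (prod_decode k))"
      by (intro suminf_cong) (simp add: V_def split: prod.split)
    also have "\<dots> = (\<Sum>i. \<Sum>n. ennreal (diameter (U i n) powr s))"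
      by (rule suminf_ennreal_2dimen) simp
    also have "\<dots> \<le> (\<Sum>i. ennreal (e * (1 / 2) ^ Suc i))"
      by (intro suminf_le U(3)) auto
    also have "\<dots> = ennreal (\<Sum>i. e * (1 / 2) ^ Suc i)"
      using e power_half_series by (intro suminf_ennreal2 summable_mult) (auto dest: sums_summable)
    also have "(\<Sum>i. e * (1 / 2) ^ Suc i) = e"
      using sums_unique[OF sums_mult[OF power_half_series, of e]] by simp
    finally show ?thesis .
  qed
  ultimately show "\<exists>U::nat \<Rightarrow> 'a set. (\<Union>i. E i) \<subseteq> (\<Union>n. U n) \<and> (\<forall>n. bounded (U n)) \<and>
     (\<Sum>n. ennreal (diameter (U n) powr s)) \<le> ennreal e" by blast
qed

lemma content_null_subset:
  fixes E F :: "'a::metric_space set"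
  shows "content_null s F \<Longrightarrow> E \<subseteq> F \<Longrightarrow> content_null s E"
  unfolding content_null_def
proof (intro allI impI)
  fix e :: real
  assume "\<forall>e>0. \<exists>U::nat \<Rightarrow> 'a set. F \<subseteq> (\<Union>n. U n) \<and> (\<forall>n. bounded (U n)) \<and>
     (\<Sum>n. ennreal (diameter (U n) powr s)) \<le> ennreal e" "E \<subseteq> F" "0 < e"
  then obtain U :: "nat \<Rightarrow> 'a set" where "F \<subseteq> (\<Union>n. U n)" "\<forall>n. bounded (U n)"
     "(\<Sum>n. ennreal (diameter (U n) powr s)) \<le> ennreal e" by blast
  with \<open>E \<subseteq> F\<close> show "\<exists>U::nat \<Rightarrow> 'a set. E \<subseteq> (\<Union>n. U n) \<and> (\<forall>n. bounded (U n)) \<and>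
     (\<Sum>n. ennreal (diameter (U n) powr s)) \<le> ennreal e" by (intro exI[of _ U]) auto
qed

section \<open>Dimension bounds and consequences of Ahlfors-David regularity\<close>

lemma hausdorff_dim_le:
  assumes "0 \<le> s" and "\<And>\<sigma>. s < \<sigma> \<Longrightarrow> content_null \<sigma> E"
  shows "hausdorff_dim E \<le> ereal s"
proof (rule ereal_le_epsilon2)
  fix e :: real assume "0 < e"
  then have "hausdorff_measure (s + e) E = 0"
    using assms by (intro content_null_hausdorff_measure) auto
  then have "hausdorff_dim E \<le> ereal (s + e)"
    unfolding hausdorff_dim_def using assms(1) \<open>0 < e\<close> by (intro Inf_lower) auto
  then show "hausdorff_dim E \<le> ereal s + ereal e" by simp
qed

lemma hausdorff_dim_nonneg: "0 \<le> hausdorff_dim E"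
  unfolding hausdorff_dim_def by (rule Inf_greatest) auto

text \<open>The balls of radius \<epsilon>/4 about the separated points are at least \<epsilon>/2
  apart, each carries measure at least of order \<epsilon>^s, and all lie in one ball of radius 3r;
  superadditivity then gives the count. If A has diameter 0 the regularity bounds say nothing, but A
  has at most one point.\<close>

lemma ahlfors_david_separated_card:
  fixes A :: "'a::euclidean_space set"
  assumes A: "compact A" and AD: "ahlfors_david_bounds s A (\<lambda>S. hausdorff_measure s (A \<inter> S))" and s: "0 \<le> s"
  obtains C where "C > 0"
    "\<And>S x r \<epsilon>. finite S \<Longrightarrow> S \<subseteq> A \<Longrightarrow> separated_by \<epsilon> S \<Longrightarrow> 0 < \<epsilon> \<Longrightarrow> \<epsilon> \<le> r \<Longrightarrow>
       real (card (S \<inter> ball x r)) \<le> C * (r / \<epsilon>) powr s"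
proof (cases "diameter A = 0")
  case True
  have "real (card (S \<inter> ball x r)) \<le> 1 * (r / \<epsilon>) powr s"
    if "finite S" "S \<subseteq> A" "0 < \<epsilon>" "\<epsilon> \<le> r" for S x r \<epsilon>
  proof -
    have "a = b" if "a \<in> S \<inter> ball x r" "b \<in> S \<inter> ball x r" for a b
      using diameter_bounded_bound[OF compact_imp_bounded[OF A], of a b] that True \<open>S \<subseteq> A\<close> by auto
    then have "card (S \<inter> ball x r) \<le> 1" using \<open>finite S\<close> by (auto simp: card_le_Suc0_iff_eq)
    moreover have "1 \<le> (r / \<epsilon>) powr s" using that s by (intro ge_one_powr_ge_zero) auto
    ultimately show ?thesis by linarith
  qed
  then show ?thesis using that[of 1] by auto
next
  case False
  define D where "D = diameter A"
  have D: "D > 0" using False diameter_ge_0[OF compact_imp_bounded[OF A]] by (simp add: D_def)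
  obtain C0 where C0: "C0 > 0"
    "\<And>x \<delta>. x \<in> A \<Longrightarrow> 0 < \<delta> \<Longrightarrow> \<delta> < D \<Longrightarrow> ennreal (inverse C0 * \<delta> powr s) \<le> hausdorff_measure s (A \<inter> ball x \<delta>)"
    "\<And>x \<delta>. x \<in> A \<Longrightarrow> 0 < \<delta> \<Longrightarrow> \<delta> < D \<Longrightarrow> hausdorff_measure s (A \<inter> ball x \<delta>) \<le> ennreal (C0 * \<delta> powr s)"
    using AD unfolding ahlfors_david_bounds_def D_def by blast
  \<comment> \<open>C0 enters squared, from the lower and the upper bound; 12 is the quotient of the
    radii 3r and \<epsilon>/4 apart from r/\<epsilon>.\<close>
  define K where "K = C0\<^sup>2 * 12 powr s"
  have K: "K > 0" using C0 by (simp add: K_def)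
  \<comment> \<open>For r <= D/4 the radius 3r stays below the diameter. The large ball is recentred
    at a point \<open>s0\<close> of S because the upper bound is available only for centres in
    A.\<close>
  have small: "real (card (S \<inter> ball x r)) \<le> K * (r / \<epsilon>) powr s"
    if S: "finite S" "S \<subseteq> A" "separated_by \<epsilon> S" and \<epsilon>: "0 < \<epsilon>" "\<epsilon> \<le> r" and r: "r \<le> D / 4" for S x r \<epsilon>
  proof (cases "S \<inter> ball x r = {}")
    case True
    then show ?thesis using K by simp
  next
    case False
    then obtain s0 where s0: "s0 \<in> S" "dist x s0 < r" by auto
    let ?T = "S \<inter> ball x r"
    have "of_nat (card ?T) * ennreal (inverse C0 * (\<epsilon> / 4) powr s) = (\<Sum>t\<in>?T. ennreal (inverse C0 * (\<epsilon> / 4) powr s))"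
      by simp
    also have "\<dots> \<le> (\<Sum>t\<in>?T. hausdorff_measure s (A \<inter> ball t (\<epsilon> / 4)))"
      using S(2) \<epsilon> r D by (intro sum_mono C0(2)) auto
    also have "\<dots> \<le> hausdorff_measure s (\<Union>t\<in>?T. A \<inter> ball t (\<epsilon> / 4))"
    proof (rule hausdorff_measure_separated[where c = "\<epsilon> / 2"])
      fix i j y z assume *: "i \<in> ?T" "j \<in> ?T" "i \<noteq> j" "y \<in> A \<inter> ball i (\<epsilon> / 4)" "z \<in> A \<inter> ball j (\<epsilon> / 4)"
      have "\<epsilon> \<le> dist i j" using S(3) * by (auto simp: separated_by_def)
      moreover have "dist i j \<le> dist i y + dist y z + dist z j"
        using dist_triangle[of i j y] dist_triangle[of y j z] by linarith
      ultimately show "\<epsilon> / 2 \<le> dist y z" using * by (simp add: dist_commute)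
    qed (use S \<epsilon> in auto)
    also have "\<dots> \<le> hausdorff_measure s (A \<inter> ball s0 (3 * r))"
    proof (rule hausdorff_measure_mono)
      show "(\<Union>t\<in>?T. A \<inter> ball t (\<epsilon> / 4)) \<subseteq> A \<inter> ball s0 (3 * r)"
      proof
        fix y assume "y \<in> (\<Union>t\<in>?T. A \<inter> ball t (\<epsilon> / 4))"
        then obtain t where t: "t \<in> ?T" "y \<in> A" "dist t y < \<epsilon> / 4" by auto
        have "dist s0 y \<le> dist s0 x + dist x t + dist t y"
          using dist_triangle[of s0 y x] dist_triangle[of x y t] by linarith
        also have "\<dots> < 3 * r" using t s0 \<epsilon> by (simp add: dist_commute)
        finally show "y \<in> A \<inter> ball s0 (3 * r)" using t by simp
      qed
    qed
    also have "\<dots> \<le> ennreal (C0 * (3 * r) powr s)"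
      using s0 S(2) \<epsilon> r D by (intro C0(3)) auto
    finally have "ennreal (real (card ?T) * (inverse C0 * (\<epsilon> / 4) powr s)) \<le> ennreal (C0 * (3 * r) powr s)"
      using C0(1) by (simp add: ennreal_mult ennreal_of_nat_eq_real_of_nat)
    then have "real (card ?T) * (inverse C0 * (\<epsilon> / 4) powr s) \<le> C0 * (3 * r) powr s"
      using C0(1) by (simp add: ennreal_le_iff)
    then have "real (card ?T) * (\<epsilon> / 4) powr s \<le> C0\<^sup>2 * (3 * r) powr s"
      using C0(1) by (simp add: field_simps power2_eq_square)
    then have "real (card ?T) \<le> C0\<^sup>2 * ((3 * r) powr s / (\<epsilon> / 4) powr s)"
      using \<epsilon> by (simp add: pos_le_divide_eq)
    also have "(3 * r) powr s / (\<epsilon> / 4) powr s = (12 * (r / \<epsilon>)) powr s"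
      using \<epsilon> by (simp add: powr_divide[symmetric])
    also have "\<dots> = 12 powr s * (r / \<epsilon>) powr s" by (simp only: powr_mult)
    finally show ?thesis by (simp add: K_def)
  qed
  have "0 < D / 4" using D by simp
  then obtain F where F: "finite F" "F \<subseteq> A" "separated_by (D / 4) F" "A \<subseteq> (\<Union>a\<in>F. ball a (D / 4))"
    by (rule maximal_separated[OF compact_imp_bounded[OF A]])
  have "real (card (S \<inter> ball x r)) \<le> (K * (1 + real (card F))) * (r / \<epsilon>) powr s"
    if S: "finite S" "S \<subseteq> A" "separated_by \<epsilon> S" and \<epsilon>: "0 < \<epsilon>" "\<epsilon> \<le> r" for S x r \<epsilon>
  proof (cases "r \<le> D / 4")
    case True
    have "K * (r / \<epsilon>) powr s \<le> (K * (1 + real (card F))) * (r / \<epsilon>) powr s"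
      using K by (intro mult_right_mono) auto
    then show ?thesis using small[OF S \<epsilon> True, of x] by linarith
  next
    case False
    \<comment> \<open>For larger r the finitely many balls of radius D/4 covering A are counted
      separately; lowering \<epsilon> to at most D/4 makes the small case apply to each.\<close>
    define \<epsilon>' where "\<epsilon>' = min \<epsilon> (D / 4)"
    have \<epsilon>': "0 < \<epsilon>'" "\<epsilon>' \<le> D / 4" "\<epsilon>' \<le> \<epsilon>" using \<epsilon> D by (auto simp: \<epsilon>'_def)
    have q: "(D / 4) / \<epsilon>' \<le> r / \<epsilon>" using False \<epsilon> D by (auto simp: \<epsilon>'_def min_def field_simps)
    have "S \<inter> ball x r \<subseteq> (\<Union>a\<in>F. S \<inter> ball a (D / 4))" using S(2) F(4) by blast
    then have "card (S \<inter> ball x r) \<le> card (\<Union>a\<in>F. S \<inter> ball a (D / 4))"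
      using F(1) S(1) by (intro card_mono) auto
    also have "\<dots> \<le> (\<Sum>a\<in>F. card (S \<inter> ball a (D / 4)))" by (rule card_UN_le) (rule F(1))
    finally have "real (card (S \<inter> ball x r)) \<le> (\<Sum>a\<in>F. real (card (S \<inter> ball a (D / 4))))"
      by (metis of_nat_le_iff of_nat_sum)
    also have "\<dots> \<le> (\<Sum>a\<in>F. K * ((D / 4) / \<epsilon>') powr s)"
      using S \<epsilon>' by (intro sum_mono small) (auto intro: separated_by_subset)
    also have "\<dots> \<le> (\<Sum>a\<in>F. K * (r / \<epsilon>) powr s)"
      using K s \<epsilon>' D q by (intro sum_mono mult_left_mono powr_mono2) auto
    also have "\<dots> = (K * real (card F)) * (r / \<epsilon>) powr s" by simp
    also have "\<dots> \<le> (K * (1 + real (card F))) * (r / \<epsilon>) powr s"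
      using K by (intro mult_right_mono mult_left_mono) auto
    finally show ?thesis .
  qed
  note bound = this
  have pos: "K * (1 + real (card F)) > 0" using K by (intro mult_pos_pos) auto
  show ?thesis by (rule that[OF pos]) (rule bound)
qed

lemma small_power_exists:
  fixes K e q :: real
  assumes "0 < K" "0 < e" "0 < q"
  obtains \<epsilon> where "0 < \<epsilon>" "\<epsilon> \<le> 1" "K * \<epsilon> powr q \<le> e"
proof
  let ?\<epsilon> = "min 1 ((e / K) powr (1 / q))"
  show "0 < ?\<epsilon>" "?\<epsilon> \<le> 1" using assms by auto
  have "?\<epsilon> powr q \<le> ((e / K) powr (1 / q)) powr q" using assms by (intro powr_mono2) auto
  also have "\<dots> = e / K" using assms by (simp add: powr_powr)
  finally show "K * ?\<epsilon> powr q \<le> e" using assms by (simp add: field_simps)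
qed

text \<open>An \<epsilon>-net has at most order \<epsilon>^(-d) points, so its balls have content of
  order \<epsilon>^(\<sigma>-d).\<close>

lemma content_null_above_dimension:
  fixes E :: "'a::euclidean_space set"
  assumes E: "bounded E" and \<sigma>: "real DIM('a) < \<sigma>"
  shows "content_null \<sigma> E"
proof (rule content_nullI_finite)
  fix e :: real assume e: "0 < e"
  obtain R where R: "R > 0" "E \<subseteq> cball 0 R"
    using bounded_subset_ballD[OF E, of 0] by (meson ball_subset_cball order_trans)
  define K where "K = (2 * R + 1) ^ DIM('a) * 2 powr \<sigma>"
  have K: "K > 0" using R by (simp add: K_def)
  have "0 < \<sigma> - real DIM('a)" using \<sigma> by simp
  then obtain \<epsilon> where \<epsilon>: "0 < \<epsilon>" "\<epsilon> \<le> 1" "K * \<epsilon> powr (\<sigma> - real DIM('a)) \<le> e"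
    by (rule small_power_exists[OF K e])
  obtain S where S: "finite S" "S \<subseteq> E" "separated_by \<epsilon> S" "E \<subseteq> (\<Union>s\<in>S. ball s \<epsilon>)"
    by (rule maximal_separated[OF E \<epsilon>(1)])
  let ?G = "(\<lambda>s. ball s \<epsilon>) ` S"
  have "(\<Sum>U\<in>?G. diameter U powr \<sigma>) \<le> (\<Sum>s\<in>S. diameter (ball s \<epsilon>) powr \<sigma>)"
    by (rule order_trans[OF sum_image_le]) (use S in auto)
  also have "\<dots> = real (card S) * (2 * \<epsilon>) powr \<sigma>" using \<epsilon> by simp
  also have "\<dots> \<le> ((2 * R + \<epsilon>) / \<epsilon>) ^ DIM('a) * (2 * \<epsilon>) powr \<sigma>"
    using S R \<epsilon> by (intro mult_right_mono card_separated_le) auto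
  also have "\<dots> \<le> ((2 * R + 1) / \<epsilon>) ^ DIM('a) * (2 * \<epsilon>) powr \<sigma>"
    using R \<epsilon> by (intro mult_right_mono power_mono divide_right_mono) auto
  also have "\<dots> = K * \<epsilon> powr (\<sigma> - real DIM('a))"
    using \<epsilon> by (simp add: K_def power_divide powr_mult powr_diff powr_realpow)
  finally have "(\<Sum>U\<in>?G. diameter U powr \<sigma>) \<le> e" using \<epsilon>(3) by simp
  then show "\<exists>\<G>. finite \<G> \<and> E \<subseteq> \<Union>\<G> \<and> (\<forall>U\<in>\<G>. bounded U) \<and> (\<Sum>U\<in>\<G>. diameter U powr \<sigma>) \<le> e"
    using S by (intro exI[of _ ?G]) auto
qed

lemma hausdorff_dim_le_DIM:
  fixes E :: "'a::euclidean_space set"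
  assumes "bounded E"
  shows "hausdorff_dim E \<le> ereal (real DIM('a))"
  by (rule hausdorff_dim_le) (auto intro: content_null_above_dimension assms)

text \<open>The regularity bounds quantify over no radius when the diameter is 0. Positive dimension
  excludes this, since a bounded set of diameter 0 is its own cover of content 0.\<close>

lemma diameter_pos_if_hausdorff_dim_pos:
  fixes E :: "'a::metric_space set"
  assumes E: "bounded E" and dim: "0 < hausdorff_dim E"
  shows "0 < diameter E"
proof (rule ccontr)
  assume "\<not> 0 < diameter E"
  then have "diameter E = 0" using diameter_ge_0[OF E] by simp
  then have "content_null \<sigma> E" for \<sigma>
    using E by (intro content_nullI_finite exI[of _ "{E}"]) auto
  then have "hausdorff_dim E \<le> ereal 0" by (intro hausdorff_dim_le) auto
  with dim show False by (simp add: zero_ereal_def)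
qed

text \<open>The upper regularity bound is available at radius \<open>diameter B / 2\<close>,
  finitely many such balls cover B, and M has no mass outside B. The lower bound at any point of B
  makes M nonzero.\<close>

lemma ahlfors_david_finite_measure:
  fixes B :: "'a::euclidean_space set"
  assumes B: "compact B" and M: "borel_measure_supported_in M B"
    and AD: "ahlfors_david_bounds s B (emeasure M)" and D: "0 < diameter B"
  shows "finite_measure M" "emeasure M UNIV \<noteq> 0"
proof -
  have sets: "sets M = sets borel" and null: "emeasure M (- B) = 0"
    using M by (auto simp: borel_measure_supported_in_def)
  have sp: "space M = UNIV" using sets_eq_imp_space_eq[OF sets] by simp
  obtain C where C: "C > 0"
    "\<And>x \<delta>. x \<in> B \<Longrightarrow> 0 < \<delta> \<Longrightarrow> \<delta> < diameter B \<Longrightarrow> ennreal (inverse C * \<delta> powr s) \<le> emeasure M (ball x \<delta>)"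
    "\<And>x \<delta>. x \<in> B \<Longrightarrow> 0 < \<delta> \<Longrightarrow> \<delta> < diameter B \<Longrightarrow> emeasure M (ball x \<delta>) \<le> ennreal (C * \<delta> powr s)"
    using AD unfolding ahlfors_david_bounds_def by blast
  let ?\<delta> = "diameter B / 2"
  have "0 < ?\<delta>" using D by simp
  then obtain F where F: "finite F" "F \<subseteq> B" "separated_by ?\<delta> F" "B \<subseteq> (\<Union>a\<in>F. ball a ?\<delta>)"
    by (rule maximal_separated[OF compact_imp_bounded[OF B]])
  have cB: "- B \<in> sets M" and uB: "(\<Union>a\<in>F. ball a ?\<delta>) \<in> sets M"
    using compact_imp_closed[OF B] by (auto simp: sets intro!: borel_open)
  have "emeasure M UNIV \<le> emeasure M ((- B) \<union> (\<Union>a\<in>F. ball a ?\<delta>))"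
    using F(4) sets.Un[OF cB uB] by (intro emeasure_mono) auto
  also have "\<dots> \<le> emeasure M (- B) + emeasure M (\<Union>a\<in>F. ball a ?\<delta>)"
    by (rule emeasure_subadditive[OF cB uB])
  also have "\<dots> \<le> (\<Sum>a\<in>F. emeasure M (ball a ?\<delta>))"
    unfolding null using F(1) by (simp add: sets emeasure_subadditive_finite image_subset_iff)
  also have "\<dots> \<le> (\<Sum>a\<in>F. ennreal (C * ?\<delta> powr s))"
    using F D by (intro sum_mono C(3)) auto
  also have "\<dots> < \<infinity>" using F(1) by (simp add: ennreal_mult_less_top of_nat_less_top)
  finally show "finite_measure M" by (intro finite_measureI) (simp add: sp)
  have "B \<noteq> {}" using D by auto
  then obtain x where "x \<in> B" by blast
  have "0 < ennreal (inverse C * ?\<delta> powr s)" using C(1) D by simp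
  also have "\<dots> \<le> emeasure M (ball x ?\<delta>)" using C(2)[OF \<open>x \<in> B\<close>, of ?\<delta>] D by simp
  also have "\<dots> \<le> emeasure M UNIV" by (rule emeasure_mono) (auto simp: sets)
  finally show "emeasure M UNIV \<noteq> 0" by simp
qed

text \<open>Hyperplanes orthogonal to the directions \<open>u + (j/n) v\<close> with \<open>\<bar>j\<bar> \<le> n\<close> have neighbourhoods of
  width of order \<open>1/n\<close> covering the double cone \<open>\<bar>b \<bullet> u\<bar> \<le> \<bar>b \<bullet> v\<bar>\<close> in a ball, so a bound with
  \<open>p > 1\<close> would make the cone a null set.\<close>

lemma hyperplane_size_bound_cone_null:
  fixes M :: "'a::euclidean_space measure"
  assumes M: "sets M = sets borel" and hyp: "hyperplane_size_bound p M" and p: "1 < p"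
    and u: "u \<in> Basis" "v \<in> Basis" "u \<noteq> v" and R: "0 \<le> R"
  shows "emeasure M {b. norm b \<le> R \<and> \<bar>b \<bullet> u\<bar> \<le> \<bar>b \<bullet> v\<bar>} = 0" (is "emeasure M ?T = 0")
proof -
  obtain C where C: "C > 0" "\<And>\<xi> r. \<xi> \<noteq> 0 \<Longrightarrow> 0 < r \<Longrightarrow> emeasure M {b. \<bar>b \<bullet> \<xi>\<bar> < r} \<le> ennreal (C * (r / norm \<xi>) powr p)"
    using hyperplane_size_boundE[OF hyp] by metis
  define \<xi> where "\<xi> = (\<lambda>n (j::int). u + (real_of_int j / real n) *\<^sub>R v)"
  define r where "r = (\<lambda>n. (R + 1) / real n)"
  have bd: "emeasure M ?T \<le> ennreal (3 * C * (R + 1) powr p * real n powr (1 - p))" if n: "n \<ge> 1" for n :: nat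
  proof -
    have r: "r n > 0" using n R by (simp add: r_def)
    have sets': "{b. \<bar>b \<bullet> \<xi> n j\<bar> < r n} \<in> sets M" for j
    proof -
      have "open {b. \<bar>b \<bullet> \<xi> n j\<bar> < r n}" by (intro open_Collect_less continuous_intros)
      then show ?thesis by (simp add: M)
    qed
    have sub: "?T \<subseteq> (\<Union>j\<in>{- int n..int n}. {b. \<bar>b \<bullet> \<xi> n j\<bar> < r n})"
    proof
      fix b assume "b \<in> ?T"
      then have b: "norm b \<le> R" "\<bar>b \<bullet> u\<bar> \<le> \<bar>b \<bullet> v\<bar>" by auto
      show "b \<in> (\<Union>j\<in>{- int n..int n}. {b. \<bar>b \<bullet> \<xi> n j\<bar> < r n})"
      proof (cases "b \<bullet> v = 0")
        case True
        then have "b \<bullet> \<xi> n 0 = 0" using b by (simp add: \<xi>_def)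
        then have "b \<in> {b. \<bar>b \<bullet> \<xi> n 0\<bar> < r n}" using r by simp
        then show ?thesis by (intro UN_I[of 0]) auto
      next
        case False
        \<comment> \<open>b is orthogonal to u + s v, and |s| <= 1 on the cone; j/n approximates s
          from below within 1/n.\<close>
        define s where "s = - (b \<bullet> u) / (b \<bullet> v)"
        have s: "\<bar>s\<bar> \<le> 1" using b False by (simp add: s_def abs_div divide_le_eq)
        define j where "j = \<lfloor>real n * s\<rfloor>"
        have ns: "\<bar>real n * s\<bar> \<le> real n" using s n by (simp add: abs_mult mult_left_le)
        have j: "real_of_int j \<le> real n * s" "real n * s < real_of_int j + 1" by (auto simp: j_def)
        have "- int n \<le> j" "j \<le> int n" using ns by (auto simp: j_def le_floor_iff floor_le_iff)
        moreover have "\<bar>b \<bullet> \<xi> n j\<bar> < r n"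
        proof -
          have "b \<bullet> \<xi> n j = (b \<bullet> v) * (real_of_int j / real n - s)"
            using False by (simp add: \<xi>_def inner_add_right s_def field_simps)
          moreover have "\<bar>real_of_int j / real n - s\<bar> \<le> 1 / real n"
          proof -
            have "real_of_int j / real n - s = (real_of_int j - real n * s) / real n"
              using n by (simp add: field_simps)
            moreover have "\<bar>real_of_int j - real n * s\<bar> \<le> 1" using j by linarith
            ultimately show ?thesis by (simp add: abs_divide divide_right_mono)
          qed
          moreover have "\<bar>b \<bullet> v\<bar> \<le> R" using Basis_le_norm[OF u(2), of b] b by linarith
          ultimately have "\<bar>b \<bullet> \<xi> n j\<bar> \<le> R * (1 / real n)"
            unfolding abs_mult by (metis abs_mult abs_ge_zero mult_mono R)
          also have "\<dots> < r n" using n by (simp add: r_def divide_strict_right_mono)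
          finally show ?thesis .
        qed
        ultimately show ?thesis by auto
      qed
    qed
    have piece: "emeasure M {b. \<bar>b \<bullet> \<xi> n j\<bar> < r n} \<le> ennreal (C * r n powr p)" for j
    proof -
      \<comment> \<open>The unit coefficient along u keeps the normal vectors from being short, so
        normalising them does not widen the slabs.\<close>
      have "\<xi> n j \<bullet> u = 1" using u by (simp add: \<xi>_def inner_add_left inner_Basis)
      then have \<xi>1: "1 \<le> norm (\<xi> n j)" using Basis_le_norm[OF u(1), of "\<xi> n j"] by simp
      then have "\<xi> n j \<noteq> 0" by auto
      then have "emeasure M {b. \<bar>b \<bullet> \<xi> n j\<bar> < r n} \<le> ennreal (C * (r n / norm (\<xi> n j)) powr p)"
        using r by (rule C(2))
      also have "\<dots> \<le> ennreal (C * r n powr p)"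
        using r C(1) p \<xi>1 by (intro ennreal_leI mult_left_mono powr_mono2) (auto simp: divide_le_eq mult_le_cancel_left1)
      finally show ?thesis .
    qed
    have "emeasure M ?T \<le> emeasure M (\<Union>j\<in>{- int n..int n}. {b. \<bar>b \<bullet> \<xi> n j\<bar> < r n})"
      using sets' by (intro emeasure_mono sub) auto
    also have "\<dots> \<le> (\<Sum>j\<in>{- int n..int n}. emeasure M {b. \<bar>b \<bullet> \<xi> n j\<bar> < r n})"
      using sets' by (intro emeasure_subadditive_finite) auto
    also have "\<dots> \<le> (\<Sum>j\<in>{- int n..int n}. ennreal (C * r n powr p))" by (intro sum_mono piece)
    also have "\<dots> = ennreal (real (2 * n + 1) * (C * r n powr p))"
    proof -
      have "card {- int n..int n} = 2 * n + 1" by simp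
      then show ?thesis using C(1) by (simp add: ennreal_mult ennreal_of_nat_eq_real_of_nat del: of_nat_Suc of_nat_add)
    qed
    \<comment> \<open>There are 2n + 1 <= 3n slabs of mass of order n^(-p) each, leaving n^(1-p),
      which tends to 0 for p > 1.\<close>
    also have "\<dots> \<le> ennreal ((3 * real n) * (C * r n powr p))"
      using n C(1) by (intro ennreal_leI mult_right_mono) auto
    also have "(3 * real n) * (C * r n powr p) = 3 * C * (R + 1) powr p * real n powr (1 - p)"
      using n R by (simp add: r_def powr_divide powr_diff)
    finally show ?thesis .
  qed
  have "(\<lambda>n. 3 * C * (R + 1) powr p * real n powr (1 - p)) \<longlonglongrightarrow> 0"
    using p by (intro tendsto_mult_right_zero tendsto_neg_powr filterlim_real_sequentially) auto
  then have "(\<lambda>n. ennreal (3 * C * (R + 1) powr p * real n powr (1 - p))) \<longlonglongrightarrow> ennreal 0"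
    by (rule tendsto_ennrealI)
  then have "emeasure M ?T \<le> ennreal 0"
    by (rule LIMSEQ_le_const) (use bd in blast)
  then show ?thesis by simp
qed

text \<open>For two distinct basis vectors u and v the cone |b.u| <= |b.v| and the cone with the
  roles exchanged cover the space; for p > 1 both would be null sets inside any ball.\<close>

lemma hyperplane_size_bound_le_1:
  fixes M :: "'a::euclidean_space measure"
  assumes dim: "2 \<le> DIM('a)" and M: "sets M = sets borel" and hyp: "hyperplane_size_bound p M"
    and supp: "emeasure M (- cball 0 R) = 0" and nz: "emeasure M UNIV \<noteq> 0"
  shows "p \<le> 1"
proof (rule ccontr)
  assume "\<not> p \<le> 1"
  then have p: "1 < p" by simp
  obtain u v :: 'a where u: "u \<in> Basis" "v \<in> Basis" "u \<noteq> v"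
    using dim by (metis card_le_Suc0_iff_eq finite_Basis not_less_eq_eq numeral_2_eq_2)
  let ?T = "\<lambda>u v. {b. norm b \<le> max 0 R \<and> \<bar>b \<bullet> u\<bar> \<le> \<bar>b \<bullet> v\<bar>}"
  have T: "?T u v \<in> sets M" for u v
  proof -
    have "closed (?T u v)" by (intro closed_Collect_conj closed_Collect_le continuous_intros)
    then show ?thesis by (simp add: M)
  qed
  have "emeasure M UNIV \<le> emeasure M ((- cball 0 R) \<union> (?T u v \<union> ?T v u))"
    using T by (intro emeasure_mono) (auto simp: M)
  also have "\<dots> \<le> emeasure M (- cball 0 R) + emeasure M (?T u v \<union> ?T v u)"
    using T by (intro emeasure_subadditive) (auto simp: M)
  also have "emeasure M (?T u v \<union> ?T v u) \<le> emeasure M (?T u v) + emeasure M (?T v u)"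
    using T by (intro emeasure_subadditive) auto
  finally have "emeasure M UNIV \<le> 0"
    using hyperplane_size_bound_cone_null[OF M hyp p u, of "max 0 R"]
      hyperplane_size_bound_cone_null[OF M hyp p u(2,1), of "max 0 R"] u(3) supp by auto
  with nz show False by simp
qed

section \<open>A discrete Frostman lemma\<close>

text \<open>Points are treated one at a time: the weight of x is raised until the constraint on some
  set containing x becomes an equality. Equalities reached earlier persist.\<close>

lemma greedy_weights:
  fixes c :: "'a set \<Rightarrow> real"
  assumes X: "finite X" and c: "\<And>F. F \<subseteq> X \<Longrightarrow> 0 \<le> c F"
  shows "\<exists>w. (\<forall>x. 0 \<le> w x) \<and> (\<forall>F\<subseteq>X. sum w F \<le> c F) \<and> (\<forall>x\<in>X. \<exists>F\<subseteq>X. x \<in> F \<and> sum w F = c F)"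
proof -
  have "\<exists>w. (\<forall>x. 0 \<le> w x) \<and> (\<forall>F\<subseteq>X. sum w F \<le> c F) \<and> (\<forall>x\<in>Y. \<exists>F\<subseteq>X. x \<in> F \<and> sum w F = c F)"
    if "finite Y" "Y \<subseteq> X" for Y
    using that
  proof (induction Y rule: finite_induct)
    case empty
    show ?case using c by (intro exI[of _ "\<lambda>_. 0"]) auto
  next
    case (insert x Y)
    then obtain w where w: "\<forall>x. 0 \<le> w x" "\<forall>F\<subseteq>X. sum w F \<le> c F" "\<forall>x\<in>Y. \<exists>F\<subseteq>X. x \<in> F \<and> sum w F = c F"
      by auto
    define \<F> where "\<F> = {F. F \<subseteq> X \<and> x \<in> F}"
    have fin: "finite \<F>" using X by (simp add: \<F>_def)
    have "X \<in> \<F>" using insert.prems by (simp add: \<F>_def)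
    then have ne: "\<F> \<noteq> {}" by blast
    \<comment> \<open>Smallest slack among the sets containing x; a set attaining it becomes
      saturated.\<close>
    define m where "m = Min ((\<lambda>F. c F - sum w F) ` \<F>)"
    have m_le: "m \<le> c F - sum w F" if "F \<in> \<F>" for F using fin that by (simp add: m_def)
    have "m \<in> (\<lambda>F. c F - sum w F) ` \<F>" unfolding m_def using fin ne by (intro Min_in) auto
    then obtain F0 where F0: "F0 \<in> \<F>" "m = c F0 - sum w F0" by blast
    have m0: "0 \<le> m" using F0 w(2) by (auto simp: \<F>_def)
    define w' where "w' = w(x := w x + m)"
    have sum': "sum w' F = sum w F + (if x \<in> F then m else 0)" if "F \<subseteq> X" for F
    proof -
      have "finite F" using that X by (rule finite_subset)
      have "sum w' F = (\<Sum>y\<in>F. w y + (if y = x then m else 0))"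
        by (intro sum.cong) (auto simp: w'_def)
      also have "\<dots> = sum w F + (if x \<in> F then m else 0)"
        using \<open>finite F\<close> by (simp add: sum.distrib)
      finally show ?thesis .
    qed
    have "\<forall>x. 0 \<le> w' x" using w(1) m0 by (simp add: w'_def)
    moreover have "\<forall>F\<subseteq>X. sum w' F \<le> c F"
    proof (intro allI impI)
      fix F assume F: "F \<subseteq> X"
      show "sum w' F \<le> c F" using w(2) F m_le[of F] by (auto simp: sum'[OF F] \<F>_def)
    qed
    moreover have "\<exists>F\<subseteq>X. y \<in> F \<and> sum w' F = c F" if y: "y \<in> insert x Y" for y
    proof (cases "y = x")
      case True
      then show ?thesis using F0 by (intro exI[of _ F0]) (auto simp: \<F>_def sum')
    next
      case False
      then obtain F where F: "F \<subseteq> X" "y \<in> F" "sum w F = c F" using w(3) y by auto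
      \<comment> \<open>If the saturated set F contains x, its slack 0 forces m = 0.\<close>
      have "sum w' F = c F" using F m_le[of F] m0 by (auto simp: sum' \<F>_def)
      then show ?thesis using F by blast
    qed
    ultimately show ?case by (intro exI[of _ w']) auto
  qed
  from this[OF X subset_refl] show ?thesis .
qed

text \<open>Vitali selection: take a set with largest \<rho>, discard everything meeting it, and
  recurse. Excluding the empty set guarantees that the selected set meets itself.\<close>

lemma disjoint_subfamily:
  fixes \<rho> :: "'a set \<Rightarrow> real"
  assumes "finite \<F>" "{} \<notin> \<F>"
  shows "\<exists>\<G>\<subseteq>\<F>. pairwise disjnt \<G> \<and> (\<forall>F\<in>\<F>. \<exists>G\<in>\<G>. F \<inter> G \<noteq> {} \<and> \<rho> F \<le> \<rho> G)"
  using assms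
proof (induction \<F> rule: finite_psubset_induct)
  case (psubset \<F>)
  show ?case
  proof (cases "\<F> = {}")
    case False
    have "Max (\<rho> ` \<F>) \<in> \<rho> ` \<F>" using psubset.hyps False by (intro Max_in) auto
    then obtain G0 where G0: "G0 \<in> \<F>" "\<rho> G0 = Max (\<rho> ` \<F>)" by (metis imageE)
    have max: "\<rho> F \<le> \<rho> G0" if "F \<in> \<F>" for F using G0(2) psubset.hyps that by simp
    define \<F>' where "\<F>' = {F \<in> \<F>. F \<inter> G0 = {}}"
    have "G0 \<notin> \<F>'" using G0 psubset.prems by (auto simp: \<F>'_def)
    then have "\<F>' \<subset> \<F>" using G0 by (auto simp: \<F>'_def)
    moreover have "{} \<notin> \<F>'" using psubset.prems by (auto simp: \<F>'_def)
    ultimately have "\<exists>\<G>\<subseteq>\<F>'. pairwise disjnt \<G> \<and> (\<forall>F\<in>\<F>'. \<exists>G\<in>\<G>. F \<inter> G \<noteq> {} \<and> \<rho> F \<le> \<rho> G)"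
      by (rule psubset.IH)
    then obtain \<G> where \<G>: "\<G> \<subseteq> \<F>'" "pairwise disjnt \<G>"
        "\<forall>F\<in>\<F>'. \<exists>G\<in>\<G>. F \<inter> G \<noteq> {} \<and> \<rho> F \<le> \<rho> G"
      by (elim exE conjE)
    have "pairwise disjnt (insert G0 \<G>)"
      unfolding pairwise_insert using \<G>(1,2) by (auto simp: \<F>'_def disjnt_def)
    moreover have "\<exists>G\<in>insert G0 \<G>. F \<inter> G \<noteq> {} \<and> \<rho> F \<le> \<rho> G" if F: "F \<in> \<F>" for F
    proof (cases "F \<inter> G0 = {}")
      case True
      then have "F \<in> \<F>'" using F by (simp add: \<F>'_def)
      then show ?thesis using \<G>(3) by blast
    next
      case False
      then show ?thesis using max[OF F] by blast
    qed
    moreover have "insert G0 \<G> \<subseteq> \<F>" using G0 \<G>(1) by (auto simp: \<F>'_def)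
    ultimately show ?thesis by (intro exI[of _ "insert G0 \<G>"]) simp
  qed simp
qed

text \<open>The weights are raised greedily until every point lies in a
  saturated set, and a disjoint family of saturated sets has total content at most the total mass.\<close>

lemma discrete_frostman:
  fixes X :: "'a::euclidean_space set"
  assumes X: "finite X" and \<epsilon>: "0 < \<epsilon>" and \<sigma>: "0 \<le> \<sigma>"
  obtains w \<G> where "\<And>x. 0 \<le> w x" "\<And>z r. \<epsilon> \<le> r \<Longrightarrow> sum w (X \<inter> ball z r) \<le> (2 * r) powr \<sigma>"
    "finite \<G>" "(\<Union>x\<in>X. ball x \<epsilon>) \<subseteq> \<Union>\<G>" "\<And>U. U \<in> \<G> \<Longrightarrow> bounded U"
    "(\<Sum>U\<in>\<G>. diameter U powr \<sigma>) \<le> 6 powr \<sigma> * sum w X"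
proof -
  \<comment> \<open>Sets smaller than the resolution \<epsilon> are charged \<epsilon>; with the
    bare diameter, singletons would have capacity 0 and every weight would vanish.\<close>
  define \<rho> where "\<rho> = (\<lambda>F::'a set. max \<epsilon> (diameter F))"
  obtain w where w: "\<forall>x. 0 \<le> w x" "\<forall>F\<subseteq>X. sum w F \<le> \<rho> F powr \<sigma>"
    "\<forall>x\<in>X. \<exists>F\<subseteq>X. x \<in> F \<and> sum w F = \<rho> F powr \<sigma>"
    using greedy_weights[OF X, of "\<lambda>F. \<rho> F powr \<sigma>"] by (elim meta_impE exE conjE) simp_all
  have growth: "sum w (X \<inter> ball z r) \<le> (2 * r) powr \<sigma>" if r: "\<epsilon> \<le> r" for z r
  proof -
    have "diameter (X \<inter> ball z r) \<le> diameter (ball z r)" by (rule diameter_subset) auto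
    also have "\<dots> = 2 * r" using r \<epsilon> by simp
    finally have "\<rho> (X \<inter> ball z r) \<le> 2 * r" using r \<epsilon> by (simp add: \<rho>_def)
    then have "\<rho> (X \<inter> ball z r) powr \<sigma> \<le> (2 * r) powr \<sigma>"
      using \<epsilon> \<sigma> by (intro powr_mono2) (auto simp: \<rho>_def)
    moreover have "sum w (X \<inter> ball z r) \<le> \<rho> (X \<inter> ball z r) powr \<sigma>" using w(2) by simp
    ultimately show ?thesis by linarith
  qed
  define \<F> where "\<F> = {F. F \<subseteq> X \<and> F \<noteq> {} \<and> sum w F = \<rho> F powr \<sigma>}"
  have "finite \<F>" using X by (simp add: \<F>_def)
  moreover have "{} \<notin> \<F>" by (simp add: \<F>_def)
  ultimately have "\<exists>\<G>\<subseteq>\<F>. pairwise disjnt \<G> \<and> (\<forall>F\<in>\<F>. \<exists>G\<in>\<G>. F \<inter> G \<noteq> {} \<and> \<rho> F \<le> \<rho> G)"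
    by (rule disjoint_subfamily)
  then obtain \<H> where \<H>: "\<H> \<subseteq> \<F>" "pairwise disjnt \<H>" "\<forall>F\<in>\<F>. \<exists>G\<in>\<H>. F \<inter> G \<noteq> {} \<and> \<rho> F \<le> \<rho> G"
    by (elim exE conjE)
  have fin\<H>: "finite \<H>" using \<open>finite \<F>\<close> \<H>(1) by (rule finite_subset[rotated])
  define y where "y = (\<lambda>G::'a set. SOME z. z \<in> G)"
  have y: "y G \<in> G" if "G \<in> \<H>" for G
  proof -
    have "G \<noteq> {}" using that \<H>(1) by (auto simp: \<F>_def)
    then show ?thesis unfolding y_def by (meson ex_in_conv someI)
  qed
  \<comment> \<open>Factor 3: \<open>diameter G\<close>, \<open>diameter F\<close> and \<epsilon>
    are each at most \<open>\<rho> G\<close>, so the ball reaches every point within \<epsilon> of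
    F. Its diameter \<open>6 * \<rho> G\<close> produces \<open>6 powr \<sigma>\<close>.\<close>
  define \<G> where "\<G> = (\<lambda>G. ball (y G) (3 * \<rho> G)) ` \<H>"
  have bdd: "bounded F" if "F \<subseteq> X" for F using that X by (meson finite_imp_bounded finite_subset)
  have cover: "(\<Union>x\<in>X. ball x \<epsilon>) \<subseteq> \<Union>\<G>"
  proof
    fix z assume "z \<in> (\<Union>x\<in>X. ball x \<epsilon>)"
    then obtain x where x: "x \<in> X" "dist x z < \<epsilon>" by auto
    obtain F where F: "F \<subseteq> X" "x \<in> F" "sum w F = \<rho> F powr \<sigma>" using w(3) x(1) by blast
    then have "F \<in> \<F>" by (auto simp: \<F>_def)
    then obtain G where G: "G \<in> \<H>" "F \<inter> G \<noteq> {}" "\<rho> F \<le> \<rho> G" using \<H>(3) by blast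
    then obtain v where v: "v \<in> F" "v \<in> G" by blast
    have "G \<subseteq> X" using G(1) \<H>(1) by (auto simp: \<F>_def)
    have "dist (y G) v \<le> diameter G"
      by (rule diameter_bounded_bound[OF bdd[OF \<open>G \<subseteq> X\<close>] y[OF G(1)] v(2)])
    moreover have "dist v x \<le> diameter F"
      by (rule diameter_bounded_bound[OF bdd[OF F(1)] v(1) F(2)])
    moreover have "diameter G \<le> \<rho> G" "diameter F \<le> \<rho> F" "\<epsilon> \<le> \<rho> G" by (auto simp: \<rho>_def)
    moreover have "dist (y G) z \<le> dist (y G) v + dist v x + dist x z"
      using dist_triangle[of "y G" z x] dist_triangle[of "y G" x v] by linarith
    ultimately have "dist (y G) z < 3 * \<rho> G" using x(2) G(3) by linarith
    then have "z \<in> ball (y G) (3 * \<rho> G)" by simp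
    then show "z \<in> \<Union>\<G>" unfolding \<G>_def using G(1) by blast
  qed
  have "(\<Sum>U\<in>\<G>. diameter U powr \<sigma>) \<le> (\<Sum>G\<in>\<H>. diameter (ball (y G) (3 * \<rho> G)) powr \<sigma>)"
    unfolding \<G>_def by (rule order_trans[OF sum_image_le]) (use fin\<H> in auto)
  also have "\<dots> = (\<Sum>G\<in>\<H>. 6 powr \<sigma> * sum w G)"
  proof (intro sum.cong refl)
    fix G assume "G \<in> \<H>"
    then have "sum w G = \<rho> G powr \<sigma>" using \<H>(1) by (auto simp: \<F>_def)
    moreover have "\<rho> G > 0" using \<epsilon> by (simp add: \<rho>_def)
    ultimately show "diameter (ball (y G) (3 * \<rho> G)) powr \<sigma> = 6 powr \<sigma> * sum w G"
      by (simp add: powr_mult)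
  qed
  also have "\<dots> = 6 powr \<sigma> * (\<Sum>G\<in>\<H>. sum w G)" by (simp add: sum_distrib_left)
  also have "(\<Sum>G\<in>\<H>. sum w G) = sum w (\<Union>\<H>)"
  proof -
    have "\<forall>G\<in>\<H>. finite G" using \<H>(1) X by (auto simp: \<F>_def intro: finite_subset)
    moreover have "\<forall>G\<in>\<H>. \<forall>H\<in>\<H>. G \<noteq> H \<longrightarrow> G \<inter> H = {}" using \<H>(2) by (auto simp: pairwise_def disjnt_def)
    ultimately show ?thesis by (simp add: sum.Union_disjoint)
  qed
  also have "6 powr \<sigma> * sum w (\<Union>\<H>) \<le> 6 powr \<sigma> * sum w X"
    using X \<H>(1) w(1) by (intro mult_left_mono sum_mono2) (auto simp: \<F>_def)
  finally have content: "(\<Sum>U\<in>\<G>. diameter U powr \<sigma>) \<le> 6 powr \<sigma> * sum w X" .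
  show ?thesis
    by (rule that[OF _ growth _ cover _ content]) (use fin\<H> w(1) in \<open>auto simp: \<G>_def\<close>)
qed

section \<open>Counting in slices\<close>

lemma covering_number_le:
  assumes "finite F" "E \<subseteq> (\<Union>x\<in>F. ball x \<epsilon>)"
  shows "covering_number E \<epsilon> \<le> card F"
  unfolding covering_number_def by (rule Least_le) (use assms in blast)

text \<open>Gaussian version of counting net points s, each weighted by the M-mass of the b with |x
  - s - t b| of order \<epsilon>. Unlike the covering number it is visibly measurable in (x,
  t).\<close>

definition dilation_sum :: "'a::euclidean_space set \<Rightarrow> 'a measure \<Rightarrow> real \<Rightarrow> 'a \<Rightarrow> real \<Rightarrow> ennreal" where
  "dilation_sum S M \<epsilon> x t = (\<Sum>s\<in>S. \<integral>\<^sup>+b. ennreal (exp (- (norm (x - (s + t *\<^sub>R b)) / \<epsilon>)\<^sup>2 / 2)) \<partial>M)"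

lemma dilation_sum_measurable:
  fixes M :: "'a::euclidean_space measure"
  assumes M: "finite_measure M" "sets M = sets borel"
  shows "(\<lambda>(x, t). dilation_sum S M \<epsilon> x t) \<in> borel_measurable (borel \<Otimes>\<^sub>M borel)"
proof -
  interpret finite_measure M by (rule M)
  note [measurable_cong] = M(2)
  show ?thesis unfolding dilation_sum_def by measurable
qed

text \<open>The net S is \<epsilon>/4-dense, so points of an \<epsilon>-separated subset of the
  slice get different net points. If a = x - t b and s is the net point of a, every b' within
  \<epsilon> of b keeps |x - s - t b'| below \<epsilon>/4 + 2\<epsilon> <= 3\<epsilon>, so each of
  these net points contributes at least m exp(-9/2).\<close>

lemma covering_slice_le_dilation_sum:
  fixes A B :: "'a::euclidean_space set"
  assumes bdd: "bounded A" and S: "finite S" "S \<subseteq> A" "A \<subseteq> (\<Union>s\<in>S. ball s (\<epsilon> / 4))"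
    and M: "sets M = sets borel" and \<epsilon>: "0 < \<epsilon>" and m: "0 < m" "\<And>b. b \<in> B \<Longrightarrow> ennreal m \<le> emeasure M (ball b \<epsilon>)"
    and t: "t \<in> {1..2}"
  shows "of_nat (covering_number (slice A B x t) \<epsilon>) \<le> ennreal (exp (9/2) / m) * dilation_sum S M \<epsilon> x t"
proof -
  note [measurable_cong] = M
  let ?K = "\<lambda>s b. ennreal (exp (- (norm (x - (s + t *\<^sub>R b)) / \<epsilon>)\<^sup>2 / 2))"
  have "bounded (slice A B x t)" using bdd by (rule bounded_subset) (auto simp: slice_def)
  then obtain E where E: "finite E" "E \<subseteq> slice A B x t" "separated_by \<epsilon> E" "slice A B x t \<subseteq> (\<Union>a\<in>E. ball a \<epsilon>)"
    by (rule maximal_separated[OF _ \<epsilon>])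
  have "\<forall>a\<in>E. \<exists>s\<in>S. dist s a < \<epsilon> / 4"
  proof
    fix a assume "a \<in> E"
    then have "a \<in> A" using E(2) by (auto simp: slice_def)
    then have "a \<in> (\<Union>s\<in>S. ball s (\<epsilon> / 4))" using S(3) by blast
    then show "\<exists>s\<in>S. dist s a < \<epsilon> / 4" by simp
  qed
  then obtain g where g: "\<forall>a\<in>E. g a \<in> S \<and> dist (g a) a < \<epsilon> / 4" by metis
  have inj: "inj_on g E"
  proof (rule inj_onI, rule ccontr)
    fix a a' assume *: "a \<in> E" "a' \<in> E" "g a = g a'" "a \<noteq> a'"
    have "dist a a' \<le> dist (g a) a + dist (g a') a'"
      using dist_triangle3[of a a' "g a"] *(3) by simp
    also have "\<dots> < \<epsilon>"
    proof -
      have "dist (g a) a < \<epsilon> / 4" "dist (g a') a' < \<epsilon> / 4" using g *(1,2) by auto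
      then show ?thesis using \<epsilon> by linarith
    qed
    finally have "dist a a' < \<epsilon>" .
    moreover have "\<epsilon> \<le> dist a a'" using E(3) *(1,2,4) unfolding separated_by_def by blast
    ultimately show False by linarith
  qed
  have low: "ennreal (exp (- 9 / 2) * m) \<le> (\<integral>\<^sup>+b. ?K (g a) b \<partial>M)" if a: "a \<in> E" for a
  proof -
    obtain b where b: "b \<in> B" "a = x - t *\<^sub>R b" using a E(2) by (auto simp: slice_def)
    have pt: "ennreal (exp (- 9 / 2)) * indicator (ball b \<epsilon>) b' \<le> ?K (g a) b'" for b'
    proof (cases "b' \<in> ball b \<epsilon>")
      case True
      have "x - (g a + t *\<^sub>R b') = (a - g a) + t *\<^sub>R (b - b')" using b(2) by (simp add: algebra_simps)
      then have "norm (x - (g a + t *\<^sub>R b')) \<le> norm (a - g a) + norm (t *\<^sub>R (b - b'))"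
        using norm_triangle_ineq by metis
      also have "\<dots> \<le> \<epsilon> / 4 + 2 * \<epsilon>"
      proof (intro add_mono)
        show "norm (a - g a) \<le> \<epsilon> / 4" using g a by (simp add: dist_norm norm_minus_commute less_imp_le)
        have "\<bar>t\<bar> * norm (b - b') \<le> 2 * \<epsilon>" using True t by (intro mult_mono) (auto simp: dist_norm)
        then show "norm (t *\<^sub>R (b - b')) \<le> 2 * \<epsilon>" by simp
      qed
      also have "\<dots> \<le> 3 * \<epsilon>" using \<epsilon> by simp
      finally have "norm (x - (g a + t *\<^sub>R b')) / \<epsilon> \<le> 3" using \<epsilon> by (simp add: divide_le_eq)
      then have "(norm (x - (g a + t *\<^sub>R b')) / \<epsilon>)\<^sup>2 \<le> 3\<^sup>2" using \<epsilon> by (intro power_mono) auto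
      then show ?thesis using True by (simp add: ennreal_leI)
    qed simp
    have "ennreal (exp (- 9 / 2) * m) = ennreal (exp (- 9 / 2)) * ennreal m"
      using m by (simp add: ennreal_mult)
    also have "\<dots> \<le> ennreal (exp (- 9 / 2)) * emeasure M (ball b \<epsilon>)"
      by (intro mult_left_mono m b) simp
    also have "\<dots> = (\<integral>\<^sup>+b'. ennreal (exp (- 9 / 2)) * indicator (ball b \<epsilon>) b' \<partial>M)"
      by (subst nn_integral_cmult_indicator) (auto simp: M)
    also have "\<dots> \<le> (\<integral>\<^sup>+b. ?K (g a) b \<partial>M)" by (intro nn_integral_mono pt)
    finally show ?thesis .
  qed
  have "ennreal (real (card E) * (exp (- 9 / 2) * m)) = (\<Sum>a\<in>E. ennreal (exp (- 9 / 2) * m))"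
    using m by (simp add: ennreal_mult ennreal_of_nat_eq_real_of_nat)
  also have "\<dots> \<le> (\<Sum>a\<in>E. \<integral>\<^sup>+b. ?K (g a) b \<partial>M)" by (intro sum_mono low)
  also have "\<dots> = (\<Sum>s\<in>g ` E. \<integral>\<^sup>+b. ?K s b \<partial>M)" by (simp add: sum.reindex[OF inj])
  also have "\<dots> \<le> dilation_sum S M \<epsilon> x t"
    unfolding dilation_sum_def using g S(1) by (intro sum_mono2) auto
  finally have main: "ennreal (real (card E) * (exp (- 9 / 2) * m)) \<le> dilation_sum S M \<epsilon> x t" .
  have "of_nat (covering_number (slice A B x t) \<epsilon>) \<le> ennreal (real (card E))"
    using covering_number_le[OF E(1,4)] by (simp add: ennreal_of_nat_eq_real_of_nat)
  also have "\<dots> = ennreal (exp (9/2) / m) * ennreal (real (card E) * (exp (- 9 / 2) * m))"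
    using m by (subst ennreal_mult[symmetric]) (auto simp: exp_minus field_simps)
  also have "\<dots> \<le> ennreal (exp (9/2) / m) * dilation_sum S M \<epsilon> x t"
    by (intro mult_left_mono main) simp
  finally show ?thesis .
qed

text \<open>The energy is bounded by growth constant times total mass, and both are of order
  \<epsilon>^(-s); the mass is the growth bound on the one ball of radius R that contains S.\<close>

lemma gauss_energy_separated:
  fixes S :: "'a::euclidean_space set"
  assumes S: "finite S" and K: "0 \<le> K" and s: "0 \<le> s" and \<epsilon>: "0 < \<epsilon>" "\<epsilon> \<le> R" and R: "S \<subseteq> ball 0 R"
    and growth: "\<And>x r. \<epsilon> \<le> r \<Longrightarrow> real (card (S \<inter> ball x r)) \<le> K * (r / \<epsilon>) powr s" and \<rho>: "\<epsilon> \<le> \<rho>"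
  shows "gauss_energy (point_masses S (\<lambda>_. 1)) (point_masses S (\<lambda>_. 1)) \<rho>
     \<le> ennreal ((K\<^sup>2 * layer_const s * R powr s / \<epsilon> powr (2 * s)) * \<rho> powr s)"
proof -
  let ?\<nu> = "point_masses S (\<lambda>_. 1)"
  have \<nu>: "emeasure ?\<nu> B = ennreal (real (card (S \<inter> B)))" if "B \<in> sets borel" for B
    using emeasure_point_masses[OF S that, of "\<lambda>_. 1"] by simp
  have g: "emeasure ?\<nu> (ball x r) \<le> ennreal ((K / \<epsilon> powr s) * r powr s)" if "\<rho> \<le> r" for x r
    using growth[of r x] that \<rho> \<epsilon> by (simp add: \<nu> powr_divide ennreal_leI)
  have lc: "0 < layer_const s" using s by (rule layer_const_pos)
  have "gauss_energy ?\<nu> ?\<nu> \<rho> \<le> ennreal ((K / \<epsilon> powr s) * layer_const s * \<rho> powr s) * emeasure ?\<nu> UNIV"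
    by (rule gauss_energy_le_growth[OF sets_point_masses s]) (use \<epsilon> \<rho> K g in auto)
  also have "emeasure ?\<nu> UNIV \<le> ennreal (K * (R / \<epsilon>) powr s)"
    using growth[of R 0] \<epsilon> R by (simp add: \<nu> Int_absorb2 ennreal_leI)
  also have "ennreal ((K / \<epsilon> powr s) * layer_const s * \<rho> powr s) * ennreal (K * (R / \<epsilon>) powr s)
     = ennreal ((K / \<epsilon> powr s) * layer_const s * \<rho> powr s * (K * (R / \<epsilon>) powr s))"
    using K lc by (subst ennreal_mult[symmetric]) auto
  also have "(K / \<epsilon> powr s) * layer_const s * \<rho> powr s * (K * (R / \<epsilon>) powr s)
     = (K\<^sup>2 * layer_const s * R powr s / \<epsilon> powr (2 * s)) * \<rho> powr s"
  proof -
    have "\<epsilon> powr (2 * s) = \<epsilon> powr s * \<epsilon> powr s" by (simp only: mult_2 powr_add)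
    then show ?thesis by (simp add: powr_divide power2_eq_square)
  qed
  finally show ?thesis by (simp add: mult_left_mono)
qed

text \<open>Energies are required only at scales from \<epsilon> to 2, so \<mu> may be discrete at
  scale \<epsilon>. The dependence on \<mu> is confined to L and enters as a square root, its share
  in the Cauchy-Schwarz inequality.\<close>

definition gauss_estimate :: "real \<Rightarrow> real \<Rightarrow> real \<Rightarrow> ('a::euclidean_space \<Rightarrow> real \<Rightarrow> ennreal) \<Rightarrow> real \<Rightarrow> bool" where
  "gauss_estimate \<alpha> \<tau> C f \<epsilon> \<longleftrightarrow> (\<forall>\<mu> L. finite_measure \<mu> \<longrightarrow> sets \<mu> = sets borel \<longrightarrow> 0 \<le> L \<longrightarrow>
     (\<forall>\<rho>. \<epsilon> \<le> \<rho> \<longrightarrow> \<rho> \<le> 2 \<longrightarrow> gauss_energy \<mu> \<mu> \<rho> \<le> ennreal (L * \<rho> powr \<alpha>)) \<longrightarrow>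
     (\<integral>\<^sup>+x. (\<integral>\<^sup>+t\<in>{1..2}. f x t \<partial>lborel) \<partial>\<mu>) \<le> ennreal (C * sqrt L * (1 / \<epsilon>) powr \<tau>))"

text \<open>The majorant D is built once, independently of \<sigma>, and satisfies the estimate for
  every admissible exponent. It is used with \<sigma> = max \<alpha> 0 for the given measure and
  with every \<sigma> above the claimed dimension for the exceptional set.\<close>

lemma slice_counting:
  fixes A B :: "'a::euclidean_space set"
  assumes A: "compact A" and AD: "ahlfors_david_bounds s\<^sub>A A (\<lambda>S. hausdorff_measure s\<^sub>A (A \<inter> S))" and sA: "0 \<le> s\<^sub>A"
    and M: "finite_measure M" "sets M = sets borel" and ADM: "ahlfors_david_bounds s\<^sub>B B (emeasure M)"
    and diam: "0 < diameter B" and hyp: "hyperplane_size_bound p M" and p: "0 < p"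
  obtains D :: "'a \<Rightarrow> real \<Rightarrow> real \<Rightarrow> ennreal" where
    "\<forall>\<epsilon>. (\<lambda>(x, t). D x t \<epsilon>) \<in> borel_measurable (borel \<Otimes>\<^sub>M borel)"
    "\<forall>x t \<epsilon>. t \<in> {1..2} \<longrightarrow> 0 < \<epsilon> \<longrightarrow> \<epsilon> \<le> 1 \<longrightarrow> of_nat (covering_number (slice A B x t) \<epsilon>) \<le> D x t \<epsilon>"
    "\<forall>\<sigma>. real DIM('a) < p + (\<sigma> + s\<^sub>A) / 2 \<longrightarrow> (\<exists>C>0. \<forall>\<epsilon>. 0 < \<epsilon> \<longrightarrow> \<epsilon> \<le> 1 \<longrightarrow>
       gauss_estimate \<sigma> (s\<^sub>A + s\<^sub>B - real DIM('a)) C (\<lambda>x t. D x t \<epsilon>) \<epsilon>)"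
proof -
  interpret M: finite_measure M by (rule M)
  note [measurable_cong] = M(2)
  have bddA: "bounded A" using A by (rule compact_imp_bounded)
  obtain R where R: "1 \<le> R" "A \<subseteq> ball 0 R"
  proof -
    obtain R where "A \<subseteq> ball 0 R" using bounded_subset_ballD[OF bddA] by blast
    then show ?thesis by (intro that[of "max 1 R"]) force+
  qed
  have "\<exists>S. finite S \<and> S \<subseteq> A \<and> separated_by (\<epsilon> / 4) S \<and> A \<subseteq> (\<Union>s\<in>S. ball s (\<epsilon> / 4))" if "0 < \<epsilon>" for \<epsilon>
  proof -
    have "0 < \<epsilon> / 4" using that by simp
    then obtain S where "finite S" "S \<subseteq> A" "separated_by (\<epsilon> / 4) S" "A \<subseteq> (\<Union>s\<in>S. ball s (\<epsilon> / 4))"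
      by (rule maximal_separated[OF bddA])
    then show ?thesis by (intro exI conjI)
  qed
  then obtain S where S: "\<And>\<epsilon>. 0 < \<epsilon> \<Longrightarrow> finite (S \<epsilon>) \<and> S \<epsilon> \<subseteq> A \<and> separated_by (\<epsilon> / 4) (S \<epsilon>) \<and> A \<subseteq> (\<Union>s\<in>S \<epsilon>. ball s (\<epsilon> / 4))"
    by metis
  obtain K where K: "K > 0"
    "\<And>S x r \<epsilon>. finite S \<Longrightarrow> S \<subseteq> A \<Longrightarrow> separated_by \<epsilon> S \<Longrightarrow> 0 < \<epsilon> \<Longrightarrow> \<epsilon> \<le> r \<Longrightarrow>
       real (card (S \<inter> ball x r)) \<le> K * (r / \<epsilon>) powr s\<^sub>A"
    using ahlfors_david_separated_card[OF A AD sA] by metis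
  obtain C0 where C0: "C0 > 0"
    "\<And>x \<delta>. x \<in> B \<Longrightarrow> 0 < \<delta> \<Longrightarrow> \<delta> < diameter B \<Longrightarrow> ennreal (inverse C0 * \<delta> powr s\<^sub>B) \<le> emeasure M (ball x \<delta>)"
    using ADM unfolding ahlfors_david_bounds_def by blast
  \<comment> \<open>Lower regularity is known only for radii below the diameter; scaling by q brings
    every \<epsilon> <= 1 into that range at the cost of the factor \<open>q powr s\<^sub>B\<close>
    in \<open>m\<close>.\<close>
  define q where "q = min 1 (diameter B / 2)"
  have q: "0 < q" "q \<le> 1" "q \<le> diameter B / 2" using diam by (auto simp: q_def)
  define m where "m = inverse C0 * q powr s\<^sub>B"
  have m: "0 < m" using C0 q by (simp add: m_def)
  have low: "ennreal (m * \<epsilon> powr s\<^sub>B) \<le> emeasure M (ball b \<epsilon>)" if "b \<in> B" "0 < \<epsilon>" "\<epsilon> \<le> 1" for b \<epsilon>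
  proof -
    have "q * \<epsilon> \<le> \<epsilon>" "q * \<epsilon> \<le> q" using q that by (auto simp: mult_le_cancel_right1 mult_le_cancel_left1)
    then have "ennreal (inverse C0 * (q * \<epsilon>) powr s\<^sub>B) \<le> emeasure M (ball b (q * \<epsilon>))"
      using that q diam \<open>q * \<epsilon> \<le> q\<close> by (intro C0(2)) (simp, simp, linarith)
    also have "\<dots> \<le> emeasure M (ball b \<epsilon>)"
      using \<open>q * \<epsilon> \<le> \<epsilon>\<close> by (intro emeasure_mono) (auto simp: M)
    also have "inverse C0 * (q * \<epsilon>) powr s\<^sub>B = m * \<epsilon> powr s\<^sub>B" by (simp add: m_def powr_mult)
    finally show ?thesis .
  qed
  define c where "c = (\<lambda>\<epsilon>. exp (9/2) / (m * \<epsilon> powr s\<^sub>B))"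
  define D where "D = (\<lambda>x t \<epsilon>. ennreal (c \<epsilon>) * dilation_sum (S \<epsilon>) M \<epsilon> x t)"
  have [measurable]: "(\<lambda>(x, t). dilation_sum (S \<epsilon>) M \<epsilon> x t) \<in> borel_measurable (borel \<Otimes>\<^sub>M borel)" for \<epsilon>
    by (rule dilation_sum_measurable[OF M])
  have 1: "\<forall>\<epsilon>. (\<lambda>(x, t). D x t \<epsilon>) \<in> borel_measurable (borel \<Otimes>\<^sub>M borel)"
    unfolding D_def by measurable
  have 2: "\<forall>x t \<epsilon>. t \<in> {1..2} \<longrightarrow> 0 < \<epsilon> \<longrightarrow> \<epsilon> \<le> 1 \<longrightarrow> of_nat (covering_number (slice A B x t) \<epsilon>) \<le> D x t \<epsilon>"
  proof (intro allI impI)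
    fix x :: 'a and t \<epsilon> :: real assume *: "t \<in> {1..2}" "0 < \<epsilon>" "\<epsilon> \<le> 1"
    then show "of_nat (covering_number (slice A B x t) \<epsilon>) \<le> D x t \<epsilon>"
      unfolding D_def c_def using S[OF *(2)] m
      by (intro covering_slice_le_dilation_sum[OF bddA _ _ _ M(2)] low) auto
  qed
  have 3: "\<exists>C>0. \<forall>\<epsilon>. 0 < \<epsilon> \<longrightarrow> \<epsilon> \<le> 1 \<longrightarrow>
       gauss_estimate \<sigma> (s\<^sub>A + s\<^sub>B - real DIM('a)) C (\<lambda>x t. D x t \<epsilon>) \<epsilon>"
    if \<sigma>: "real DIM('a) < p + (\<sigma> + s\<^sub>A) / 2" for \<sigma>
  proof -
    obtain C1 where C1: "C1 > 0"
      "\<And>\<mu> \<nu> \<epsilon> L L' \<alpha> s. finite_measure \<mu> \<Longrightarrow> sets \<mu> = sets borel \<Longrightarrow> finite_measure \<nu> \<Longrightarrow> sets \<nu> = sets borel \<Longrightarrow>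
       0 < \<epsilon> \<Longrightarrow> \<epsilon> \<le> 1 \<Longrightarrow> 0 \<le> L \<Longrightarrow> 0 \<le> L' \<Longrightarrow> (\<alpha> + s) / 2 = (\<sigma> + s\<^sub>A) / 2 \<Longrightarrow>
       (\<And>\<rho>. \<epsilon> \<le> \<rho> \<Longrightarrow> \<rho> \<le> 2 \<Longrightarrow> gauss_energy \<mu> \<mu> \<rho> \<le> ennreal (L * \<rho> powr \<alpha>)) \<Longrightarrow>
       (\<And>\<rho>. \<epsilon> \<le> \<rho> \<Longrightarrow> \<rho> \<le> 2 \<Longrightarrow> gauss_energy \<nu> \<nu> \<rho> \<le> ennreal (L' * \<rho> powr s)) \<Longrightarrow>
       gauss_energy \<mu> (dilation_law \<nu> M) \<epsilon> \<le> ennreal (C1 * \<epsilon> ^ DIM('a) * sqrt (L * L'))"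
      using gauss_energy_dilation_bound[OF M hyp p \<sigma>] by metis
    \<comment> \<open>The net is \<epsilon>/4-separated, whence the power of 4.\<close>
    define Z where "Z = K\<^sup>2 * layer_const s\<^sub>A * R powr s\<^sub>A * 4 powr (2 * s\<^sub>A)"
    have Z: "Z > 0" using K R layer_const_pos[OF sA] by (simp add: Z_def)
    define C where "C = exp (9/2) / m * (sqrt (2 * pi) * exp 2) * C1 * sqrt Z"
    have C: "C > 0" using m C1 Z by (simp add: C_def)
    have "(\<integral>\<^sup>+x. (\<integral>\<^sup>+t\<in>{1..2}. D x t \<epsilon> \<partial>lborel) \<partial>\<mu>) \<le> ennreal (C * sqrt L * (1 / \<epsilon>) powr (s\<^sub>A + s\<^sub>B - real DIM('a)))"
      if \<mu>: "finite_measure \<mu>" "sets \<mu> = sets borel" and \<epsilon>: "0 < \<epsilon>" "\<epsilon> \<le> 1" and L: "0 \<le> L"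
        and G: "\<forall>\<rho>. \<epsilon> \<le> \<rho> \<longrightarrow> \<rho> \<le> 2 \<longrightarrow> gauss_energy \<mu> \<mu> \<rho> \<le> ennreal (L * \<rho> powr \<sigma>)" for \<mu> :: "'a measure" and \<epsilon> L
    proof -
      interpret mu: finite_measure \<mu> by (rule \<mu>)
      note [measurable_cong] = \<mu>(2)
      let ?\<nu> = "point_masses (S \<epsilon>) (\<lambda>_. 1)"
      have fS: "finite (S \<epsilon>)" using S[OF \<epsilon>(1)] by simp
      have \<nu>: "finite_measure ?\<nu>" "sets ?\<nu> = sets borel"
        by (auto intro: finite_point_masses fS simp: sets_point_masses)
      have D_eq: "dilation_sum (S \<epsilon>) M \<epsilon> x t = (\<integral>\<^sup>+a. (\<integral>\<^sup>+b. ennreal (exp (- (norm (x - (a + t *\<^sub>R b)) / \<epsilon>)\<^sup>2 / 2)) \<partial>M) \<partial>?\<nu>)" for x t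
        unfolding dilation_sum_def by (subst nn_integral_point_masses[OF fS]) auto
      have energy_nu: "gauss_energy ?\<nu> ?\<nu> \<rho> \<le> ennreal ((Z / \<epsilon> powr (2 * s\<^sub>A)) * \<rho> powr s\<^sub>A)" if "\<epsilon> \<le> \<rho>" for \<rho>
      proof -
        have "gauss_energy ?\<nu> ?\<nu> \<rho>
           \<le> ennreal ((K\<^sup>2 * layer_const s\<^sub>A * R powr s\<^sub>A / (\<epsilon> / 4) powr (2 * s\<^sub>A)) * \<rho> powr s\<^sub>A)"
        proof (rule gauss_energy_separated[OF fS _ sA])
          show "real (card (S \<epsilon> \<inter> ball x r)) \<le> K * (r / (\<epsilon> / 4)) powr s\<^sub>A" if "\<epsilon> / 4 \<le> r" for x r
            using S[OF \<epsilon>(1)] \<epsilon> that by (intro K(2)) auto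
        qed (use K \<epsilon> R S[OF \<epsilon>(1)] that in auto)
        also have "K\<^sup>2 * layer_const s\<^sub>A * R powr s\<^sub>A / (\<epsilon> / 4) powr (2 * s\<^sub>A) = Z / \<epsilon> powr (2 * s\<^sub>A)"
          by (simp add: Z_def powr_divide)
        finally show ?thesis .
      qed
      have "(\<integral>\<^sup>+x. (\<integral>\<^sup>+t\<in>{1..2}. D x t \<epsilon> \<partial>lborel) \<partial>\<mu>)
         = (\<integral>\<^sup>+x. (\<integral>\<^sup>+t. ennreal (c \<epsilon>) * (dilation_sum (S \<epsilon>) M \<epsilon> x t * indicator {1..2} t) \<partial>lborel) \<partial>\<mu>)"
        by (simp add: D_def mult.assoc)
      also have "\<dots> = ennreal (c \<epsilon>) * (\<integral>\<^sup>+x. (\<integral>\<^sup>+t\<in>{1..2}. dilation_sum (S \<epsilon>) M \<epsilon> x t \<partial>lborel) \<partial>\<mu>)"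
        by (simp add: nn_integral_cmult)
      also have "\<dots> \<le> ennreal (c \<epsilon>) * (ennreal (sqrt (2 * pi) * exp 2) * gauss_energy \<mu> (dilation_law ?\<nu> M) \<epsilon>)"
        unfolding D_eq by (intro mult_left_mono average_dilations_le_gauss_energy \<mu> \<nu> M) simp
      also have "\<dots> \<le> ennreal (c \<epsilon>) * (ennreal (sqrt (2 * pi) * exp 2) * ennreal (C1 * \<epsilon> ^ DIM('a) * sqrt (L * (Z / \<epsilon> powr (2 * s\<^sub>A)))))"
        using G energy_nu L Z by (intro mult_left_mono C1(2)[OF \<mu> \<nu> \<epsilon> L _ refl]) auto
      also have "\<dots> = ennreal (c \<epsilon> * ((sqrt (2 * pi) * exp 2) * (C1 * \<epsilon> ^ DIM('a) * sqrt (L * (Z / \<epsilon> powr (2 * s\<^sub>A))))))"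
        using m C1 L Z \<epsilon> by (simp add: ennreal_mult[symmetric] c_def)
      also have "sqrt (L * (Z / \<epsilon> powr (2 * s\<^sub>A))) = sqrt L * sqrt Z / \<epsilon> powr s\<^sub>A"
      proof -
        have "\<epsilon> powr (2 * s\<^sub>A) = (\<epsilon> powr s\<^sub>A)\<^sup>2" by (simp only: mult_2 powr_add power2_eq_square)
        then show ?thesis by (simp add: real_sqrt_mult real_sqrt_divide)
      qed
      also have "c \<epsilon> * ((sqrt (2 * pi) * exp 2) * (C1 * \<epsilon> ^ DIM('a) * (sqrt L * sqrt Z / \<epsilon> powr s\<^sub>A)))
         = C * sqrt L * (\<epsilon> ^ DIM('a) / (\<epsilon> powr s\<^sub>A * \<epsilon> powr s\<^sub>B))"
        by (simp add: c_def C_def mult_ac)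
      \<comment> \<open>Total power of \<epsilon>: d from the Gaussian normalisation, -s_A from the
        square root of the net energy, -s_B from the mass of \<epsilon>-balls in B.\<close>
      also have "\<epsilon> ^ DIM('a) / (\<epsilon> powr s\<^sub>A * \<epsilon> powr s\<^sub>B) = (1 / \<epsilon>) powr (s\<^sub>A + s\<^sub>B - real DIM('a))"
        using \<epsilon> by (simp add: powr_divide powr_diff powr_add powr_realpow)
      finally show ?thesis .
    qed
    then show ?thesis using C unfolding gauss_estimate_def by (intro exI[of _ C]) simp
  qed
  show ?thesis by (rule that[OF 1 2]) (use 3 in simp)
qed

section \<open>Exceptional sets\<close>

lemma Liminf_le_frequently:
  fixes f :: "'a \<Rightarrow> 'b::complete_linorder"
  assumes "\<exists>\<^sub>F x in F. f x \<le> c"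
  shows "Liminf F f \<le> c"
  unfolding Liminf_def
proof (rule SUP_least, clarify)
  fix P assume "eventually P F"
  then have "\<exists>\<^sub>F x in F. f x \<le> c \<and> P x"    by (intro frequently_rev_mp[OF assms]) (simp add: eventually_mono)
  then obtain x where "P x" "f x \<le> c" by (auto dest: frequently_ex)
  then show "(INF x\<in>Collect P. f x) \<le> c" by (intro INF_lower2[of x]) auto
qed

text \<open>A liminf is bounded above as soon as the bound holds along some sequence of scales
  tending to 0, so infinitely many dyadic scales suffice.\<close>

lemma lower_minkowski_dim_le:
  assumes \<tau>: "0 \<le> \<tau>"
    and freq: "\<forall>n::nat. \<exists>\<^sub>F k in sequentially. real (covering_number E ((1/2) ^ k)) \<le> (2 ^ k) powr (\<tau> + 1 / (real n + 1))"
  shows "lower_minkowski_dim E \<le> ereal \<tau>"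
proof (cases "E = {}")
  case True
  then show ?thesis using \<tau> by (simp add: lower_minkowski_dim_def zero_ereal_def)
next
  case False
  let ?f = "\<lambda>\<epsilon>. ereal (ln (real (covering_number E \<epsilon>)) / ln (1 / \<epsilon>))"
  have lim: "filterlim (\<lambda>k::nat. (1/2 :: real) ^ k) (at_right 0) sequentially"
    unfolding filterlim_at_right_to_0[symmetric] filterlim_at by (auto intro!: LIMSEQ_power_zero)
  have "Liminf (at_right 0) ?f \<le> ereal \<tau> + ereal e" if e: "0 < e" for e
  proof -
    obtain n where n: "inverse (real (Suc n)) < e" using reals_Archimedean[OF e] by blast
    have "\<exists>\<^sub>F k in sequentially. ?f ((1/2) ^ k) \<le> ereal \<tau> + ereal e"
    proof (rule frequently_rev_mp[OF spec[OF freq, of n]])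
      show "\<forall>\<^sub>F k in sequentially. real (covering_number E ((1/2) ^ k)) \<le> (2 ^ k) powr (\<tau> + 1 / (real n + 1))
         \<longrightarrow> ?f ((1/2) ^ k) \<le> ereal \<tau> + ereal e"
        using eventually_gt_at_top[of "0::nat"]
      proof eventually_elim
        case (elim k)
        show ?case
        proof
          assume *: "real (covering_number E ((1/2) ^ k)) \<le> (2 ^ k) powr (\<tau> + 1 / (real n + 1))"
          have l2: "ln (1 / (1/2 :: real) ^ k) = real k * ln 2" by (simp add: power_one_over ln_realpow)
          have pos: "0 < real k * ln 2" using elim by simp
          have "ln (real (covering_number E ((1/2) ^ k))) \<le> (\<tau> + 1 / (real n + 1)) * (real k * ln 2)"
          \<comment> \<open>\<open>ln 0\<close> is 0, and the right-hand side is nonnegative because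
            \<tau> >= 0.\<close>
          proof (cases "covering_number E ((1/2) ^ k) = 0")
            case True
            then show ?thesis using \<tau> pos by (simp add: mult_nonneg_nonneg)
          next
            case False
            then have "ln (real (covering_number E ((1/2) ^ k))) \<le> ln ((2 ^ k) powr (\<tau> + 1 / (real n + 1)))"
              using * by (subst ln_le_cancel_iff) auto
            then show ?thesis by (simp add: ln_powr ln_realpow)
          qed
          then have "ln (real (covering_number E ((1/2) ^ k))) / (real k * ln 2) \<le> \<tau> + 1 / (real n + 1)"
            using pos by (simp add: pos_divide_le_eq)
          also have "\<dots> \<le> \<tau> + e" using n by (simp add: inverse_eq_divide add.commute)
          finally show "?f ((1/2) ^ k) \<le> ereal \<tau> + ereal e" unfolding l2 by simp
        qed
      qed
    qed
    then have "\<exists>\<^sub>F \<epsilon> in at_right 0. ?f \<epsilon> \<le> ereal \<tau> + ereal e"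
      unfolding frequently_def using eventually_compose_filterlim[OF _ lim] by blast
    then show ?thesis by (rule Liminf_le_frequently)
  qed
  then show ?thesis using False by (simp add: lower_minkowski_dim_def ereal_le_epsilon2)
qed

text \<open>Fatou for the rescaled functions \<open>g\<close>. The integral bound is assumed for
  infinitely many k rather than for all: the contrapositive then yields large integrals at every
  large k, which is how points of the exceptional set are detected.\<close>

lemma AE_frequently_le:
  fixes D :: "nat \<Rightarrow> 'a \<Rightarrow> ennreal"
  assumes [measurable]: "\<And>k. D k \<in> borel_measurable N"
    and int: "\<forall>n::nat. \<exists>\<^sub>F k in sequentially. (\<integral>\<^sup>+z. D k z \<partial>N) \<le> ennreal (C * (2 ^ k) powr (\<tau> + 1 / (real n + 1)))"
  shows "AE z in N. \<forall>n::nat. \<exists>\<^sub>F k in sequentially. D k z \<le> ennreal ((2 ^ k) powr (\<tau> + 1 / (real n + 1)))"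
  unfolding AE_all_countable
proof
  fix n :: nat
  define \<eta> where "\<eta> = 1 / (real n + 1)"
  \<comment> \<open>The index whose slack is \<eta>/2; after rescaling this leaves the factor 2^(-k
    \<eta>/2).\<close>
  define m where "m = 2 * n + 1"
  have m: "1 / (real m + 1) = \<eta> / 2" "\<eta> > 0" by (auto simp: m_def \<eta>_def field_simps)
  define g where "g = (\<lambda>k z. ennreal ((2 ^ k) powr - (\<tau> + \<eta>)) * D k z)"
  have [measurable]: "g k \<in> borel_measurable N" for k unfolding g_def by measurable
  have "liminf (\<lambda>k. \<integral>\<^sup>+z. g k z \<partial>N) \<le> 0 + ennreal e" if e: "0 < e" for e
  proof (rule Liminf_le_frequently)
    have "(\<lambda>k. \<bar>C\<bar> * (2 ^ k) powr (- (\<eta> / 2)) :: real) \<longlonglongrightarrow> 0"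
    proof -
      have "(2 ^ k) powr a = (2 powr a) ^ k" for k and a :: real
        by (induction k) (simp_all add: powr_mult)
      moreover have "2 powr - (\<eta> / 2) < 2 powr 0" using m by (intro powr_less_mono) auto
      ultimately show ?thesis by (auto intro!: tendsto_mult_right_zero LIMSEQ_power_zero)
    qed
    then have ev: "\<forall>\<^sub>F k in sequentially. \<bar>C\<bar> * (2 ^ k) powr (- (\<eta> / 2)) < e"
      using e by (rule order_tendstoD(2))
    show "\<exists>\<^sub>F k in sequentially. (\<integral>\<^sup>+z. g k z \<partial>N) \<le> 0 + ennreal e"
    proof (rule frequently_rev_mp[OF spec[OF int, of m]])
      show "\<forall>\<^sub>F k in sequentially. (\<integral>\<^sup>+z. D k z \<partial>N) \<le> ennreal (C * (2 ^ k) powr (\<tau> + 1 / (real m + 1)))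
         \<longrightarrow> (\<integral>\<^sup>+z. g k z \<partial>N) \<le> 0 + ennreal e"
        using ev
      proof eventually_elim
        case (elim k)
        show ?case
        proof
          assume *: "(\<integral>\<^sup>+z. D k z \<partial>N) \<le> ennreal (C * (2 ^ k) powr (\<tau> + 1 / (real m + 1)))"
          have "(\<integral>\<^sup>+z. g k z \<partial>N) = ennreal ((2 ^ k) powr - (\<tau> + \<eta>)) * (\<integral>\<^sup>+z. D k z \<partial>N)"
            unfolding g_def by (rule nn_integral_cmult) measurable
          also have "\<dots> \<le> ennreal ((2 ^ k) powr - (\<tau> + \<eta>)) * ennreal (C * (2 ^ k) powr (\<tau> + \<eta> / 2))"
            using * unfolding m(1) by (intro mult_left_mono) auto
          also have "\<dots> = ennreal ((2 ^ k) powr - (\<tau> + \<eta>) * (C * (2 ^ k) powr (\<tau> + \<eta> / 2)))"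
            by (simp add: ennreal_mult')
          also have "(2 ^ k) powr - (\<tau> + \<eta>) * (C * (2 ^ k) powr (\<tau> + \<eta> / 2)) = C * (2 ^ k) powr (- (\<eta> / 2))"
          proof -
            have "(2 ^ k) powr - (\<tau> + \<eta>) * (2 ^ k) powr (\<tau> + \<eta> / 2) = (2 ^ k :: real) powr (- (\<eta> / 2))"
              unfolding powr_add[symmetric] by (simp add: field_simps)
            then show ?thesis by (simp add: mult.left_commute)
          qed
          also have "ennreal \<dots> \<le> ennreal e"
            using elim mult_right_mono[OF abs_ge_self[of C] powr_ge_zero[of "2 ^ k" "- (\<eta> / 2)"]]
            by (intro ennreal_leI) linarith
          finally show "(\<integral>\<^sup>+z. g k z \<partial>N) \<le> 0 + ennreal e" by simp
        qed
      qed
    qed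
  qed
  then have "liminf (\<lambda>k. \<integral>\<^sup>+z. g k z \<partial>N) \<le> 0"
    by (rule_tac ennreal_le_epsilon) simp
  moreover have "(\<integral>\<^sup>+z. liminf (\<lambda>k. g k z) \<partial>N) \<le> liminf (\<lambda>k. \<integral>\<^sup>+z. g k z \<partial>N)"
    by (rule nn_integral_liminf) measurable
  ultimately have "(\<integral>\<^sup>+z. liminf (\<lambda>k. g k z) \<partial>N) = 0" by simp
  then have "AE z in N. liminf (\<lambda>k. g k z) = 0" by (subst (asm) nn_integral_0_iff_AE) auto
  then show "AE z in N. \<exists>\<^sub>F k in sequentially. D k z \<le> ennreal ((2 ^ k) powr (\<tau> + 1 / (real n + 1)))"
  proof eventually_elim
    case (elim z)
    show ?case
    proof (rule ccontr)
      assume "\<not> ?thesis"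
      then have "\<forall>\<^sub>F k in sequentially. \<not> D k z \<le> ennreal ((2 ^ k) powr (\<tau> + \<eta>))"
        by (simp add: frequently_def \<eta>_def)
      then have "\<forall>\<^sub>F k in sequentially. 1 \<le> g k z"
      proof eventually_elim
        case (elim k)
        have "1 = ennreal ((2 ^ k) powr - (\<tau> + \<eta>)) * ennreal ((2 ^ k) powr (\<tau> + \<eta>))"
          by (subst ennreal_mult[symmetric]) (simp_all add: powr_add[symmetric])
        also have "\<dots> \<le> g k z" unfolding g_def using elim by (intro mult_left_mono) auto
        finally show ?case .
      qed
      then have "1 \<le> liminf (\<lambda>k. g k z)" by (rule Liminf_bounded)
      with elim show False by simp
    qed
  qed
qed

lemma dominated_slices_lower_minkowski_dim:
  assumes "0 \<le> \<tau>" "\<forall>k. of_nat (covering_number E ((1/2) ^ k)) \<le> D k"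
    and "\<forall>n::nat. \<exists>\<^sub>F k in sequentially. D k \<le> ennreal ((2 ^ k) powr (\<tau> + 1 / (real n + 1)))"
  shows "lower_minkowski_dim E \<le> ereal \<tau>"
proof (rule lower_minkowski_dim_le[OF assms(1)], intro allI)
  fix n :: nat
  show "\<exists>\<^sub>F k in sequentially. real (covering_number E ((1/2) ^ k)) \<le> (2 ^ k) powr (\<tau> + 1 / (real n + 1))"
  proof (rule frequently_mono[OF _ spec[OF assms(3), of n]], intro allI impI)
    fix k assume "D k \<le> ennreal ((2 ^ k) powr (\<tau> + 1 / (real n + 1)))"
    then have "of_nat (covering_number E ((1/2) ^ k)) \<le> ennreal ((2 ^ k) powr (\<tau> + 1 / (real n + 1)))"
      using assms(2) by (meson order_trans)
    then show "real (covering_number E ((1/2) ^ k)) \<le> (2 ^ k) powr (\<tau> + 1 / (real n + 1))"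
      by (simp add: ennreal_of_nat_eq_real_of_nat ennreal_le_iff)
  qed
qed

text \<open>The Frostman measure of mass W on a net of E has energy constant of order W. It
  integrates the averages to at least W \<epsilon>^(-\<tau>-\<eta>), while the estimate allows at
  most order sqrt(W) \<epsilon>^(-\<tau>). Hence W is at most of order \<epsilon>^(2\<eta>), and W
  bounds the content of the cover that comes with the measure.\<close>

lemma content_of_large_averages:
  fixes E :: "'a::euclidean_space set" and f :: "'a \<Rightarrow> real \<Rightarrow> ennreal"
  assumes est: "gauss_estimate \<sigma> \<tau> C f \<epsilon>" and C: "0 < C" and \<sigma>: "0 \<le> \<sigma>" and \<epsilon>: "0 < \<epsilon>"
    and f: "(\<lambda>(x, t). f x t) \<in> borel_measurable (borel \<Otimes>\<^sub>M borel)"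
    and E: "bounded E" and large: "\<And>x. x \<in> E \<Longrightarrow> ennreal ((1 / \<epsilon>) powr (\<tau> + \<eta>)) \<le> (\<integral>\<^sup>+t\<in>{1..2}. f x t \<partial>lborel)"
  shows "\<exists>\<G>. finite \<G> \<and> E \<subseteq> \<Union>\<G> \<and> (\<forall>U\<in>\<G>. bounded U) \<and>
    (\<Sum>U\<in>\<G>. diameter U powr \<sigma>) \<le> 6 powr \<sigma> * (C\<^sup>2 * (2 powr \<sigma> * layer_const \<sigma>)) * \<epsilon> powr (2 * \<eta>)"
proof -
  obtain X where X: "finite X" "X \<subseteq> E" "separated_by \<epsilon> X" "E \<subseteq> (\<Union>x\<in>X. ball x \<epsilon>)"
    by (rule maximal_separated[OF E \<epsilon>])
  obtain w \<G> where w: "\<And>x. 0 \<le> w x" "\<And>z r. \<epsilon> \<le> r \<Longrightarrow> sum w (X \<inter> ball z r) \<le> (2 * r) powr \<sigma>"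
    and \<G>: "finite \<G>" "(\<Union>x\<in>X. ball x \<epsilon>) \<subseteq> \<Union>\<G>" "\<And>U. U \<in> \<G> \<Longrightarrow> bounded U"
      "(\<Sum>U\<in>\<G>. diameter U powr \<sigma>) \<le> 6 powr \<sigma> * sum w X"
    using discrete_frostman[OF X(1) \<epsilon> \<sigma>] by metis
  define W where "W = sum w X"
  have W: "0 \<le> W" unfolding W_def by (intro sum_nonneg w)
  define Q where "Q = 2 powr \<sigma> * layer_const \<sigma>"
  have Q: "0 < Q" using layer_const_pos[OF \<sigma>] by (simp add: Q_def)
  let ?\<mu> = "point_masses X w"
  have \<mu>: "finite_measure ?\<mu>" "sets ?\<mu> = sets borel"
    by (auto intro: finite_point_masses X w simp: sets_point_masses)
  have energy: "gauss_energy ?\<mu> ?\<mu> \<rho> \<le> ennreal ((Q * W) * \<rho> powr \<sigma>)" if \<rho>: "\<epsilon> \<le> \<rho>" for \<rho>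
  proof -
    have growth: "emeasure ?\<mu> (ball x r) \<le> ennreal (2 powr \<sigma> * r powr \<sigma>)" if "\<rho> \<le> r" for x r
    proof -
      have "emeasure ?\<mu> (ball x r) = ennreal (sum w (X \<inter> ball x r))"
        by (rule emeasure_point_masses) (use X w in auto)
      also have "\<dots> \<le> ennreal ((2 * r) powr \<sigma>)" using w(2)[of r x] that \<rho> by (intro ennreal_leI) simp
      finally show ?thesis by (simp add: powr_mult)
    qed
    have "gauss_energy ?\<mu> ?\<mu> \<rho> \<le> ennreal (2 powr \<sigma> * layer_const \<sigma> * \<rho> powr \<sigma>) * emeasure ?\<mu> UNIV"
      by (rule gauss_energy_le_growth[OF \<mu>(2) \<sigma>]) (use \<rho> \<epsilon> growth in auto)
    also have "emeasure ?\<mu> UNIV = ennreal W"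
      using emeasure_point_masses[OF X(1), of UNIV w] w(1) by (simp add: W_def)
    also have "ennreal (2 powr \<sigma> * layer_const \<sigma> * \<rho> powr \<sigma>) * ennreal W = ennreal ((Q * W) * \<rho> powr \<sigma>)"
      using Q W by (subst ennreal_mult[symmetric]) (auto simp: Q_def mult_ac less_imp_le zero_less_mult_iff)
    finally show ?thesis .
  qed
  have "ennreal (W * (1 / \<epsilon>) powr (\<tau> + \<eta>)) = (\<Sum>x\<in>X. ennreal (w x) * ennreal ((1 / \<epsilon>) powr (\<tau> + \<eta>)))"
    using w(1) by (simp add: W_def sum_distrib_right ennreal_mult''[symmetric])
  also have "\<dots> \<le> (\<Sum>x\<in>X. ennreal (w x) * (\<integral>\<^sup>+t\<in>{1..2}. f x t \<partial>lborel))"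
    using X(2) by (intro sum_mono mult_left_mono large) auto
  also have "\<dots> = (\<integral>\<^sup>+x. (\<integral>\<^sup>+t\<in>{1..2}. f x t \<partial>lborel) \<partial>?\<mu>)"
  proof (rule nn_integral_point_masses[OF X(1), symmetric])
    note [measurable] = f
    show "(\<lambda>x. \<integral>\<^sup>+t\<in>{1..2}. f x t \<partial>lborel) \<in> borel_measurable borel" by measurable
  qed
  also have "\<dots> \<le> ennreal (C * sqrt (Q * W) * (1 / \<epsilon>) powr \<tau>)"
    using est \<mu> energy Q W unfolding gauss_estimate_def by auto
  finally have "W * (1 / \<epsilon>) powr (\<tau> + \<eta>) \<le> C * sqrt (Q * W) * (1 / \<epsilon>) powr \<tau>"
    using C Q W by (subst (asm) ennreal_le_iff) auto
  then have "(W * (1 / \<epsilon>) powr \<eta>) * (1 / \<epsilon>) powr \<tau> \<le> (C * sqrt (Q * W)) * (1 / \<epsilon>) powr \<tau>"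
    by (simp add: powr_add mult_ac)
  then have "W * (1 / \<epsilon>) powr \<eta> \<le> C * sqrt (Q * W)"
    using \<epsilon> by (simp add: mult_le_cancel_right)
  then have "W \<le> C * sqrt (Q * W) * \<epsilon> powr \<eta>"
    using \<epsilon> by (simp add: powr_divide divide_le_eq)
  also have "\<dots> = (C * sqrt Q * \<epsilon> powr \<eta>) * sqrt W" by (simp add: real_sqrt_mult)
  finally have "sqrt W * sqrt W \<le> (C * sqrt Q * \<epsilon> powr \<eta>) * sqrt W" using W by simp
  then have "sqrt W \<le> C * sqrt Q * \<epsilon> powr \<eta>"
  proof (cases "W = 0")
    case False
    then have "0 < sqrt W" using W by simp
    with \<open>sqrt W * sqrt W \<le> (C * sqrt Q * \<epsilon> powr \<eta>) * sqrt W\<close> show ?thesis by (rule mult_right_le_imp_le)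
  qed (use C Q in auto)
  then have "(sqrt W)\<^sup>2 \<le> (C * sqrt Q * \<epsilon> powr \<eta>)\<^sup>2" using W by (intro power_mono) auto
  also have "\<dots> = C\<^sup>2 * Q * \<epsilon> powr (2 * \<eta>)"
  proof -
    have "\<epsilon> powr (2 * \<eta>) = (\<epsilon> powr \<eta>)\<^sup>2" by (simp only: mult_2 powr_add power2_eq_square)
    then show ?thesis using Q by (simp add: power_mult_distrib)
  qed
  finally have "W \<le> C\<^sup>2 * Q * \<epsilon> powr (2 * \<eta>)" using W by simp
  then have "6 powr \<sigma> * W \<le> 6 powr \<sigma> * (C\<^sup>2 * Q * \<epsilon> powr (2 * \<eta>))" by (intro mult_left_mono) auto
  with \<G>(4) have "(\<Sum>U\<in>\<G>. diameter U powr \<sigma>) \<le> 6 powr \<sigma> * (C\<^sup>2 * Q * \<epsilon> powr (2 * \<eta>))"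
    unfolding W_def by (rule order_trans)
  then have "(\<Sum>U\<in>\<G>. diameter U powr \<sigma>) \<le> 6 powr \<sigma> * (C\<^sup>2 * Q) * \<epsilon> powr (2 * \<eta>)"
    by (simp only: mult.assoc)
  then show ?thesis using \<G>(1-3) X(4) unfolding Q_def by (intro exI[of _ \<G>]) auto
qed

text \<open>Each large dyadic scale by itself supplies a finite cover of all of E, and the contents
  of these covers tend to 0.\<close>

lemma content_null_large_averages:
  fixes E :: "'a::euclidean_space set" and f :: "'a \<Rightarrow> real \<Rightarrow> real \<Rightarrow> ennreal"
  assumes est: "\<And>\<epsilon>. 0 < \<epsilon> \<Longrightarrow> \<epsilon> \<le> 1 \<Longrightarrow> gauss_estimate \<sigma> \<tau> C (\<lambda>x t. f x t \<epsilon>) \<epsilon>" and C: "0 < C" and \<sigma>: "0 \<le> \<sigma>" and \<eta>: "0 < \<eta>"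
    and f: "\<And>\<epsilon>. (\<lambda>(x, t). f x t \<epsilon>) \<in> borel_measurable (borel \<Otimes>\<^sub>M borel)"
    and E: "bounded E"
    and large: "\<And>x k. x \<in> E \<Longrightarrow> K \<le> k \<Longrightarrow> ennreal ((2 ^ k) powr (\<tau> + \<eta>)) \<le> (\<integral>\<^sup>+t\<in>{1..2}. f x t ((1/2) ^ k) \<partial>lborel)"
  shows "content_null \<sigma> E"
proof (rule content_nullI_finite)
  fix e :: real assume e: "0 < e"
  define Q where "Q = 6 powr \<sigma> * (C\<^sup>2 * (2 powr \<sigma> * layer_const \<sigma>))"
  have Q: "0 < Q" using C layer_const_pos[OF \<sigma>] by (simp add: Q_def)
  have "0 < 2 * \<eta>" using \<eta> by simp
  then obtain \<epsilon>0 where \<epsilon>0: "0 < \<epsilon>0" "\<epsilon>0 \<le> 1" "Q * \<epsilon>0 powr (2 * \<eta>) \<le> e"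
    by (rule small_power_exists[OF Q e])
  obtain k0 where k0: "(1/2 :: real) ^ k0 < \<epsilon>0" using real_arch_pow_inv[OF \<epsilon>0(1), of "1/2"] by auto
  define k where "k = max k0 K"
  define \<epsilon> where "\<epsilon> = (1/2 :: real) ^ k"
  have "(1/2 :: real) ^ k \<le> (1/2) ^ k0" by (intro power_decreasing) (auto simp: k_def)
  with k0 have "\<epsilon> \<le> \<epsilon>0" unfolding \<epsilon>_def by linarith
  then have \<epsilon>: "0 < \<epsilon>" "\<epsilon> \<le> 1" "\<epsilon> \<le> \<epsilon>0" by (auto simp: \<epsilon>_def power_le_one)
  have inv: "1 / \<epsilon> = 2 ^ k" by (simp add: \<epsilon>_def power_one_over)
  have big: "ennreal ((1 / \<epsilon>) powr (\<tau> + \<eta>)) \<le> (\<integral>\<^sup>+t\<in>{1..2}. f x t \<epsilon> \<partial>lborel)" if "x \<in> E" for x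
    unfolding inv unfolding \<epsilon>_def by (rule large[OF that]) (simp add: k_def)
  obtain \<G> where \<G>: "finite \<G>" "E \<subseteq> \<Union>\<G>" "\<forall>U\<in>\<G>. bounded U" "(\<Sum>U\<in>\<G>. diameter U powr \<sigma>) \<le> Q * \<epsilon> powr (2 * \<eta>)"
  proof -
    have "\<exists>\<G>. finite \<G> \<and> E \<subseteq> \<Union>\<G> \<and> (\<forall>U\<in>\<G>. bounded U) \<and> (\<Sum>U\<in>\<G>. diameter U powr \<sigma>) \<le> Q * \<epsilon> powr (2 * \<eta>)"
      unfolding Q_def by (rule content_of_large_averages[OF est[OF \<epsilon>(1,2)] C \<sigma> \<epsilon>(1) f E big])
    then show ?thesis using that by (elim exE conjE)
  qed
  have "Q * \<epsilon> powr (2 * \<eta>) \<le> Q * \<epsilon>0 powr (2 * \<eta>)"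
    using \<epsilon> Q \<eta> by (intro mult_left_mono powr_mono2) auto
  then have "(\<Sum>U\<in>\<G>. diameter U powr \<sigma>) \<le> e" using \<G>(4) \<epsilon>0(3) by linarith
  then show "\<exists>\<G>. finite \<G> \<and> E \<subseteq> \<Union>\<G> \<and> (\<forall>U\<in>\<G>. bounded U) \<and> (\<Sum>U\<in>\<G>. diameter U powr \<sigma>) \<le> e"
    using \<G> by (intro exI[of _ \<G>]) simp
qed

text \<open>For \<alpha> <= 0 the Gaussian kernel is at most 1 and \<mu> has mass 1, which is the
  bound with exponent 0.\<close>

lemma gauss_energy_le_if_riesz_energy_finite:
  fixes \<mu> :: "'a::euclidean_space measure"
  assumes "prob_space \<mu>" "sets \<mu> = sets borel" and fin: "riesz_energy \<alpha> \<mu> < \<infinity>"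
  shows "\<exists>L\<ge>0. \<forall>\<rho>>0. gauss_energy \<mu> \<mu> \<rho> \<le> ennreal (L * \<rho> powr max \<alpha> 0)"
proof (cases "0 < \<alpha>")
  case True
  interpret prob_space \<mu> by fact
  define L where "L = \<alpha> powr (\<alpha> / 2) * enn2real (riesz_energy \<alpha> \<mu>)"
  have "gauss_energy \<mu> \<mu> \<rho> \<le> ennreal (L * \<rho> powr max \<alpha> 0)" if "0 < \<rho>" for \<rho>
  proof -
    have "gauss_energy \<mu> \<mu> \<rho> \<le> ennreal (\<alpha> powr (\<alpha> / 2) * \<rho> powr \<alpha>) * riesz_energy \<alpha> \<mu>"
      by (rule gauss_energy_le_riesz_energy[OF finite_measure_axioms assms(2) True that])
    also have "riesz_energy \<alpha> \<mu> = ennreal (enn2real (riesz_energy \<alpha> \<mu>))"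
      using fin by simp
    also have "ennreal (\<alpha> powr (\<alpha> / 2) * \<rho> powr \<alpha>) * ennreal (enn2real (riesz_energy \<alpha> \<mu>)) = ennreal (L * \<rho> powr max \<alpha> 0)"
      using True by (subst ennreal_mult[symmetric]) (auto simp: L_def mult_ac)
    finally show ?thesis .
  qed
  then show ?thesis by (intro exI[of _ L]) (simp add: L_def)
next
  case False
  interpret prob_space \<mu> by fact
  have "gauss_energy \<mu> \<mu> \<rho> \<le> ennreal (1 * \<rho> powr max \<alpha> 0)" if "0 < \<rho>" for \<rho>
  proof -
    have "gauss_energy \<mu> \<mu> \<rho> \<le> (\<integral>\<^sup>+x. (\<integral>\<^sup>+y. 1 \<partial>\<mu>) \<partial>\<mu>)"
      unfolding gauss_energy_def by (intro nn_integral_mono) auto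
    then show ?thesis using False that by (simp add: emeasure_space_1)
  qed
  then show ?thesis by (intro exI[of _ 1]) simp
qed

text \<open>Empty slices have dimension 0, so this confines the exceptional set to a ball, where
  finite nets exist.\<close>

lemma slice_nonempty_bounded:
  fixes A B :: "'a::euclidean_space set"
  assumes "bounded A" "bounded B"
  shows "\<exists>R. \<forall>x. \<forall>t\<in>{1..2}. slice A B x t \<noteq> {} \<longrightarrow> x \<in> ball 0 R"
proof -
  obtain RA RB where R: "\<And>a. a \<in> A \<Longrightarrow> norm a \<le> RA" "\<And>b. b \<in> B \<Longrightarrow> norm b \<le> RB"
    using assms unfolding bounded_iff by metis
  show ?thesis
  proof (intro exI allI ballI impI)
    fix x :: 'a and t :: real assume t: "t \<in> {1..2}" and "slice A B x t \<noteq> {}"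
    then obtain b where b: "b \<in> B" "x - t *\<^sub>R b \<in> A" by (auto simp: slice_def)
    have "norm x \<le> norm (x - t *\<^sub>R b) + norm (t *\<^sub>R b)"
      using norm_triangle_ineq[of "x - t *\<^sub>R b" "t *\<^sub>R b"] by simp
    also have "norm (t *\<^sub>R b) \<le> 2 * norm b" using t by (auto intro: mult_right_mono)
    finally have "norm x \<le> RA + 2 * RB" using R(1)[OF b(2)] R(2)[OF b(1)] by linarith
    then show "x \<in> ball 0 (RA + 2 * RB + 1)" by simp
  qed
qed

theorem theorem2p11:
  fixes A B :: "'a::euclidean_space set"
    and \<mu> :: "'a measure"
    and s\<^sub>A s\<^sub>B h \<alpha> :: real
  assumes "2 \<le> DIM('a)"
    and "compact A" and "ahlfors_david_regular s\<^sub>A A"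
    and "compact B" and "ahlfors_david_regular s\<^sub>B B"
    and "real DIM('a) \<le> s\<^sub>A + s\<^sub>B"
    and "prob_space \<mu>"
    and "\<exists>K. compact K \<and> borel_measure_supported_in \<mu> K"
    and "riesz_energy \<alpha> \<mu> < \<infinity>"
    and "hyperplane_size_condition s\<^sub>B h B"
    and "(\<alpha> + s\<^sub>A) / 2 > real DIM('a) - (s\<^sub>B - h)"
  shows "(\<exists>C::real. \<forall>\<epsilon>. 0 < \<epsilon> \<and> \<epsilon> \<le> 1 \<longrightarrow>
            (\<integral>\<^sup>+x. (\<integral>\<^sup>+t\<in>{1..2}. of_nat (covering_number (slice A B x t) \<epsilon>) \<partial>lborel) \<partial>\<mu>)
              \<le> ennreal (C * (1 / \<epsilon>) powr (s\<^sub>A + s\<^sub>B - real DIM('a))))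
       \<and> (AE (t, x) in restrict_space lborel {1..2} \<Otimes>\<^sub>M \<mu>.
            lower_minkowski_dim (slice A B x t) \<le> ereal (s\<^sub>A + s\<^sub>B - real DIM('a)))
       \<and> (AE t in restrict_space lborel {1..2::real}.
            hausdorff_dim {x. (\<integral>\<^sup>+u\<in>{1..2}. e2ennreal (lower_minkowski_dim (slice A B x u)) \<partial>lborel)
                                > ennreal (s\<^sub>A + s\<^sub>B - real DIM('a))}
              \<le> ereal (2 * (real DIM('a) - (s\<^sub>B - h)) - s\<^sub>A))"
proof -
  define d where "d = real DIM('a)"
  define \<tau> where "\<tau> = s\<^sub>A + s\<^sub>B - d"
  define p where "p = s\<^sub>B - h"
  have \<tau>: "0 \<le> \<tau>" using assms(6) by (simp add: \<tau>_def d_def)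
  have h: "0 < h" "h < s\<^sub>B" and dimB: "hausdorff_dim B = ereal s\<^sub>B"
    using assms(10) by (auto simp: hyperplane_size_condition_def)
  have p: "0 < p" and sB: "0 < s\<^sub>B" using h by (auto simp: p_def)
  obtain M where suppM: "borel_measure_supported_in M B" and ADM: "ahlfors_david_bounds s\<^sub>B B (emeasure M)"
    and hyp: "hyperplane_size_bound p M"
    using assms(10) unfolding hyperplane_size_condition_def p_def by blast
  have bddA: "bounded A" and bddB: "bounded B" using assms(2,4) by (auto intro: compact_imp_bounded)
  have diamB: "0 < diameter B"
    by (rule diameter_pos_if_hausdorff_dim_pos[OF bddB]) (use sB dimB in simp)
  note M = ahlfors_david_finite_measure(1)[OF assms(4) suppM ADM diamB]
  have setsM: "sets M = sets borel" using suppM by (simp add: borel_measure_supported_in_def)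
  have dimA: "hausdorff_dim A = ereal s\<^sub>A"
    and ADA: "ahlfors_david_bounds s\<^sub>A A (\<lambda>S. hausdorff_measure s\<^sub>A (A \<inter> S))"
    using assms(3) by (auto simp: ahlfors_david_regular_def)
  have sA: "0 \<le> s\<^sub>A" using hausdorff_dim_nonneg[of A] dimA by (simp add: zero_ereal_def)
  have sAd: "s\<^sub>A \<le> d" using hausdorff_dim_le_DIM[OF bddA] dimA by (simp add: d_def)
  have p1: "p \<le> 1"
  proof -
    obtain R where R: "B \<subseteq> cball 0 R"
      using bounded_subset_ballD[OF bddB, of 0] by (meson ball_subset_cball order_trans)
    have "emeasure M (- cball 0 R) \<le> emeasure M (- B)"
      using R compact_imp_closed[OF assms(4)] by (intro emeasure_mono) (auto simp: setsM)
    then have "emeasure M (- cball 0 R) = 0" using suppM by (simp add: borel_measure_supported_in_def)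
    then show ?thesis
      by (rule hyperplane_size_bound_le_1[OF assms(1) setsM hyp _ ahlfors_david_finite_measure(2)[OF assms(4) suppM ADM diamB]])
  qed
  interpret \<mu>: prob_space \<mu> by (rule assms(7))
  have sets\<mu>: "sets \<mu> = sets borel" using assms(8) by (auto simp: borel_measure_supported_in_def)
  note [measurable_cong] = sets\<mu>
  obtain D :: "'a \<Rightarrow> real \<Rightarrow> real \<Rightarrow> ennreal" where
    D_meas: "\<forall>\<epsilon>. (\<lambda>(x, t). D x t \<epsilon>) \<in> borel_measurable (borel \<Otimes>\<^sub>M borel)" and
    D_dom: "\<forall>x t \<epsilon>. t \<in> {1..2} \<longrightarrow> 0 < \<epsilon> \<longrightarrow> \<epsilon> \<le> 1 \<longrightarrow> of_nat (covering_number (slice A B x t) \<epsilon>) \<le> D x t \<epsilon>" and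
    D_int: "\<forall>\<sigma>. real DIM('a) < p + (\<sigma> + s\<^sub>A) / 2 \<longrightarrow> (\<exists>C>0. \<forall>\<epsilon>. 0 < \<epsilon> \<longrightarrow> \<epsilon> \<le> 1 \<longrightarrow>
       gauss_estimate \<sigma> (s\<^sub>A + s\<^sub>B - real DIM('a)) C (\<lambda>x t. D x t \<epsilon>) \<epsilon>)"
    by (rule slice_counting[OF assms(2) ADA sA M setsM ADM diamB hyp p])
  have estimate: "\<exists>C>0. \<forall>\<epsilon>. 0 < \<epsilon> \<longrightarrow> \<epsilon> \<le> 1 \<longrightarrow> gauss_estimate \<sigma> \<tau> C (\<lambda>x t. D x t \<epsilon>) \<epsilon>"
    if "d < p + (\<sigma> + s\<^sub>A) / 2" for \<sigma>
    using D_int that by (simp add: \<tau>_def d_def)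
  have D_meas' [measurable]: "(\<lambda>(x, t). D x t \<epsilon>) \<in> borel_measurable (borel \<Otimes>\<^sub>M borel)" for \<epsilon>
    using D_meas by blast
  have pow: "0 < (1/2 :: real) ^ k" "(1/2 :: real) ^ k \<le> 1" "1 / (1/2 :: real) ^ k = 2 ^ k" for k
    by (auto simp: power_le_one power_one_over)
  have D_dom': "\<forall>k. of_nat (covering_number (slice A B x t) ((1/2) ^ k)) \<le> D x t ((1/2) ^ k)" if "t \<in> {1..2}" for x t
    using D_dom that pow by blast

  obtain L where L: "0 \<le> L" "\<forall>\<rho>>0. gauss_energy \<mu> \<mu> \<rho> \<le> ennreal (L * \<rho> powr max \<alpha> 0)"
    using gauss_energy_le_if_riesz_energy_finite[OF assms(7) sets\<mu> assms(9)] by blast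
  \<comment> \<open>Replacing \<alpha> by max \<alpha> 0 only increases the left-hand side, so the
    strict inequality persists.\<close>
  have "(\<alpha> + s\<^sub>A) / 2 \<le> (max \<alpha> 0 + s\<^sub>A) / 2" by simp
  then have "d < p + (max \<alpha> 0 + s\<^sub>A) / 2" using assms(11) unfolding p_def d_def by linarith
  then obtain C where C: "C > 0" "\<forall>\<epsilon>. 0 < \<epsilon> \<longrightarrow> \<epsilon> \<le> 1 \<longrightarrow> gauss_estimate (max \<alpha> 0) \<tau> C (\<lambda>x t. D x t \<epsilon>) \<epsilon>"
    using estimate by blast
  have int_\<mu>: "(\<integral>\<^sup>+x. (\<integral>\<^sup>+t\<in>{1..2}. D x t \<epsilon> \<partial>lborel) \<partial>\<mu>) \<le> ennreal (C * sqrt L * (1 / \<epsilon>) powr \<tau>)"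
    if \<epsilon>: "0 < \<epsilon>" "\<epsilon> \<le> 1" for \<epsilon>
  proof -
    have "gauss_estimate (max \<alpha> 0) \<tau> C (\<lambda>x t. D x t \<epsilon>) \<epsilon>" using C \<epsilon> by blast
    then show ?thesis
      unfolding gauss_estimate_def using L \<epsilon> \<mu>.finite_measure_axioms sets\<mu> by auto
  qed
  let ?N = "\<lambda>\<epsilon>. \<integral>\<^sup>+x. (\<integral>\<^sup>+t\<in>{1..2}. of_nat (covering_number (slice A B x t) \<epsilon>) \<partial>lborel) \<partial>\<mu>"
  have first: "\<exists>C::real. \<forall>\<epsilon>. 0 < \<epsilon> \<and> \<epsilon> \<le> 1 \<longrightarrow>
            ?N \<epsilon>
              \<le> ennreal (C * (1 / \<epsilon>) powr (s\<^sub>A + s\<^sub>B - real DIM('a)))"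
  proof (intro exI allI impI, elim conjE)
    fix \<epsilon> :: real assume \<epsilon>: "0 < \<epsilon>" "\<epsilon> \<le> 1"
    \<comment> \<open>Only monotonicity of the nonnegative integral is applied to the covering
      numbers; measurability enters through D.\<close>
    have "?N \<epsilon>
       \<le> (\<integral>\<^sup>+x. (\<integral>\<^sup>+t\<in>{1..2}. D x t \<epsilon> \<partial>lborel) \<partial>\<mu>)"
      using D_dom \<epsilon> by (intro nn_integral_mono) (auto simp: indicator_def)
    also have "\<dots> \<le> ennreal (C * sqrt L * (1 / \<epsilon>) powr \<tau>)" by (rule int_\<mu>[OF \<epsilon>])
    finally show "?N \<epsilon>
       \<le> ennreal (C * sqrt L * (1 / \<epsilon>) powr (s\<^sub>A + s\<^sub>B - real DIM('a)))" by (simp add: \<tau>_def d_def)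
  qed

  let ?T = "restrict_space lborel {1..2::real}"
  have T_finite: "finite_measure ?T"
    by (intro finite_measureI) (simp add: space_restrict_space emeasure_restrict_space)
  interpret T: finite_measure ?T by (rule T_finite)
  interpret T\<mu>: pair_sigma_finite ?T \<mu> ..
  have id_T [measurable]: "(\<lambda>t. t) \<in> measurable ?T borel" by (rule measurable_restrict_space1) simp
  have D_T [measurable]: "(\<lambda>t. D x t \<epsilon>) \<in> borel_measurable ?T" for x \<epsilon>
  proof -
    have "(\<lambda>t. D x t \<epsilon>) \<in> borel_measurable borel"
      using measurable_compose[OF measurable_Pair1'[of x borel borel] D_meas'] by simp
    then show ?thesis by (intro measurable_restrict_space1) simp
  qed
  have D_T\<mu> [measurable]: "(\<lambda>z. D (snd z) (fst z) \<epsilon>) \<in> borel_measurable (?T \<Otimes>\<^sub>M \<mu>)" for \<epsilon>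
  proof -
    have "(\<lambda>z. (snd z, fst z)) \<in> measurable (?T \<Otimes>\<^sub>M \<mu>) (borel \<Otimes>\<^sub>M borel)"
      by (rule measurable_Pair[OF _ measurable_compose[OF measurable_fst id_T]])
         (simp add: measurable_snd measurable_cong_sets[OF refl sets\<mu>, symmetric])
    from measurable_compose[OF this D_meas'] show ?thesis by simp
  qed
  have T_int: "(\<integral>\<^sup>+t. f t \<partial>?T) = (\<integral>\<^sup>+t\<in>{1..2}. f t \<partial>lborel)" for f :: "real \<Rightarrow> ennreal"
    by (rule nn_integral_restrict_space) simp
  have second: "AE (t, x) in ?T \<Otimes>\<^sub>M \<mu>. lower_minkowski_dim (slice A B x t) \<le> ereal (s\<^sub>A + s\<^sub>B - real DIM('a))"
  proof -
    have "(\<integral>\<^sup>+z. D (snd z) (fst z) ((1/2) ^ k) \<partial>(?T \<Otimes>\<^sub>M \<mu>)) \<le> ennreal (C * sqrt L * (2 ^ k) powr (\<tau> + 1 / (real n + 1)))" for k n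
    proof -
      have "(\<integral>\<^sup>+z. D (snd z) (fst z) ((1/2) ^ k) \<partial>(?T \<Otimes>\<^sub>M \<mu>)) = (\<integral>\<^sup>+x. (\<integral>\<^sup>+t. D x t ((1/2) ^ k) \<partial>?T) \<partial>\<mu>)"
        using T\<mu>.nn_integral_snd[of "\<lambda>z. D (snd z) (fst z) ((1/2) ^ k)"] by simp
      also have "\<dots> \<le> ennreal (C * sqrt L * (2 ^ k) powr \<tau>)"
        unfolding T_int using int_\<mu>[OF pow(1,2), of k] unfolding pow(3) .
      also have "\<dots> \<le> ennreal (C * sqrt L * (2 ^ k) powr (\<tau> + 1 / (real n + 1)))"
        using C L by (intro ennreal_leI mult_left_mono powr_mono) auto
      finally show ?thesis .
    qed
    then have "AE z in ?T \<Otimes>\<^sub>M \<mu>. \<forall>n::nat. \<exists>\<^sub>F k in sequentially.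
        D (snd z) (fst z) ((1/2) ^ k) \<le> ennreal ((2 ^ k) powr (\<tau> + 1 / (real n + 1)))"
      by (intro AE_frequently_le[where C = "C * sqrt L"] D_T\<mu>) auto
    then show ?thesis
    proof (rule AE_mp, intro AE_I2 impI)
      fix z assume "z \<in> space (?T \<Otimes>\<^sub>M \<mu>)"
        and *: "\<forall>n::nat. \<exists>\<^sub>F k in sequentially. D (snd z) (fst z) ((1/2) ^ k) \<le> ennreal ((2 ^ k) powr (\<tau> + 1 / (real n + 1)))"
      then have "fst z \<in> {1..2}" by (auto simp: space_pair_measure space_restrict_space)
      from dominated_slices_lower_minkowski_dim[OF \<tau> D_dom'[OF this] *]
      show "case z of (t, x) \<Rightarrow> lower_minkowski_dim (slice A B x t) \<le> ereal (s\<^sub>A + s\<^sub>B - real DIM('a))"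
        by (simp add: split_beta \<tau>_def d_def)
    qed
  qed

  define E where "E = {x. (\<integral>\<^sup>+u\<in>{1..2}. e2ennreal (lower_minkowski_dim (slice A B x u)) \<partial>lborel) > ennreal \<tau>}"
  obtain R where R: "\<forall>x. \<forall>t\<in>{1..2}. slice A B x t \<noteq> {} \<longrightarrow> x \<in> ball 0 R"
    using slice_nonempty_bounded[OF bddA bddB] by blast
  \<comment> \<open>The negated integral hypothesis of \<open>AE_frequently_le\<close> supplies one
    n and a threshold K, so countably many of these sets exhaust E.\<close>
  define F where "F = (\<lambda>n K. {x \<in> ball 0 R. \<forall>k\<ge>K. ennreal ((2 ^ k) powr (\<tau> + 1 / (real n + 1)))
     \<le> (\<integral>\<^sup>+t\<in>{1..2}. D x t ((1/2) ^ k) \<partial>lborel)})"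
  have E_sub: "E \<subseteq> (\<Union>n::nat. \<Union>K::nat. F n K)"
  proof
    fix x assume x: "x \<in> E"
    have "\<exists>t\<in>{1..2}. slice A B x t \<noteq> {}"
    proof (rule ccontr)
      assume "\<not> ?thesis"
      then have "(\<integral>\<^sup>+u\<in>{1..2}. e2ennreal (lower_minkowski_dim (slice A B x u)) \<partial>lborel) = (\<integral>\<^sup>+u. 0 \<partial>(lborel :: real measure))"
        by (intro nn_integral_cong) (auto simp: indicator_def lower_minkowski_dim_def)
      with x show False by (simp add: E_def)
    qed
    then have xR: "x \<in> ball 0 R" using R by blast
    \<comment> \<open>Otherwise the dimension of the slice is at most \<tau> for almost every t, and
      since [1,2] has length 1 its integral over t could not exceed \<tau>.\<close>
    have "\<not> (\<forall>n::nat. \<exists>\<^sub>F k in sequentially. (\<integral>\<^sup>+t. D x t ((1/2) ^ k) \<partial>?T) \<le> ennreal (1 * (2 ^ k) powr (\<tau> + 1 / (real n + 1))))"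
    proof
      assume "\<forall>n::nat. \<exists>\<^sub>F k in sequentially. (\<integral>\<^sup>+t. D x t ((1/2) ^ k) \<partial>?T) \<le> ennreal (1 * (2 ^ k) powr (\<tau> + 1 / (real n + 1)))"
      then have "AE t in ?T. \<forall>n::nat. \<exists>\<^sub>F k in sequentially. D x t ((1/2) ^ k) \<le> ennreal ((2 ^ k) powr (\<tau> + 1 / (real n + 1)))"
        by (rule AE_frequently_le[OF D_T])
      then have "AE t in ?T. e2ennreal (lower_minkowski_dim (slice A B x t)) \<le> ennreal \<tau>"
      proof (rule AE_mp, intro AE_I2 impI)
        fix t assume "t \<in> space ?T"
          and *: "\<forall>n::nat. \<exists>\<^sub>F k in sequentially. D x t ((1/2) ^ k) \<le> ennreal ((2 ^ k) powr (\<tau> + 1 / (real n + 1)))"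
        then have "t \<in> {1..2}" by (simp add: space_restrict_space)
        from dominated_slices_lower_minkowski_dim[OF \<tau> D_dom'[OF this] *]
        have "e2ennreal (lower_minkowski_dim (slice A B x t)) \<le> e2ennreal (ereal \<tau>)" by (rule e2ennreal_mono)
        then show "e2ennreal (lower_minkowski_dim (slice A B x t)) \<le> ennreal \<tau>" by (simp add: ennreal.rep_eq)
      qed
      then have "(\<integral>\<^sup>+t. e2ennreal (lower_minkowski_dim (slice A B x t)) \<partial>?T) \<le> (\<integral>\<^sup>+t. ennreal \<tau> \<partial>?T)"
        by (rule nn_integral_mono_AE)
      also have "\<dots> = ennreal \<tau>" by (simp add: space_restrict_space emeasure_restrict_space)
      finally show False using x unfolding T_int E_def by simp
    qed
    then obtain n :: nat where "\<forall>\<^sub>F k in sequentially. \<not> (\<integral>\<^sup>+t. D x t ((1/2) ^ k) \<partial>?T) \<le> ennreal (1 * (2 ^ k) powr (\<tau> + 1 / (real n + 1)))"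
      by (auto simp: frequently_def)
    then obtain K where "\<And>k. k \<ge> K \<Longrightarrow> \<not> (\<integral>\<^sup>+t. D x t ((1/2) ^ k) \<partial>?T) \<le> ennreal (1 * (2 ^ k) powr (\<tau> + 1 / (real n + 1)))"
      unfolding eventually_sequentially by blast
    then have "x \<in> F n K" using xR unfolding F_def T_int by (auto simp: not_le less_imp_le)
    then show "x \<in> (\<Union>n::nat. \<Union>K::nat. F n K)" by blast
  qed
  \<comment> \<open>2(d - p) - s_A >= 2(d - 1) - d = d - 2 >= 0. The exponents in
    \<open>hausdorff_dim\<close> are nonnegative, so the bound could not hold below 0.\<close>
  have dim_nonneg: "0 \<le> 2 * (d - p) - s\<^sub>A"
    using sAd p1 assms(1) by (simp add: d_def)
  have "content_null \<sigma> E" if \<sigma>: "2 * (d - p) - s\<^sub>A < \<sigma>" for \<sigma>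
  proof -
    have \<sigma>0: "0 \<le> \<sigma>" using \<sigma> dim_nonneg by linarith
    have "d < p + (\<sigma> + s\<^sub>A) / 2" using \<sigma> by (simp add: field_simps)
    then obtain C where C: "C > 0" "\<forall>\<epsilon>. 0 < \<epsilon> \<longrightarrow> \<epsilon> \<le> 1 \<longrightarrow> gauss_estimate \<sigma> \<tau> C (\<lambda>x t. D x t \<epsilon>) \<epsilon>"
      using estimate by blast
    have "content_null \<sigma> (F n K)" for n K
    proof (rule content_null_large_averages[OF _ C(1) \<sigma>0, where \<eta> = "1 / (real n + 1)" and f = D and K = K])
      show "bounded (F n K)" by (rule bounded_subset[OF bounded_ball[of 0 R]]) (auto simp: F_def)
    qed (use C(2) D_meas' in \<open>auto simp: F_def\<close>)
    then have "content_null \<sigma> (\<Union>n::nat. \<Union>K::nat. F n K)" by (intro content_null_UN)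
    then show ?thesis using E_sub by (rule content_null_subset)
  qed
  then have "hausdorff_dim E \<le> ereal (2 * (d - p) - s\<^sub>A)"
    by (rule hausdorff_dim_le[OF dim_nonneg])
  \<comment> \<open>The outer t does not occur in E, so the bound holds at every t.\<close>
  then have third: "AE t in ?T.
            hausdorff_dim {x. (\<integral>\<^sup>+u\<in>{1..2}. e2ennreal (lower_minkowski_dim (slice A B x u)) \<partial>lborel)
                                > ennreal (s\<^sub>A + s\<^sub>B - real DIM('a))}
              \<le> ereal (2 * (real DIM('a) - (s\<^sub>B - h)) - s\<^sub>A)"
    by (simp add: E_def \<tau>_def d_def p_def)
  show ?thesis using first second third by blast
qed

end
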